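(* Let $(M^n,g,e^{-f}dV)$, $m>n\ge3$, $k>0$, $p$, $G$, $s$, $v$ be as in the context. Let $U\subset M\setminus\{p\}$ be a connected open set on which $\nabla s\ne0$ and on which, with $\psi=\frac{\Delta s^2}{n}$, $$\mathrm{Hess}\,s^2=\psi g,\qquad\langle\nabla f,\nabla s^2\rangle=-(m-n)\psi,\qquad\bigl(\mathrm{Ric}_f^m-(m-1)kg\bigr)(\nabla s^2,\nabla s^2)=0 .$$ Then, locally in $U$, there are coordinates $(t,y)$, with $t$ increasing in the direction of $\nabla s$ and $y$ ranging over a transverse level set $\Sigma$ of $s$, a constant $c>0$, a constant $t_0$, a metric $g_\Sigma$ and a function $f_\Sigma$ on $\Sigma$, such that $s^2$ depends only on $t$ and, with $'=\frac{d}{dt}$, $$\bigl((s^2)'\bigr)^2=c\,s^2-ks^4,\qquad s^2=\frac{c}{k}\sin^2\!\Bigl(\frac{\sqrt k\,(t-t_0)}{2}\Bigr),$$ $$g=dt^2+\bigl((s^2)'\bigr)^2g_\Sigma,\qquad f=-(m-n)\log|(s^2)'|+f_\Sigma,\qquad v^2=c,$$ for $t$ in an interval on which $(s^2)'>0$.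
   Context: $(M^n,g)$ is a closed, connected smooth Riemannian manifold, $n\ge3$, $f\in C^\infty(M)$, $m>n$, $k>0$. $\Delta=\mathrm{div}\nabla$, $\Delta_f u=\Delta u-\langle\nabla f,\nabla u\rangle$, $\mathrm{Ric}_f^m=\mathrm{Ric}+\mathrm{Hess}\,f-\frac{df\otimes df}{m-n}$; standing assumption: $\mathrm{Ric}_f^m\ge(m-1)kg$. $p\in M$ is fixed and $G$ is the positive Green function with pole $p$ of $-\Delta_f+\frac{m(m-2)k}{4}$: smooth and positive on $M\setminus\{p\}$, with $\int_M G\,(-\Delta_f\phi+\frac{m(m-2)k}{4}\phi)e^{-f}dV=\kappa\phi(p)$ for all $\phi\in C^\infty(M)$, $\kappa>0$ fixed; in particular $\Delta_fG=\frac{m(m-2)k}{4}G$ on $M\setminus\{p\}$. $s=\frac12G^{1/(2-m)}$, so $G=(2s)^{2-m}$; $v=(4|\nabla s|^2+ks^2)^{1/2}$. *)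

theory Defs
  imports "HOL-Analysis.Analysis"
begin

section \<open>Smooth functions\<close>

text \<open>Both notions are meant for open \<open>S\<close>.\<close>

primrec Ck_on :: "nat \<Rightarrow> 'a::real_normed_vector set \<Rightarrow> ('a \<Rightarrow> 'b::real_normed_vector) \<Rightarrow> bool" where
  "Ck_on 0 S F \<longleftrightarrow> continuous_on S F"
| "Ck_on (Suc r) S F \<longleftrightarrow>
     (\<forall>x\<in>S. F differentiable (at x)) \<and> (\<forall>w. Ck_on r S (\<lambda>x. frechet_derivative F (at x) w))"

definition smooth_on :: "'a::real_normed_vector set \<Rightarrow> ('a \<Rightarrow> 'b::real_normed_vector) \<Rightarrow> bool" where
  "smooth_on S F \<longleftrightarrow> (\<forall>r. Ck_on r S F)"

section \<open>Smooth manifolds\<close>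

text \<open>
  The manifold is the whole of a topological type \<open>'a\<close>, its dimension is \<open>CARD('n)\<close>, and its smooth
  structure is given by an atlas \<open>A\<close>, not necessarily maximal. A chart is a pair of its domain and
  its coordinate map; the values of the map outside the domain are irrelevant.
\<close>

type_synonym ('a, 'n) chart = "'a set \<times> ('a \<Rightarrow> real^'n)"

definition chart_inv :: "('a, 'n::finite) chart \<Rightarrow> real^'n \<Rightarrow> 'a" where
  "chart_inv c = inv_into (fst c) (snd c)"

definition is_chart :: "('a::topological_space, 'n::finite) chart \<Rightarrow> bool" where
  "is_chart c \<longleftrightarrow> open (fst c) \<and> open (snd c ` fst c) \<and>
     homeomorphism (fst c) (snd c ` fst c) (snd c) (chart_inv c)"

definition smooth_atlas :: "('a::topological_space, 'n::finite) chart set \<Rightarrow> bool" where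
  "smooth_atlas A \<longleftrightarrow> (\<forall>c\<in>A. is_chart c) \<and> (\<Union>c\<in>A. fst c) = UNIV \<and>
     (\<forall>c\<in>A. \<forall>d\<in>A. smooth_on (snd c ` (fst c \<inter> fst d)) (snd d \<circ> chart_inv c))"

text \<open>Smoothness on an open subset \<open>W\<close> of the manifold.\<close>

definition smooth_fun ::
    "('a, 'n::finite) chart set \<Rightarrow> 'a set \<Rightarrow> ('a \<Rightarrow> 'b::real_normed_vector) \<Rightarrow> bool" where
  "smooth_fun A W u \<longleftrightarrow> (\<forall>c\<in>A. smooth_on (snd c ` (fst c \<inter> W)) (u \<circ> chart_inv c))"

text \<open>\<open>F\<close> is a diffeomorphism from the open set \<open>V\<close> of the manifold onto the open set \<open>W\<close>.\<close>

definition coordinates_on ::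
    "('a::topological_space, 'n::finite) chart set \<Rightarrow> 'a set \<Rightarrow> 'b::real_normed_vector set \<Rightarrow> ('a \<Rightarrow> 'b) \<Rightarrow> bool" where
  "coordinates_on A V W F \<longleftrightarrow> open V \<and> open W \<and> homeomorphism V W F (inv_into V F) \<and>
     smooth_fun A V F \<and>
     (\<forall>c\<in>A. smooth_on (F ` (V \<inter> fst c)) (snd c \<circ> inv_into V F))"

text \<open>The coordinate derivative of \<open>u\<close> with respect to the \<open>i\<close>-th coordinate of \<open>c\<close>.\<close>

definition pd :: "('a, 'n::finite) chart \<Rightarrow> 'n \<Rightarrow> ('a \<Rightarrow> real) \<Rightarrow> 'a \<Rightarrow> real" where
  "pd c i u x = frechet_derivative (u \<circ> chart_inv c) (at (snd c x)) (axis i 1)"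

text \<open>
  The components in \<open>c\<close>, at \<open>x\<close>, of the pullback along \<open>F\<close> of the bilinear form with matrix \<open>h\<close>.
\<close>

definition pullback ::
    "('a, 'n::finite) chart \<Rightarrow> ('a \<Rightarrow> real^'k) \<Rightarrow> real^'k^'k \<Rightarrow> 'a \<Rightarrow> real^'n^'n" where
  "pullback c F h x =
     (\<chi> i j. \<Sum>a\<in>UNIV. \<Sum>b\<in>UNIV. h $ a $ b * pd c i (\<lambda>y. F y $ a) x * pd c j (\<lambda>y. F y $ b) x)"

section \<open>Riemannian metrics\<close>

text \<open>
  Tensor fields are families of component matrices, or vectors, indexed by the charts: \<open>g c x\<close> is the
  matrix of the metric at \<open>x\<close> in the chart \<open>c\<close>. It is meaningful for \<open>c \<in> A\<close> and \<open>x \<in> fst c\<close>.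
\<close>

type_synonym ('a, 'n) tensor2 = "('a, 'n) chart \<Rightarrow> 'a \<Rightarrow> real^'n^'n"

definition metric_components :: "(real^'n) set \<Rightarrow> (real^'n \<Rightarrow> real^'n^'n) \<Rightarrow> bool" where
  "metric_components W h \<longleftrightarrow> smooth_on W h \<and>
     (\<forall>z\<in>W. transpose (h z) = h z \<and> (\<forall>\<xi>. \<xi> \<noteq> 0 \<longrightarrow> \<xi> \<bullet> (h z *v \<xi>) > 0))"

definition riemannian_metric :: "('a, 'n::finite) chart set \<Rightarrow> ('a, 'n) tensor2 \<Rightarrow> bool" where
  "riemannian_metric A g \<longleftrightarrow>
     (\<forall>c\<in>A. metric_components (snd c ` fst c) (g c \<circ> chart_inv c)) \<and>
     (\<forall>c\<in>A. \<forall>d\<in>A. \<forall>x\<in>fst c \<inter> fst d. g c x = pullback c (snd d) (g d x) x)"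

definition christoffel :: "('a, 'n::finite) tensor2 \<Rightarrow> ('a, 'n) chart \<Rightarrow> 'n \<Rightarrow> 'n \<Rightarrow> 'n \<Rightarrow> 'a \<Rightarrow> real" where
  "christoffel g c l i j x = 1/2 * (\<Sum>r\<in>UNIV. matrix_inv (g c x) $ l $ r *
     (pd c i (\<lambda>y. g c y $ j $ r) x + pd c j (\<lambda>y. g c y $ i $ r) x - pd c r (\<lambda>y. g c y $ i $ j) x))"

definition grad :: "('a, 'n::finite) tensor2 \<Rightarrow> ('a, 'n) chart \<Rightarrow> ('a \<Rightarrow> real) \<Rightarrow> 'a \<Rightarrow> real^'n" where
  "grad g c u x = matrix_inv (g c x) *v (\<chi> i. pd c i u x)"

definition hess :: "('a, 'n::finite) tensor2 \<Rightarrow> ('a \<Rightarrow> real) \<Rightarrow> ('a, 'n) tensor2" where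
  "hess g u c x =
     (\<chi> i j. pd c i (pd c j u) x - (\<Sum>l\<in>UNIV. christoffel g c l i j x * pd c l u x))"

text \<open>The trace of the covariant derivative of the vector field with components \<open>X\<close>.\<close>

definition divergence ::
    "('a, 'n::finite) tensor2 \<Rightarrow> ('a, 'n) chart \<Rightarrow> ('a \<Rightarrow> real^'n) \<Rightarrow> 'a \<Rightarrow> real" where
  "divergence g c X x =
     (\<Sum>i\<in>UNIV. pd c i (\<lambda>y. X y $ i) x + (\<Sum>l\<in>UNIV. christoffel g c i i l x * X x $ l))"

text \<open>Sign convention: round spheres have positive Ricci curvature.\<close>

definition ricci :: "('a, 'n::finite) tensor2 \<Rightarrow> ('a, 'n) tensor2" where
  "ricci g c x = (\<chi> i j. \<Sum>l\<in>UNIV.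
     pd c l (christoffel g c l i j) x - pd c j (christoffel g c l i l) x
     + (\<Sum>r\<in>UNIV. christoffel g c l l r x * christoffel g c r i j x
                 - christoffel g c l j r x * christoffel g c r i l x))"

definition bakry_emery_ricci ::
    "('a, 'n::finite) tensor2 \<Rightarrow> ('a \<Rightarrow> real) \<Rightarrow> real \<Rightarrow> ('a, 'n) tensor2" where
  "bakry_emery_ricci g f m c x = ricci g c x + hess g f c x
     - (1 / (m - real CARD('n))) *\<^sub>R (\<chi> i j. pd c i f x * pd c j f x)"

text \<open>
  The scalars below do not depend on the chart used to compute them, so they are computed in an
  arbitrarily chosen chart around each point.
\<close>

definition chart_at :: "('a, 'n::finite) chart set \<Rightarrow> 'a \<Rightarrow> ('a, 'n) chart" where
  "chart_at A x = (SOME c. c \<in> A \<and> x \<in> fst c)"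

definition grad_inner ::
    "('a, 'n::finite) chart set \<Rightarrow> ('a, 'n) tensor2 \<Rightarrow> ('a \<Rightarrow> real) \<Rightarrow> ('a \<Rightarrow> real) \<Rightarrow> 'a \<Rightarrow> real" where
  "grad_inner A g u w x = (let c = chart_at A x in grad g c u x \<bullet> (g c x *v grad g c w x))"

definition laplacian ::
    "('a, 'n::finite) chart set \<Rightarrow> ('a, 'n) tensor2 \<Rightarrow> ('a \<Rightarrow> real) \<Rightarrow> 'a \<Rightarrow> real" where
  "laplacian A g u x = (let c = chart_at A x in divergence g c (grad g c u) x)"

definition weighted_laplacian ::
    "('a, 'n::finite) chart set \<Rightarrow> ('a, 'n) tensor2 \<Rightarrow> ('a \<Rightarrow> real) \<Rightarrow> ('a \<Rightarrow> real) \<Rightarrow> 'a \<Rightarrow> real" where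
  "weighted_laplacian A g f u x = laplacian A g u x - grad_inner A g f u x"

text \<open>
  The Riemannian measure is the Borel measure with density \<open>sqrt (det g)\<close> in every chart. On a compact
  manifold it exists and is unique.
\<close>

definition riemannian_measure ::
    "('a::topological_space, 'n::finite) chart set \<Rightarrow> ('a, 'n) tensor2 \<Rightarrow> 'a measure" where
  "riemannian_measure A g = (THE \<mu>. sets \<mu> = sets borel \<and>
     (\<forall>c\<in>A. \<forall>B\<in>sets borel. B \<subseteq> fst c \<longrightarrow>
        emeasure \<mu> B = (\<integral>\<^sup>+z\<in>snd c ` B. ennreal (sqrt (det (g c (chart_inv c z)))) \<partial>lborel)))"

section \<open>The Green function\<close>

text \<open>
  \<open>G\<close> is a positive Green function with pole \<open>p\<close> of the operator \<open>- \<Delta>\<^sub>f + a\<close>, normalised by \<open>\<kappa>\<close>; the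
  value of \<open>G\<close> at \<open>p\<close> itself is irrelevant. The last clause is the pointwise equation off the pole, a
  consequence of the weak equation that is recorded along with it.
\<close>

definition green_function ::
    "('a::topological_space, 'n::finite) chart set \<Rightarrow> ('a, 'n) tensor2 \<Rightarrow> ('a \<Rightarrow> real) \<Rightarrow> real \<Rightarrow> real \<Rightarrow>
     'a \<Rightarrow> ('a \<Rightarrow> real) \<Rightarrow> bool" where
  "green_function A g f a \<kappa> p G \<longleftrightarrow>
     smooth_fun A (- {p}) G \<and> (\<forall>x. x \<noteq> p \<longrightarrow> G x > 0) \<and>
     (\<forall>\<phi>. smooth_fun A UNIV \<phi> \<longrightarrow>
        has_bochner_integral (riemannian_measure A g)
          (\<lambda>x. G x * (- weighted_laplacian A g f \<phi> x + a * \<phi> x) * exp (- f x)) (\<kappa> * \<phi> p)) \<and>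
     (\<forall>x. x \<noteq> p \<longrightarrow> weighted_laplacian A g f G x = a * G x)"

definition green_s :: "real \<Rightarrow> ('a \<Rightarrow> real) \<Rightarrow> 'a \<Rightarrow> real" where
  "green_s m G x = 1/2 * G x powr (1 / (2 - m))"

definition green_v ::
    "('a, 'n::finite) chart set \<Rightarrow> ('a, 'n) tensor2 \<Rightarrow> real \<Rightarrow> ('a \<Rightarrow> real) \<Rightarrow> 'a \<Rightarrow> real" where
  "green_v A g k s x = sqrt (4 * grad_inner A g s s x + k * (s x)\<^sup>2)"

end

theory Submission
  imports Defs
begin

text \<open>
  Write \<open>w = s\<^sup>2\<close>. The condition on \<open>f\<close> says that the weighted Laplacian of \<open>w\<close> is \<open>m \<psi>\<close>, so the equation
  for \<open>G = (4 w) powr ((2 - m) / 2)\<close> off the pole becomes \<open>\<bar>\<nabla>w\<bar>\<^sup>2 = k w\<^sup>2 + 2 \<psi> w\<close>. Since \<open>Hess w = \<psi> g\<close> also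
  gives \<open>d \<bar>\<nabla>w\<bar>\<^sup>2 = 2 \<psi> dw\<close>, the function \<open>v\<^sup>2 = \<bar>\<nabla>w\<bar>\<^sup>2 / w + k w\<close> is a constant \<open>c\<close>; hence
  \<open>\<bar>\<nabla>w\<bar>\<^sup>2 = c w - k w\<^sup>2\<close> and \<open>\<psi> = c / 2 - k w\<close>.

  The function \<open>T = 2 / sqrt k * arcsin (sqrt (k w / c))\<close> then has a gradient of length one, proportional to
  \<open>\<nabla>w\<close>, and the flow of \<open>\<nabla>T\<close> gives coordinates \<open>(T, Y)\<close> with \<open>Y\<close> constant along the flow lines. As the Lie
  derivative of \<open>g\<close> along \<open>\<nabla>w\<close> is \<open>2 \<psi> g\<close>, the transverse part of \<open>g\<close> divided by \<open>S'(T)\<^sup>2\<close> is constant along the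
  flow lines, and so is \<open>f + (m - n) ln S'(T)\<close>.

  Smooth dependence of the flow on the initial value is obtained from the Picard iterates: each of their
  spatial derivatives satisfies an affine recursion whose linear part is the same contraction for every
  order, so all derivatives converge locally uniformly.
\<close>

section \<open>Sequences that converge with their derivatives\<close>

text \<open>The constant in the Green operator is what makes \<open>m\<close> drop out: for a = (2 -
  m) / 2 one has a (a - 1) = m (m - 2) / 4 and a m = - 2 a (a - 1), so after division by the common
  factor only k, \<psi> and w remain. The time T is the integral of dw / sqrt (c w - k w^2), the arc
  length of a gradient line measured by the value of w. The metric is known only through component
  matrices in the charts of an atlas. The normal form is therefore established on an open subset of
  R^n for a matrix-valued metric, with the Hessian condition restated as a Lie derivative identity
  in which no inverse matrix occurs; chart changes then carry it to the manifold. Regularity of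
  every order is needed on one and the same flow box. \<open>Ck_on\<close> differentiates in
  constant directions only, so a derivative along a moving direction is expanded in a basis first,
  and smoothness of gradients and of inverse maps is read off from linear systems by Cramer's
  rule.\<close>

abbreviation dir :: "('a::real_normed_vector \<Rightarrow> 'b::real_normed_vector) \<Rightarrow> 'a \<Rightarrow> 'a \<Rightarrow> 'b" where
  "dir F x w \<equiv> frechet_derivative F (at x) w"

lemma dir_eq: "(F has_derivative F') (at x) \<Longrightarrow> dir F x w = F' w"
  by (metis frechet_derivative_at)

lemma has_derivative_dir: "F differentiable (at x) \<Longrightarrow> (F has_derivative dir F x) (at x)"
  by (simp add: frechet_derivative_works)

lemma eq_on_open_derivative:
  assumes "open S" "x \<in> S" "\<And>y. y \<in> S \<Longrightarrow> F y = G y"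
  shows "(F has_derivative F') (at x) \<longleftrightarrow> (G has_derivative F') (at x)"
    and "F differentiable (at x) \<longleftrightarrow> G differentiable (at x)"
    and "dir F x = dir G x"
proof -
  show *: "(F has_derivative D) (at x) \<longleftrightarrow> (G has_derivative D) (at x)" for D
    using assms has_derivative_transform_within_open[of F D x UNIV S G]
      has_derivative_transform_within_open[of G D x UNIV S F] by auto
  show "F differentiable (at x) \<longleftrightarrow> G differentiable (at x)"
    by (simp add: differentiable_def *)
  show "dir F x = dir G x"
    by (simp add: frechet_derivative_def *)
qed

text \<open>Reduces a derivative in a direction that varies with the point to fixed basis
  directions, the kind of direction in which \<open>Ck_on\<close> and \<open>Ck_seq\<close> can be
  differentiated further.\<close>

lemma dir_basis_expansion:
  fixes F :: "'a::euclidean_space \<Rightarrow> 'b::real_normed_vector"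
  assumes "F differentiable (at x)"
  shows "dir F x w = (\<Sum>b\<in>Basis. (w \<bullet> b) *\<^sub>R dir F x b)"
proof -
  have "linear (dir F x)"
    using assms by (rule linear_frechet_derivative)
  then show ?thesis
    by (subst euclidean_representation[symmetric, of w]) (simp only: linear_sum linear_scale)
qed

text \<open>Continuity of the terms is included so that the limit is continuous and the terms are
  jointly bounded on compact sets.\<close>

definition locally_convergent :: "'a::topological_space set \<Rightarrow> (nat \<Rightarrow> 'a \<Rightarrow> 'b::metric_space) \<Rightarrow> bool" where
  "locally_convergent S u \<longleftrightarrow> (\<forall>j. continuous_on S (u j)) \<and>
     (\<forall>C. compact C \<longrightarrow> C \<subseteq> S \<longrightarrow> uniformly_convergent_on C u)"

text \<open>Convergence is carried along with differentiability so that the limit of the Picard iterates of a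
  smooth vector field is smooth without a separate argument for differentiability in the initial value.\<close>

primrec Ck_seq :: "nat \<Rightarrow> 'a::real_normed_vector set \<Rightarrow> (nat \<Rightarrow> 'a \<Rightarrow> 'b::real_normed_vector) \<Rightarrow> bool" where
  "Ck_seq 0 S u \<longleftrightarrow> locally_convergent S u"
| "Ck_seq (Suc r) S u \<longleftrightarrow> locally_convergent S u \<and> (\<forall>j. \<forall>x\<in>S. u j differentiable (at x)) \<and>
     (\<forall>w. Ck_seq r S (\<lambda>j x. dir (u j) x w))"

lemma locally_convergent_cong:
  assumes "\<And>j x. x \<in> S \<Longrightarrow> u j x = v j x"
  shows "locally_convergent S u \<longleftrightarrow> locally_convergent S v"
proof -
  have "continuous_on S (u j) \<longleftrightarrow> continuous_on S (v j)" for j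
    using assms by (intro continuous_on_cong) auto
  moreover have "uniformly_convergent_on C u \<longleftrightarrow> uniformly_convergent_on C v" if "C \<subseteq> S" for C
    using assms that by (intro uniformly_convergent_cong) (auto intro!: always_eventually)
  ultimately show ?thesis
    by (auto simp: locally_convergent_def)
qed

lemma Ck_seq_cong:
  assumes "open S" "\<And>j x. x \<in> S \<Longrightarrow> u j x = v j x"
  shows "Ck_seq r S u \<longleftrightarrow> Ck_seq r S v"
  using assms(2)
proof (induction r arbitrary: u v)
  case 0
  then show ?case using locally_convergent_cong[of S u v] by simp
next
  case (Suc r)
  have "dir (u j) x = dir (v j) x" "u j differentiable (at x) \<longleftrightarrow> v j differentiable (at x)" if "x \<in> S" for j x
    using eq_on_open_derivative[OF \<open>open S\<close> that, of "u j" "v j"] Suc.prems by auto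
  then have "Ck_seq r S (\<lambda>j x. dir (u j) x w) \<longleftrightarrow> Ck_seq r S (\<lambda>j x. dir (v j) x w)" for w
    by (intro Suc.IH) auto
  with Suc.prems locally_convergent_cong[of S u v] show ?case
    using \<open>\<And>x j. x \<in> S \<Longrightarrow> (u j differentiable at x) = (v j differentiable at x)\<close> by simp
qed

lemma Ck_on_cong:
  assumes "open S" "\<And>x. x \<in> S \<Longrightarrow> u x = v x"
  shows "Ck_on r S u \<longleftrightarrow> Ck_on r S v"
  using assms(2)
proof (induction r arbitrary: u v)
  case 0
  then show ?case using continuous_on_cong[of S S u v] by simp
next
  case (Suc r)
  have *: "dir u x = dir v x" "u differentiable (at x) \<longleftrightarrow> v differentiable (at x)" if "x \<in> S" for x
    using eq_on_open_derivative[OF \<open>open S\<close> that, of "u" "v"] Suc.prems by auto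
  then have "Ck_on r S (\<lambda>x. dir u x w) \<longleftrightarrow> Ck_on r S (\<lambda>x. dir v x w)" for w
    by (intro Suc.IH) auto
  with * show ?case by simp
qed

lemma Ck_on_eq:
  assumes "Ck_on r S v" "open S" "\<And>x. x \<in> S \<Longrightarrow> u x = v x"
  shows "Ck_on r S u"
  using assms Ck_on_cong[of S u v r] by simp

lemma Ck_seq_locally_convergent: "Ck_seq r S u \<Longrightarrow> locally_convergent S u"
  by (cases r) auto

lemma Ck_seq_Suc: "Ck_seq (Suc r) S u \<Longrightarrow> Ck_seq r S u"
  by (induction r arbitrary: u) auto

lemma Ck_seq_mono: "Ck_seq r S u \<Longrightarrow> q \<le> r \<Longrightarrow> Ck_seq q S u"
  by (induction r) (auto simp: le_Suc_eq simp del: Ck_seq.simps dest: Ck_seq_Suc)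

lemma Ck_seq_subset: "Ck_seq r S u \<Longrightarrow> S' \<subseteq> S \<Longrightarrow> Ck_seq r S' u"
proof (induction r arbitrary: u)
  case 0
  then show ?case by (auto simp: locally_convergent_def intro: continuous_on_subset)
next
  case (Suc r)
  have "locally_convergent S' u"
    using Suc.prems by (auto simp: locally_convergent_def intro: continuous_on_subset)
  with Suc show ?case by auto
qed

lemma locally_convergent_const: "locally_convergent S (\<lambda>j. u) \<longleftrightarrow> continuous_on S u"
  by (auto simp: locally_convergent_def)

lemma Ck_on_continuous: "Ck_on r S u \<Longrightarrow> continuous_on S u"
  by (cases r) (auto intro!: continuous_at_imp_continuous_on differentiable_imp_continuous_within)

text \<open>Constant sequences embed \<open>Ck_on\<close> into \<open>Ck_seq\<close>, so each
  closure property of sequences yields the corresponding rule for single functions.\<close>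

lemma Ck_seq_const: "Ck_seq r S (\<lambda>j. u) \<longleftrightarrow> Ck_on r S u"
proof (induction r arbitrary: u)
  case (Suc r)
  show ?case
    using Suc.IH[of "\<lambda>x. dir u x _"] Ck_on_continuous[of "Suc r" S u]
    by (auto simp: locally_convergent_const)
qed (simp add: locally_convergent_const)

text \<open>Uniform continuity of \<open>X\<close> comes from compactness, so one compact
  \<open>K\<close> has to contain the images of \<open>C\<close> under all terms
  simultaneously.\<close>

lemma locally_convergent_compose:
  fixes u :: "nat \<Rightarrow> 'a::topological_space \<Rightarrow> 'b::metric_space" and X :: "'b \<Rightarrow> 'c::metric_space"
  assumes X: "continuous_on P X" and u: "locally_convergent S u"
    and K: "\<And>C. compact C \<Longrightarrow> C \<subseteq> S \<Longrightarrow> \<exists>K\<subseteq>P. compact K \<and> (\<forall>j. u j ` C \<subseteq> K)"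
    and uP: "\<And>j. u j ` S \<subseteq> P"
  shows "locally_convergent S (\<lambda>j x. X (u j x))"
  unfolding locally_convergent_def
proof safe
  fix j show "continuous_on S (\<lambda>x. X (u j x))"
    using u uP by (intro continuous_on_compose2[OF X]) (auto simp: locally_convergent_def)
next
  fix C assume C: "compact C" "C \<subseteq> S"
  then obtain K where "K \<subseteq> P" "compact K" "\<And>j. u j ` C \<subseteq> K"
    using K[OF C] by metis
  have "uniformly_continuous_on K X"
    using X \<open>K \<subseteq> P\<close> \<open>compact K\<close> compact_uniformly_continuous continuous_on_subset by metis
  moreover have "uniformly_convergent_on C u"
    using u C by (auto simp: locally_convergent_def)
  ultimately show "uniformly_convergent_on C (\<lambda>j x. X (u j x))"
    using \<open>\<And>j. u j ` C \<subseteq> K\<close> \<open>compact K\<close>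
    by (intro uniformly_convergent_on_compose_uniformly_continuous_on[of C u K X])
       (auto simp: compact_imp_closed image_subset_iff intro!: always_eventually)
qed

text \<open>Beyond some index every term is within 1 of a fixed one; the finitely many earlier terms
  are bounded individually, and the sum of their bounds dominates each of them.\<close>

lemma locally_convergent_bounded:
  fixes u :: "nat \<Rightarrow> 'a::topological_space \<Rightarrow> 'b::real_normed_vector"
  assumes u: "locally_convergent S u" and C: "compact C" "C \<subseteq> S"
  shows "\<exists>B. \<forall>j. \<forall>x\<in>C. norm (u j x) \<le> B"
proof (cases "C = {}")
  case False
  have bj: "\<exists>B. \<forall>x\<in>C. norm (u j x) \<le> B" for j
  proof -
    have "continuous_on C (u j)"
      using u C by (auto simp: locally_convergent_def intro: continuous_on_subset)
    then have "bounded (u j ` C)"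
      using C by (intro compact_imp_bounded compact_continuous_image)
    then show ?thesis by (auto simp: bounded_iff)
  qed
  obtain B where B: "\<And>j x. x \<in> C \<Longrightarrow> norm (u j x) \<le> B j"
    using bj by metis
  have "uniformly_Cauchy_on C u"
    using u C by (intro uniformly_convergent_Cauchy) (auto simp: locally_convergent_def)
  then obtain N where N: "\<And>x m n. x \<in> C \<Longrightarrow> m \<ge> N \<Longrightarrow> n \<ge> N \<Longrightarrow> dist (u m x) (u n x) < 1"
    unfolding uniformly_Cauchy_on_def by (meson zero_less_one)
  have "norm (u j x) \<le> (\<Sum>i\<le>N. B i) + 1" if "x \<in> C" for j x
  proof -
    have B0: "B i \<ge> 0" for i
      using B[OF that, of i] norm_ge_zero by (rule order_trans[rotated])
    have Bi: "B i \<le> (\<Sum>i\<le>N. B i)" if "i \<le> N" for i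
      using that B0 by (intro member_le_sum) auto
    show ?thesis
    proof (cases "j \<le> N")
      case True
      then show ?thesis using B[OF that, of j] Bi[of j] by linarith
    next
      case False
      then have "norm (u j x - u N x) < 1"
        using N[OF that, of j N] by (simp add: dist_norm)
      then show ?thesis
        using B[OF that, of N] Bi[of N] norm_triangle_sub[of "u j x" "u N x"] by linarith
    qed
  qed
  then show ?thesis by blast
qed auto

text \<open>Bounded limits make products of uniformly convergent sequences converge uniformly; here
  the limits are continuous on the compact set \<open>C\<close>.\<close>

lemma locally_convergent_bilinear:
  fixes prod :: "'b::real_normed_vector \<Rightarrow> 'c::real_normed_vector \<Rightarrow> 'd::real_normed_vector"
  assumes "bounded_bilinear prod" "locally_convergent S u" "locally_convergent S v"
  shows "locally_convergent S (\<lambda>j x. prod (u j x) (v j x))"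
  unfolding locally_convergent_def
proof safe
  interpret bounded_bilinear prod by fact
  fix j show "continuous_on S (\<lambda>x. prod (u j x) (v j x))"
    using assms by (intro continuous_on) (auto simp: locally_convergent_def)
next
  interpret bounded_bilinear prod by fact
  fix C assume C: "compact C" "C \<subseteq> S"
  have lim: "\<exists>l. uniform_limit C f l sequentially \<and> bounded (l ` C)"
    if f: "locally_convergent S f" for f :: "nat \<Rightarrow> 'a \<Rightarrow> 'e::real_normed_vector"
  proof -
    obtain l where l: "uniform_limit C f l sequentially"
      using f C by (auto simp: locally_convergent_def uniformly_convergent_on_def)
    have "continuous_on C (f j)" for j
      using f C by (auto simp: locally_convergent_def intro: continuous_on_subset)
    then have "continuous_on C l"
      using l by (intro uniform_limit_theorem[where F=sequentially and f=f]) (auto intro!: always_eventually)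
    then show ?thesis
      using l C by (auto intro: compact_imp_bounded compact_continuous_image)
  qed
  obtain l m where l: "uniform_limit C u l sequentially" "bounded (l ` C)"
    and m: "uniform_limit C v m sequentially" "bounded (m ` C)"
    using lim[OF assms(2)] lim[OF assms(3)] by metis
  then show "uniformly_convergent_on C (\<lambda>j x. prod (u j x) (v j x))"
    by (intro uniformly_convergentI[OF bounded_uniform_limit[OF l(1) m(1) m(2) l(2)]])
qed

lemma locally_convergent_add:
  fixes u v :: "nat \<Rightarrow> 'a::topological_space \<Rightarrow> 'b::real_normed_vector"
  assumes "locally_convergent S u" "locally_convergent S v"
  shows "locally_convergent S (\<lambda>j x. u j x + v j x)"
  unfolding locally_convergent_def
proof safe
  fix j show "continuous_on S (\<lambda>x. u j x + v j x)"
    using assms by (auto simp: locally_convergent_def intro: continuous_on_add)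
next
  fix C assume "compact C" "C \<subseteq> S"
  then have "uniformly_convergent_on C u" "uniformly_convergent_on C v"
    using assms by (auto simp: locally_convergent_def)
  then show "uniformly_convergent_on C (\<lambda>j x. u j x + v j x)"
    unfolding uniformly_convergent_on_def by (blast dest: uniform_limit_add)
qed

lemma Ck_seq_add:
  assumes "open S" "Ck_seq r S u" "Ck_seq r S v"
  shows "Ck_seq r S (\<lambda>j x. u j x + v j x)"
  using assms(2,3)
proof (induction r arbitrary: u v)
  case (Suc r)
  have "dir (\<lambda>x. u j x + v j x) x w = dir (u j) x w + dir (v j) x w" if "x \<in> S" for j x w
    using Suc.prems that
    by (intro dir_eq) (auto intro!: has_derivative_add simp: frechet_derivative_works)
  then have "Ck_seq r S (\<lambda>j x. dir (\<lambda>x. u j x + v j x) x w) \<longleftrightarrow>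
      Ck_seq r S (\<lambda>j x. dir (u j) x w + dir (v j) x w)" for w
    by (intro Ck_seq_cong[OF \<open>open S\<close>]) auto
  with Suc show ?case by (auto intro: locally_convergent_add)
qed (simp add: locally_convergent_add)

lemma Ck_seq_bilinear:
  fixes prod :: "'b::real_normed_vector \<Rightarrow> 'c::real_normed_vector \<Rightarrow> 'd::real_normed_vector"
  assumes "open S" and prod: "bounded_bilinear prod" and "Ck_seq r S u" "Ck_seq r S v"
  shows "Ck_seq r S (\<lambda>j x. prod (u j x) (v j x))"
  using assms(3,4)
proof (induction r arbitrary: u v)
  case 0
  then show ?case by (simp add: locally_convergent_bilinear[OF prod])
next
  case (Suc r)
  interpret bounded_bilinear prod by fact
  have der: "((\<lambda>x. prod (u j x) (v j x)) has_derivative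
      (\<lambda>w. prod (u j x) (dir (v j) x w) + prod (dir (u j) x w) (v j x))) (at x)" if "x \<in> S" for j x
    using Suc.prems that by (intro FDERIV) (auto simp: frechet_derivative_works)
  have "Ck_seq r S (\<lambda>j x. dir (\<lambda>x. prod (u j x) (v j x)) x w) \<longleftrightarrow>
      Ck_seq r S (\<lambda>j x. prod (u j x) (dir (v j) x w) + prod (dir (u j) x w) (v j x))" for w
    by (intro Ck_seq_cong[OF \<open>open S\<close>]) (simp add: dir_eq[OF der])
  moreover have "Ck_seq r S (\<lambda>j x. prod (u j x) (dir (v j) x w) + prod (dir (u j) x w) (v j x))" for w
    using Suc.prems Ck_seq_Suc[OF Suc.prems(1)] Ck_seq_Suc[OF Suc.prems(2)]
    by (intro Ck_seq_add \<open>open S\<close> Suc.IH) auto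
  ultimately show ?case
    using Suc.prems differentiableI[OF der] by (simp add: locally_convergent_bilinear[OF prod])
qed

lemma Ck_seq_constant: "Ck_seq r S (\<lambda>j x. c)"
  by (induction r arbitrary: c) (auto simp: locally_convergent_def)

lemma Ck_seq_sum:
  assumes "open S" "\<And>i. i \<in> I \<Longrightarrow> Ck_seq r S (u i)"
  shows "Ck_seq r S (\<lambda>j x. \<Sum>i\<in>I. u i j x)"
proof (cases "finite I")
  case True
  then show ?thesis
    using assms(2) by (induction I) (auto intro: Ck_seq_add[OF \<open>open S\<close>] Ck_seq_constant)
qed (simp add: Ck_seq_constant)

text \<open>In the chain rule the inner direction \<open>dir (u j) x w\<close> varies with
  \<open>j\<close> and \<open>x\<close>. Expanding it in a basis leaves products of its coefficients
  with partial derivatives of \<open>X\<close> along \<open>u j\<close>; the latter are covered by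
  the induction because it is carried out for arbitrary \<open>X\<close>.\<close>

lemma Ck_seq_compose:
  fixes X :: "'b::euclidean_space \<Rightarrow> 'c::real_normed_vector"
  assumes S: "open S" and X: "Ck_on r P X" and u: "Ck_seq r S u"
    and K: "\<And>C. compact C \<Longrightarrow> C \<subseteq> S \<Longrightarrow> \<exists>K\<subseteq>P. compact K \<and> (\<forall>j. u j ` C \<subseteq> K)"
  shows "Ck_seq r S (\<lambda>j x. X (u j x))"
proof -
  have uP: "u j x \<in> P" if "x \<in> S" for j x
    using K[of "{x}"] that by auto
  show ?thesis
    using X u
  proof (induction r arbitrary: X)
    case 0
    then show ?case
      using K uP by (auto intro!: locally_convergent_compose[of P X])
  next
    case (Suc r)
    have der: "((\<lambda>x. X (u j x)) has_derivative (\<lambda>w. dir X (u j x) (dir (u j) x w))) (at x)" if "x \<in> S" for j x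
      using Suc.prems that uP by (intro has_derivative_compose[of "u j" _ x UNIV X]) (auto simp: frechet_derivative_works)
    have eq: "dir (\<lambda>x. X (u j x)) x w = (\<Sum>b\<in>Basis. (dir (u j) x w \<bullet> b) *\<^sub>R dir X (u j x) b)"
      if "x \<in> S" for j x w
    proof -
      have "X differentiable (at (u j x))"
        using Suc.prems(1) uP[OF that] by simp
      then show ?thesis
        unfolding dir_eq[OF der[OF that]] by (rule dir_basis_expansion)
    qed
    have u': "Ck_seq r S (\<lambda>j x. dir (u j) x w)" for w
      using Suc.prems by auto
    have "Ck_seq r S (\<lambda>j x. (\<Sum>b\<in>Basis. (dir (u j) x w \<bullet> b) *\<^sub>R dir X (u j x) b))" for w
    proof (intro Ck_seq_sum S Ck_seq_bilinear[OF S bounded_bilinear_scaleR])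
      show "Ck_seq r S (\<lambda>j x. dir (u j) x w \<bullet> b)" for b
        by (intro Ck_seq_bilinear[OF S bounded_bilinear_inner] u' Ck_seq_constant)
      show "Ck_seq r S (\<lambda>j x. dir X (u j x) b)" for b
        using Suc.prems(1) Ck_seq_Suc[OF Suc.prems(2)] by (intro Suc.IH) auto
    qed
    then have "Ck_seq r S (\<lambda>j x. dir (\<lambda>x. X (u j x)) x w)" for w
      by (simp add: Ck_seq_cong[OF S eq])
    moreover have "locally_convergent S (\<lambda>j x. X (u j x))"
      using Ck_on_continuous[OF Suc.prems(1)] K uP Suc.prems(2)
      by (intro locally_convergent_compose[of P X]) auto
    ultimately show ?case
      using differentiableI[OF der] by simp
  qed
qed

text \<open>A recursion controls only the terms with successor index; the initial term has to be
  supplied separately.\<close>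

lemma Ck_seq_shift:
  assumes "Ck_on r S (u 0)" "Ck_seq r S (\<lambda>j. u (Suc j))"
  shows "Ck_seq r S u"
  using assms
proof (induction r arbitrary: u)
  have conv: "locally_convergent S u" if "continuous_on S (u 0)" "locally_convergent S (\<lambda>j. u (Suc j))"
    for u :: "nat \<Rightarrow> 'a \<Rightarrow> 'b"
    unfolding locally_convergent_def
  proof safe
    fix j show "continuous_on S (u j)"
      using that by (cases j) (auto simp: locally_convergent_def)
  next
    fix C assume "compact C" "C \<subseteq> S"
    then have "uniformly_convergent_on C (\<lambda>j. u (Suc j))"
      using that by (auto simp: locally_convergent_def)
    then obtain l where "uniform_limit C (\<lambda>j. u (Suc j)) l sequentially"
      by (auto simp: uniformly_convergent_on_def)
    then have "uniform_limit C u l sequentially"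
      by (simp add: filterlim_sequentially_Suc)
    then show "uniformly_convergent_on C u"
      by (rule uniformly_convergentI)
  qed
  {
    case 0
    then show ?case using conv[of u] by simp
  next
    case (Suc r)
    have "locally_convergent S u"
      using Suc.prems Ck_on_continuous[OF Suc.prems(1)] conv[of u] by simp
    moreover have "Ck_seq r S (\<lambda>j x. dir (u j) x w)" for w
      by (rule Suc.IH) (use Suc.prems in auto)
    moreover have "u j differentiable (at x)" if "x \<in> S" for j x
      using Suc.prems that by (cases j) auto
    ultimately show ?case by simp
  }
qed

text \<open>Locally uniform convergence of all directional derivatives permits termwise
  differentiation. Higher regularity follows by induction, since the derivatives of the limit are
  again limits of such sequences.\<close>

lemma Ck_seq_limit:
  fixes u :: "nat \<Rightarrow> 'a::euclidean_space \<Rightarrow> 'b::euclidean_space"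
  assumes "open S" "Ck_seq r S u"
  shows "Ck_on r S (\<lambda>x. lim (\<lambda>j. u j x))"
    and "x \<in> S \<Longrightarrow> (\<lambda>j. u j x) \<longlonglongrightarrow> lim (\<lambda>j. u j x)"
    and "r > 0 \<Longrightarrow> x \<in> S \<Longrightarrow> ((\<lambda>x. lim (\<lambda>j. u j x)) has_derivative (\<lambda>w. lim (\<lambda>j. dir (u j) x w))) (at x)"
proof -
  have pointwise: "(\<lambda>j. u j x) \<longlonglongrightarrow> lim (\<lambda>j. u j x)"
    if "locally_convergent S u" "x \<in> S" for u :: "nat \<Rightarrow> 'a \<Rightarrow> 'b" and x
    using that uniformly_convergent_imp_convergent[of "{x}" u x]
    by (auto simp: locally_convergent_def convergent_LIMSEQ_iff)
  have unif: "uniform_limit C u (\<lambda>x. lim (\<lambda>j. u j x)) sequentially"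
    if "locally_convergent S u" "compact C" "C \<subseteq> S" for u :: "nat \<Rightarrow> 'a \<Rightarrow> 'b" and C
    using that by (auto simp: locally_convergent_def uniformly_convergent_uniform_limit_iff)
  have cont: "continuous_on S (\<lambda>x. lim (\<lambda>j. u j x))"
    if "locally_convergent S u" for u :: "nat \<Rightarrow> 'a \<Rightarrow> 'b"
  proof (intro continuous_at_imp_continuous_on ballI)
    fix x assume "x \<in> S"
    then obtain e where e: "e > 0" "cball x e \<subseteq> S"
      using \<open>open S\<close> open_contains_cball by blast
    have "continuous_on (cball x e) (\<lambda>x. lim (\<lambda>j. u j x))"
      using that e unif[OF that compact_cball, of x e]
      by (intro uniform_limit_theorem[where F=sequentially and f=u])
         (auto simp: locally_convergent_def intro!: always_eventually intro: continuous_on_subset)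
    then show "isCont (\<lambda>x. lim (\<lambda>j. u j x)) x"
      using e by (intro continuous_on_interior[of "cball x e"]) auto
  qed
  have der: "((\<lambda>x. lim (\<lambda>j. u j x)) has_derivative (\<lambda>w. lim (\<lambda>j. dir (u j) x w))) (at x)"
    if u: "Ck_seq (Suc 0) S u" and x: "x \<in> S" for u :: "nat \<Rightarrow> 'a \<Rightarrow> 'b" and x
  proof -
    obtain d where d: "d > 0" "cball x d \<subseteq> S"
      using \<open>open S\<close> x open_contains_cball by blast
    let ?B = "cball x d"
    have derj: "(u j has_derivative dir (u j) y) (at y)" if "y \<in> ?B" for j y
      using u that d by (auto simp: frechet_derivative_works)
    have l': "(\<lambda>j. dir (u j) y w) \<longlonglongrightarrow> lim (\<lambda>j. dir (u j) y w)" if "y \<in> ?B" for y w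
      using u that d pointwise[of "\<lambda>j x. dir (u j) x w" y] by auto
    have ex: "\<exists>h. \<forall>y\<in>?B. (\<lambda>j. u j y) \<longlonglongrightarrow> h y \<and>
        (h has_derivative (\<lambda>w. lim (\<lambda>j. dir (u j) y w))) (at y within ?B)"
    proof (rule has_derivative_sequence[of ?B u "\<lambda>j y. dir (u j) y" "\<lambda>y w. lim (\<lambda>j. dir (u j) y w)" x "lim (\<lambda>j. u j x)"])
      show "(u j has_derivative dir (u j) y) (at y within ?B)" if "y \<in> ?B" for j y
        using derj[OF that] has_derivative_at_withinI by blast
      show "(\<lambda>j. u j x) \<longlonglongrightarrow> lim (\<lambda>j. u j x)"
        using pointwise u x by auto
      fix e :: real assume "e > 0"
      \<comment> \<open>Uniform convergence is known for one direction at a time; an error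
        \<open>e / n\<close> in each of the \<open>n\<close> basis directions adds up to at most
        \<open>e\<close> in operator norm.\<close>
      define n where "n = real (card (Basis :: 'a set))"
      have "n > 0" by (simp add: n_def)
      have "\<forall>\<^sub>F j in sequentially. \<forall>y\<in>?B. dist (dir (u j) y b) (lim (\<lambda>j. dir (u j) y b)) < e / n" for b
        using unif[of "\<lambda>j x. dir (u j) x b" ?B] u d \<open>e > 0\<close> \<open>n > 0\<close>
        by (auto simp: uniform_limit_iff)
      then have "\<forall>\<^sub>F j in sequentially. \<forall>b\<in>Basis. \<forall>y\<in>?B. dist (dir (u j) y b) (lim (\<lambda>j. dir (u j) y b)) < e / n"
        by (intro eventually_ball_finite) auto
      then show "\<forall>\<^sub>F j in sequentially. \<forall>y\<in>?B. \<forall>h. norm (dir (u j) y h - lim (\<lambda>j. dir (u j) y h)) \<le> e * norm h"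
      proof eventually_elim
        case (elim j)
        show ?case
        proof (intro ballI allI)
          fix y h assume y: "y \<in> ?B"
          let ?d = "\<lambda>b. dir (u j) y b - lim (\<lambda>j. dir (u j) y b)"
          have ex: "dir (u i) y h = (\<Sum>b\<in>Basis. (h \<bullet> b) *\<^sub>R dir (u i) y b)" for i
            using derj[OF y] by (intro dir_basis_expansion) (auto simp: differentiable_def)
          have "(\<lambda>i. dir (u i) y h) \<longlonglongrightarrow> (\<Sum>b\<in>Basis. (h \<bullet> b) *\<^sub>R lim (\<lambda>j. dir (u j) y b))"
            unfolding ex by (intro tendsto_intros l'[OF y])
          then have "lim (\<lambda>i. dir (u i) y h) = (\<Sum>b\<in>Basis. (h \<bullet> b) *\<^sub>R lim (\<lambda>j. dir (u j) y b))"
            by (rule limI)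
          then have "?d h = (\<Sum>b\<in>Basis. (h \<bullet> b) *\<^sub>R ?d b)"
            by (simp add: ex[of j] sum_subtractf scaleR_diff_right)
          also have "norm \<dots> \<le> (\<Sum>b\<in>(Basis::'a set). norm h * (e / n))"
          proof (rule sum_norm_le)
            fix b :: 'a assume b: "b \<in> Basis"
            have "norm (?d b) \<le> e / n"
              using elim b y by (force simp: dist_norm)
            then show "norm ((h \<bullet> b) *\<^sub>R ?d b) \<le> norm h * (e / n)"
              unfolding norm_scaleR using b by (intro mult_mono) (auto simp: Basis_le_norm)
          qed
          also have "\<dots> = e * norm h"
            using \<open>n > 0\<close> by (simp add: n_def)
          finally show "norm (?d h) \<le> e * norm h" .
        qed
      qed
    qed (use d in auto)
    then obtain h where h: "\<And>y. y \<in> ?B \<Longrightarrow> (\<lambda>j. u j y) \<longlonglongrightarrow> h y"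
      "\<And>y. y \<in> ?B \<Longrightarrow> (h has_derivative (\<lambda>w. lim (\<lambda>j. dir (u j) y w))) (at y within ?B)"
      by blast
    have "(h has_derivative (\<lambda>w. lim (\<lambda>j. dir (u j) x w))) (at x)"
      using h(2)[of x] d at_within_interior[of x ?B] by simp
    then show ?thesis
    proof (rule has_derivative_transform_within_open[of _ _ _ _ "ball x d"])
      show "h y = lim (\<lambda>j. u j y)" if "y \<in> ball x d" for y
        using h(1)[of y] that by (auto simp: limI)
    qed (use d in auto)
  qed
  show "x \<in> S \<Longrightarrow> (\<lambda>j. u j x) \<longlonglongrightarrow> lim (\<lambda>j. u j x)"
    using pointwise assms(2) Ck_seq_locally_convergent by blast
  show "r > 0 \<Longrightarrow> x \<in> S \<Longrightarrow> ((\<lambda>x. lim (\<lambda>j. u j x)) has_derivative (\<lambda>w. lim (\<lambda>j. dir (u j) x w))) (at x)"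
    using der[of u x] Ck_seq_mono[OF assms(2), of "Suc 0"] by auto
  show "Ck_on r S (\<lambda>x. lim (\<lambda>j. u j x))"
    using assms(2)
  proof (induction r arbitrary: u)
    case (Suc r)
    have "Ck_seq (Suc 0) S u"
      using Suc.prems Ck_seq_mono by blast
    note d = der[OF this]
    have "Ck_on r S (\<lambda>x. dir (\<lambda>x. lim (\<lambda>j. u j x)) x w) \<longleftrightarrow> Ck_on r S (\<lambda>x. lim (\<lambda>j. dir (u j) x w))" for w
      using dir_eq[OF d] by (intro Ck_on_cong[OF \<open>open S\<close>]) auto
    with Suc d show ?case by (auto simp: differentiable_def)
  qed (simp add: cont)
qed

lemma Ck_seq_term: "Ck_seq r S u \<Longrightarrow> Ck_seq r S (\<lambda>_. u j)"
proof (induction r arbitrary: u)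
  case 0
  then show ?case by (simp add: locally_convergent_def)
next
  case (Suc r)
  then have "Ck_seq r S (\<lambda>j x. dir (u j) x w)" for w by simp
  then have "Ck_seq r S (\<lambda>_ x. dir (u j) x w)" for w by (rule Suc.IH)
  with Suc.prems show ?case by (simp add: locally_convergent_def)
qed

lemma Ck_on_dir: "Ck_on (Suc r) S u \<Longrightarrow> Ck_on r S (\<lambda>x. dir u x w)"
  by simp

lemma Ck_on_differentiable: "Ck_on (Suc r) S u \<Longrightarrow> x \<in> S \<Longrightarrow> u differentiable (at x)"
  by simp

lemma Ck_seq_eq:
  assumes "Ck_seq r S v" "open S" "\<And>j x. x \<in> S \<Longrightarrow> u j x = v j x"
  shows "Ck_seq r S u"
  using assms Ck_seq_cong[of S u v r] by simp

section \<open>Calculus of functions of class \<open>C\<^sup>r\<close>\<close>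

lemma Ck_on_bounded_linear:
  assumes "bounded_linear f"
  shows "Ck_on r S f"
proof (cases r)
  case 0
  then show ?thesis using assms linear_continuous_on by auto
next
  case (Suc q)
  have d: "(f has_derivative f) (at x)" for x
    using assms by (rule bounded_linear_imp_has_derivative)
  have "Ck_on q S (\<lambda>x. f w)" for w
    using Ck_seq_constant[of q S "f w"] by (simp only: Ck_seq_const)
  then show ?thesis
    unfolding Suc using differentiableI[OF d] by (simp add: dir_eq[OF d])
qed

lemma Ck_on_subset: "Ck_on r S u \<Longrightarrow> S' \<subseteq> S \<Longrightarrow> Ck_on r S' u"
  using Ck_seq_subset[of r S "\<lambda>_. u" S'] by (simp only: Ck_seq_const)

lemma Ck_on_const: "Ck_on r S (\<lambda>x. c)"
  using Ck_seq_constant[of r S c] by (simp only: Ck_seq_const)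

lemma Ck_on_add: "open S \<Longrightarrow> Ck_on r S u \<Longrightarrow> Ck_on r S v \<Longrightarrow> Ck_on r S (\<lambda>x. u x + v x)"
  using Ck_seq_add[of S r "\<lambda>_. u" "\<lambda>_. v"] by (simp only: Ck_seq_const)

lemma Ck_on_bilinear:
  "bounded_bilinear f \<Longrightarrow> open S \<Longrightarrow> Ck_on r S u \<Longrightarrow> Ck_on r S v \<Longrightarrow> Ck_on r S (\<lambda>x. f (u x) (v x))"
  using Ck_seq_bilinear[of S f r "\<lambda>_. u" "\<lambda>_. v"] by (simp only: Ck_seq_const)

lemma Ck_on_sum: "open S \<Longrightarrow> (\<And>i. i \<in> I \<Longrightarrow> Ck_on r S (u i)) \<Longrightarrow> Ck_on r S (\<lambda>x. \<Sum>i\<in>I. u i x)"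
  using Ck_seq_sum[of S I r "\<lambda>i _. u i"] by (simp only: Ck_seq_const)

lemma Ck_on_compose:
  fixes X :: "'b::euclidean_space \<Rightarrow> 'c::real_normed_vector"
  assumes "open S" "Ck_on r P X" "Ck_on r S u" "u ` S \<subseteq> P"
  shows "Ck_on r S (\<lambda>x. X (u x))"
proof -
  have "\<exists>K\<subseteq>P. compact K \<and> (\<forall>j::nat. u ` C \<subseteq> K)" if "compact C" "C \<subseteq> S" for C
  proof (intro exI[of _ "u ` C"] conjI)
    show "compact (u ` C)"
      using that Ck_on_continuous[OF assms(3)]
      by (intro compact_continuous_image) (auto intro: continuous_on_subset)
  qed (use assms(4) that in auto)
  then show ?thesis
    using Ck_seq_compose[of S r P X "\<lambda>_. u"] assms(1-3) by (simp only: Ck_seq_const)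
qed

lemma Ck_on_linear:
  "bounded_linear f \<Longrightarrow> open S \<Longrightarrow> Ck_on r S (u :: _ \<Rightarrow> _::euclidean_space) \<Longrightarrow> Ck_on r S (\<lambda>x. f (u x))"
  by (rule Ck_on_compose[OF _ Ck_on_bounded_linear[of f r UNIV]]) auto

lemma Ck_on_mult:
  fixes u v :: "_ \<Rightarrow> 'a::real_normed_algebra"
  shows "open S \<Longrightarrow> Ck_on r S u \<Longrightarrow> Ck_on r S v \<Longrightarrow> Ck_on r S (\<lambda>x. u x * v x)"
  by (rule Ck_on_bilinear[OF bounded_bilinear_mult])

lemma Ck_on_prod:
  fixes u :: "_ \<Rightarrow> _ \<Rightarrow> 'a::{real_normed_algebra_1, comm_monoid_mult}"
  assumes "open S" "\<And>i. i \<in> I \<Longrightarrow> Ck_on r S (u i)"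
  shows "Ck_on r S (\<lambda>x. \<Prod>i\<in>I. u i x)"
proof (cases "finite I")
  case True
  then show ?thesis
    using assms(2) by (induction I) (auto intro: Ck_on_mult[OF assms(1)] simp: Ck_on_const)
qed (simp add: Ck_on_const)

lemma Ck_on_vec:
  fixes u :: "_ \<Rightarrow> _ \<Rightarrow> 'a::euclidean_space"
  assumes "open S" "\<And>i. Ck_on r S (u i)"
  shows "Ck_on r S (\<lambda>x. \<chi> i::'n::finite. u i x)"
proof -
  have "linear (axis i :: 'a \<Rightarrow> 'a^'n)" for i
    by (rule linearI) (simp_all add: vec_eq_iff axis_def)
  then have "Ck_on r S (\<lambda>x. axis i (u i x) :: 'a^'n)" for i
    using assms by (intro Ck_on_linear[of "axis i"]) (simp_all add: linear_conv_bounded_linear)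
  then have "Ck_on r S (\<lambda>x. \<Sum>i\<in>UNIV. axis i (u i x) :: 'a^'n)"
    by (intro Ck_on_sum assms)
  moreover have "(\<Sum>i\<in>UNIV. axis i (u i x)) = (\<chi> i. u i x)" for x
    by (simp add: vec_eq_iff axis_def if_distrib cong: if_cong)
  ultimately show ?thesis by simp
qed

lemma Ck_on_nth: "open S \<Longrightarrow> Ck_on r S u \<Longrightarrow> Ck_on r S (\<lambda>x. (u x :: 'b::euclidean_space^'n::finite) $ i)"
  by (rule Ck_on_linear[OF bounded_linear_vec_nth])

lemma Ck_on_Pair:
  fixes u :: "_ \<Rightarrow> 'a::euclidean_space" and v :: "_ \<Rightarrow> 'b::euclidean_space"
  assumes "open S" "Ck_on r S u" "Ck_on r S v"
  shows "Ck_on r S (\<lambda>x. (u x, v x))"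
proof -
  have "bounded_linear (\<lambda>a::'a. (a, 0::'b))" "bounded_linear (\<lambda>b::'b. (0::'a, b))"
    by (intro bounded_linear_Pair bounded_linear_zero bounded_linear_ident)+
  then have "Ck_on r S (\<lambda>x. (u x, 0) + (0, v x))"
    by (intro Ck_on_add[OF assms(1)] Ck_on_linear[OF _ assms(1,2)] Ck_on_linear[OF _ assms(1,3)])
  then show ?thesis by simp
qed

text \<open>For one real variable the derivative in direction \<open>w\<close> is just
  \<open>w * f' x\<close>, so the class of \<open>f'\<close> is raised by one. This is the induction
  step for elementary functions.\<close>

lemma Ck_on_real_antiderivative:
  fixes f f' :: "real \<Rightarrow> real"
  assumes "open I" "Ck_on r I f'" "\<And>x. x \<in> I \<Longrightarrow> (f has_real_derivative f' x) (at x)"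
  shows "Ck_on (Suc r) I f"
proof -
  have d: "(f has_derivative (\<lambda>w. w * f' x)) (at x)" if "x \<in> I" for x
  proof -
    have "(\<lambda>w. w * f' x) = (*) (f' x)" by (simp add: fun_eq_iff)
    then show ?thesis using assms(3)[OF that] by (simp add: has_field_derivative_def)
  qed
  have "Ck_on r I (\<lambda>x. w * f' x)" for w
    using assms by (intro Ck_on_mult Ck_on_const)
  then have "Ck_on r I (\<lambda>x. dir f x w)" for w
    using Ck_on_cong[OF assms(1), of "\<lambda>x. dir f x w" "\<lambda>x. w * f' x"] by (simp add: dir_eq[OF d])
  then show ?thesis
    using differentiableI[OF d] by simp
qed

text \<open>The induction runs over all exponents at once, because differentiation lowers
  \<open>a\<close>.\<close>

lemma Ck_on_powr: "Ck_on r {0<..} (\<lambda>x::real. x powr a)"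
proof (induction r arbitrary: a)
  case 0
  then show ?case by (auto intro!: continuous_intros)
next
  case (Suc r)
  show ?case
  proof (rule Ck_on_real_antiderivative)
    show "Ck_on r {0<..} (\<lambda>x. a * x powr (a - 1))"
      by (intro Ck_on_mult Ck_on_const Suc) simp
  qed (auto intro!: derivative_eq_intros)
qed

text \<open>The derivative is a polynomial in \<open>inverse\<close> itself, which closes the
  induction.\<close>

lemma Ck_on_inverse: "Ck_on r (- {0}) (inverse :: real \<Rightarrow> real)"
proof (induction r)
  case 0
  then show ?case by (auto intro!: continuous_intros)
next
  case (Suc r)
  show ?case
  proof (rule Ck_on_real_antiderivative)
    show "Ck_on r (- {0}) (\<lambda>x::real. (- 1) * (inverse x * inverse x))"
      by (intro Ck_on_mult Ck_on_const Suc) auto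
  qed (auto intro!: derivative_eq_intros)
qed

lemma Ck_on_divide:
  fixes u v :: "_ \<Rightarrow> real"
  assumes "open S" "Ck_on r S u" "Ck_on r S v" "\<And>x. x \<in> S \<Longrightarrow> v x \<noteq> 0"
  shows "Ck_on r S (\<lambda>x. u x / v x)"
  unfolding divide_inverse
  using assms by (intro Ck_on_mult Ck_on_compose[OF _ Ck_on_inverse]) auto

lemma Ck_on_det:
  fixes M :: "_ \<Rightarrow> real^'n^'n"
  assumes "open S" "\<And>i j. Ck_on r S (\<lambda>x. M x $ i $ j)"
  shows "Ck_on r S (\<lambda>x. det (M x))"
  unfolding det_def using assms by (intro Ck_on_sum Ck_on_mult Ck_on_prod Ck_on_const)

text \<open>Cramer's rule writes the solution as quotients of determinants, which inherit the
  regularity of the coefficients. It serves both for gradients, avoiding derivatives of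
  \<open>matrix_inv\<close>, and for derivatives of inverse maps.\<close>

lemma Ck_on_linear_solve:
  fixes M :: "_ \<Rightarrow> real^'n^'n"
  assumes S: "open S" and M: "\<And>i j. Ck_on r S (\<lambda>x. M x $ i $ j)" and b: "\<And>i. Ck_on r S (\<lambda>x. b x $ i)"
    and det: "\<And>x. x \<in> S \<Longrightarrow> det (M x) \<noteq> 0" and u: "\<And>x. x \<in> S \<Longrightarrow> M x *v u x = b x"
  shows "Ck_on r S u"
proof -
  have eq: "u x = (\<chi> l. det (\<chi> i j. if j = l then b x $ i else M x $ i $ j) / det (M x))" if "x \<in> S" for x
    using cramer[OF det[OF that]] u[OF that] by blast
  have "Ck_on r S (\<lambda>x. if j = l then b x $ i else M x $ i $ j)" for i j l
    using M b by (cases "j = l") auto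
  then have "Ck_on r S (\<lambda>x. \<chi> l. det (\<chi> i j. if j = l then b x $ i else M x $ i $ j) / det (M x))"
    by (intro Ck_on_vec Ck_on_divide Ck_on_det S M det) auto
  then show ?thesis
    using Ck_on_cong[OF S eq] by simp
qed

lemma dir_compose:
  assumes "u differentiable (at x)" "X differentiable (at (u x))"
  shows "dir (\<lambda>x. X (u x)) x w = dir X (u x) (dir u x w)"
    and "(\<lambda>x. X (u x)) differentiable (at x)"
proof -
  have "((\<lambda>x. X (u x)) has_derivative (\<lambda>w. dir X (u x) (dir u x w))) (at x)"
    by (intro has_derivative_compose[of u _ x UNIV X] has_derivative_dir assms)
  then show "dir (\<lambda>x. X (u x)) x w = dir X (u x) (dir u x w)" "(\<lambda>x. X (u x)) differentiable (at x)"
    by (auto simp: dir_eq intro: differentiableI)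
qed

section \<open>Integration in the first coordinate\<close>

text \<open>Rescaling to the unit interval avoids a case distinction on the sign of the first coordinate.\<close>

definition time_integral :: "(real \<times> 'a \<Rightarrow> 'b::real_normed_vector) \<Rightarrow> real \<times> 'a \<Rightarrow> 'b" where
  "time_integral u p = fst p *\<^sub>R integral {0..1} (\<lambda>\<sigma>. u (\<sigma> * fst p, snd p))"

lemma scaled_time_in:
  fixes p :: "real \<times> 'a"
  assumes "p \<in> {-\<epsilon><..<\<epsilon>} \<times> P" "\<sigma> \<in> {0..1}"
  shows "(\<sigma> * fst p, snd p) \<in> {-\<epsilon><..<\<epsilon>} \<times> P"
proof -
  have "\<bar>\<sigma> * fst p\<bar> \<le> 1 * \<bar>fst p\<bar>"
    unfolding abs_mult using assms by (intro mult_right_mono) auto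
  then show ?thesis using assms by (auto simp: mem_Times_iff)
qed

lemma continuous_on_scaled_time:
  fixes u :: "real \<times> 'a::topological_space \<Rightarrow> 'b::topological_space"
  assumes u: "continuous_on ({-\<epsilon><..<\<epsilon>} \<times> P) u"
  shows "continuous_on (({-\<epsilon><..<\<epsilon>} \<times> P) \<times> cbox 0 1) (\<lambda>(p, \<sigma>::real). u (\<sigma> * fst p, snd p))"
  unfolding split_beta
proof (rule continuous_on_compose2[OF u])
  show "(\<lambda>(x::(real \<times> 'a) \<times> real). (snd x * fst (fst x), snd (fst x))) ` (({-\<epsilon><..<\<epsilon>} \<times> P) \<times> cbox 0 1)
      \<subseteq> {-\<epsilon><..<\<epsilon>} \<times> P"
  proof (rule image_subsetI)
    fix x :: "(real \<times> 'a) \<times> real" assume "x \<in> ({-\<epsilon><..<\<epsilon>} \<times> P) \<times> cbox 0 1"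
    then have "fst x \<in> {-\<epsilon><..<\<epsilon>} \<times> P" "snd x \<in> {0..1}" by auto
    then show "(snd x * fst (fst x), snd (fst x)) \<in> {-\<epsilon><..<\<epsilon>} \<times> P" by (rule scaled_time_in)
  qed
qed (intro continuous_intros)

lemma continuous_on_scaled_time_slice:
  fixes u :: "real \<times> 'a::topological_space \<Rightarrow> 'b::topological_space"
  assumes u: "continuous_on ({-\<epsilon><..<\<epsilon>} \<times> P) u" and p: "p \<in> {-\<epsilon><..<\<epsilon>} \<times> P"
  shows "continuous_on {0..1} (\<lambda>\<sigma>. u (\<sigma> * fst p, snd p))"
proof (rule continuous_on_compose2[OF u])
  show "(\<lambda>\<sigma>. (\<sigma> * fst p, snd p)) ` {0..1} \<subseteq> {-\<epsilon><..<\<epsilon>} \<times> P"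
    using scaled_time_in[OF p] by (rule image_subsetI)
qed (intro continuous_intros)

lemma time_integral_continuous:
  fixes u :: "real \<times> 'a::topological_space \<Rightarrow> 'b::banach"
  assumes u: "continuous_on ({-\<epsilon><..<\<epsilon>} \<times> P) u"
  shows "continuous_on ({-\<epsilon><..<\<epsilon>} \<times> P) (time_integral u)"
  unfolding time_integral_def
  using integral_continuous_on_param[OF continuous_on_scaled_time[OF u]]
  by (auto intro!: continuous_intros)

text \<open>The factor \<open>\<epsilon>\<close>, half the length of the time interval, is the
  source of the contraction estimates for the Picard iterates and their derivatives.\<close>

lemma time_integral_bound:
  fixes u :: "real \<times> 'a::topological_space \<Rightarrow> 'b::banach"
  assumes u: "continuous_on ({-\<epsilon><..<\<epsilon>} \<times> P) u" and p: "p \<in> {-\<epsilon><..<\<epsilon>} \<times> P"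
    and B: "\<And>\<sigma>. \<sigma> \<in> {0..1} \<Longrightarrow> norm (u (\<sigma> * fst p, snd p)) \<le> B"
  shows "norm (time_integral u p) \<le> \<epsilon> * B"
proof -
  have "norm (integral {0..1} (\<lambda>\<sigma>. u (\<sigma> * fst p, snd p))) \<le> B * (1 - 0)"
    using continuous_on_scaled_time_slice[OF u p] B by (intro integral_bound) auto
  then show ?thesis
    unfolding time_integral_def norm_scaleR using p by (intro mult_mono) auto
qed

lemma time_integral_diff:
  fixes u v :: "real \<times> 'a::topological_space \<Rightarrow> 'b::banach"
  assumes "continuous_on ({-\<epsilon><..<\<epsilon>} \<times> P) u" "continuous_on ({-\<epsilon><..<\<epsilon>} \<times> P) v"
    and "p \<in> {-\<epsilon><..<\<epsilon>} \<times> P"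
  shows "time_integral (\<lambda>q. u q - v q) p = time_integral u p - time_integral v p"
  unfolding time_integral_def scaleR_diff_right[symmetric]
  using continuous_on_scaled_time_slice[OF assms(1,3)] continuous_on_scaled_time_slice[OF assms(2,3)]
  by (subst integral_diff) (auto intro: integrable_continuous_interval)

lemma time_integral_add:
  fixes u v :: "real \<times> 'a::topological_space \<Rightarrow> 'b::banach"
  assumes "continuous_on ({-\<epsilon><..<\<epsilon>} \<times> P) u" "continuous_on ({-\<epsilon><..<\<epsilon>} \<times> P) v"
    and "p \<in> {-\<epsilon><..<\<epsilon>} \<times> P"
  shows "time_integral (\<lambda>q. u q + v q) p = time_integral u p + time_integral v p"
  unfolding time_integral_def scaleR_add_right[symmetric]
  using continuous_on_scaled_time_slice[OF assms(1,3)] continuous_on_scaled_time_slice[OF assms(2,3)]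
  by (subst integral_add) (auto intro: integrable_continuous_interval)

lemma time_integral_cong:
  assumes "\<And>q. q \<in> {-\<epsilon><..<\<epsilon>} \<times> P \<Longrightarrow> u q = v q" "p \<in> {-\<epsilon><..<\<epsilon>} \<times> P"
  shows "time_integral u p = time_integral v p"
  unfolding time_integral_def
  by (intro arg_cong[where f="scaleR _"] integral_cong assms(1) scaled_time_in[OF assms(2)])

lemma time_integral_deriv:
  fixes u :: "real \<times> 'a::topological_space \<Rightarrow> 'b::banach"
  assumes u: "continuous_on ({-\<epsilon><..<\<epsilon>} \<times> P) u" and t: "\<bar>t\<bar> < \<epsilon>" and x: "x \<in> P"
  shows "((\<lambda>\<tau>. time_integral u (\<tau>, x)) has_vector_derivative u (t, x)) (at t)"
proof -
  \<comment> \<open>A midpoint, so that the closed interval from \<open>-b\<close> to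
    \<open>b\<close> contains \<open>t\<close> in its interior and stays inside the time
    domain.\<close>
  define b where "b = (\<epsilon> + \<bar>t\<bar>) / 2"
  have b: "\<bar>t\<bar> < b" "b < \<epsilon>" using t by (auto simp: b_def)
  define G where "G = (\<lambda>\<tau>. integral {-b..\<tau>} (\<lambda>s. u (s, x)))"
  have cont: "continuous_on {-b..b} (\<lambda>s. u (s, x))"
    by (rule continuous_on_compose2[OF u]) (use b x in \<open>auto intro!: continuous_intros\<close>)
  have G: "(G has_vector_derivative u (s, x)) (at s)" if "\<bar>s\<bar> < b" for s
  proof -
    have "(G has_vector_derivative u (s, x)) (at s within {-b..b})"
      unfolding G_def using that by (intro integral_has_vector_derivative[OF cont]) auto
    then show ?thesis
      using that at_within_interior[of s "{-b..b}"] by (auto simp: abs_less_iff)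
  qed
  \<comment> \<open>The substitution \<open>s = \<sigma> * \<tau>\<close> undoes the rescaling. It
    is carried out by the fundamental theorem of calculus for \<open>G (\<sigma> * \<tau>)\<close>
    on the unit interval, which treats both signs of \<open>\<tau>\<close> alike.\<close>
  have J: "time_integral u (\<tau>, x) = G \<tau> - G 0" if \<tau>: "\<bar>\<tau>\<bar> < b" for \<tau>
  proof -
    have "((\<lambda>\<sigma>. \<tau> *\<^sub>R u (\<sigma> * \<tau>, x)) has_integral (G (1 * \<tau>) - G (0 * \<tau>))) {0..1}"
    proof (rule fundamental_theorem_of_calculus)
      fix \<sigma> :: real assume "\<sigma> \<in> {0..1}"
      then have "\<bar>\<sigma> * \<tau>\<bar> \<le> 1 * \<bar>\<tau>\<bar>"
        unfolding abs_mult by (intro mult_right_mono) auto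
      then have "\<bar>\<sigma> * \<tau>\<bar> < b" using \<tau> by simp
      have "((\<lambda>\<sigma>. \<sigma> * \<tau>) has_vector_derivative \<tau>) (at \<sigma>)"
        by (auto intro!: derivative_eq_intros simp: has_real_derivative_iff_has_vector_derivative[symmetric])
      then have "((G \<circ> (\<lambda>\<sigma>. \<sigma> * \<tau>)) has_vector_derivative \<tau> *\<^sub>R u (\<sigma> * \<tau>, x)) (at \<sigma>)"
        using G[OF \<open>\<bar>\<sigma> * \<tau>\<bar> < b\<close>] by (rule vector_diff_chain_at)
      then show "((\<lambda>\<sigma>. G (\<sigma> * \<tau>)) has_vector_derivative \<tau> *\<^sub>R u (\<sigma> * \<tau>, x)) (at \<sigma> within {0..1})"
        by (simp add: o_def has_vector_derivative_at_within)
    qed simp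
    from integral_unique[OF this] show ?thesis
      by (simp add: time_integral_def)
  qed
  have "((\<lambda>\<tau>. G \<tau> - G 0) has_vector_derivative u (t, x) - 0) (at t)"
    using b by (intro has_vector_derivative_diff G has_vector_derivative_const)
  then have "((\<lambda>\<tau>. G \<tau> - G 0) has_vector_derivative u (t, x)) (at t)"
    by simp
  then show ?thesis
  proof (rule has_vector_derivative_transform_within_open[of _ _ _ "{-b<..<b}"])
    show "G \<tau> - G 0 = time_integral u (\<tau>, x)" if "\<tau> \<in> {-b<..<b}" for \<tau>
      using J[of \<tau>] that by auto
  qed (use b in auto)
qed

text \<open>The time derivative is the integrand, by the fundamental theorem, and spatial
  derivatives pass under the integral; continuity of the spatial partial derivative combines the two
  into a total derivative.\<close>

lemma time_integral_has_derivative: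
  fixes u :: "real \<times> 'a::euclidean_space \<Rightarrow> 'b::euclidean_space"
  assumes P: "open P" and p: "p \<in> {-\<epsilon><..<\<epsilon>} \<times> P"
    and u: "\<And>q. q \<in> {-\<epsilon><..<\<epsilon>} \<times> P \<Longrightarrow> u differentiable (at q)"
    and u': "\<And>w. continuous_on ({-\<epsilon><..<\<epsilon>} \<times> P) (\<lambda>q. dir u q w)"
  shows "(time_integral u has_derivative
      (\<lambda>h. fst h *\<^sub>R u p + time_integral (\<lambda>q. dir u q (0, snd h)) p)) (at p)"
proof -
  let ?S = "{-\<epsilon><..<\<epsilon>} \<times> P"
  obtain t x where tx: "p = (t, x)" by fastforce
  then have t: "\<bar>t\<bar> < \<epsilon>" and x: "x \<in> P" using p by auto
  obtain d where d: "d > 0" "ball x d \<subseteq> P"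
    using P x open_contains_ball by blast
  have contu: "continuous_on ?S u"
    using u by (auto intro!: continuous_at_imp_continuous_on differentiable_imp_continuous_within)
  \<comment> \<open>The spatial derivative as a bounded linear map: both the Leibniz rule and the
    criterion by partial derivatives ask for continuity in operator norm.\<close>
  define D where "D = (\<lambda>q. Blinfun (\<lambda>w. dir u q (0, w)))"
  have D: "blinfun_apply (D q) = (\<lambda>w. dir u q (0, w))" if "q \<in> ?S" for q
  proof -
    have "bounded_linear (dir u q)"
      using u[OF that] has_derivative_dir has_derivative_bounded_linear by blast
    then have "bounded_linear (dir u q \<circ> (\<lambda>w. (0, w)))"
      unfolding o_def by (rule bounded_linear_compose) (intro bounded_linear_Pair bounded_linear_zero bounded_linear_ident)
    then show ?thesis
      by (simp add: D_def o_def bounded_linear_Blinfun_apply)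
  qed
  have contD: "continuous_on ?S D"
  proof (rule continuous_on_blinfun_componentwise)
    fix b :: 'a
    have "continuous_on ?S (\<lambda>q. blinfun_apply (D q) b) \<longleftrightarrow> continuous_on ?S (\<lambda>q. dir u q (0, b))"
      by (intro continuous_on_cong) (auto simp: D)
    then show "continuous_on ?S (\<lambda>q. blinfun_apply (D q) b)"
      using u' by simp
  qed
  have fy: "((\<lambda>y. time_integral u (\<tau>, y)) has_derivative blinfun_apply (time_integral D (\<tau>, y)))
      (at y within ball x d)" if \<tau>: "\<tau> \<in> {-\<epsilon><..<\<epsilon>}" and y: "y \<in> ball x d" for \<tau> y
  proof -
    have st: "(\<sigma> * \<tau>, y) \<in> ?S" if "\<sigma> \<in> {0..1}" "y \<in> ball x d" for \<sigma> y
      using scaled_time_in[of "(\<tau>, y)" \<epsilon> P \<sigma>] \<tau> that d by auto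
    have "((\<lambda>y. integral (cbox 0 1) (\<lambda>\<sigma>. u (\<sigma> * \<tau>, y))) has_derivative
        blinfun_apply (integral (cbox 0 1) (\<lambda>\<sigma>. D (\<sigma> * \<tau>, y)))) (at y within ball x d)"
    proof (rule leibniz_rule)
      fix y \<sigma> assume *: "y \<in> ball x d" "\<sigma> \<in> cbox 0 (1::real)"
      have "((\<lambda>y. u (\<sigma> * \<tau>, y)) has_derivative (\<lambda>w. dir u (\<sigma> * \<tau>, y) (0, w))) (at y within ball x d)"
      proof (rule has_derivative_compose[where f="\<lambda>y. (\<sigma> * \<tau>, y)" and g=u])
        show "((\<lambda>y. (\<sigma> * \<tau>, y)) has_derivative (\<lambda>w. (0, w))) (at y within ball x d)"
          by (auto intro!: derivative_eq_intros)
        show "(u has_derivative dir u (\<sigma> * \<tau>, y)) (at (\<sigma> * \<tau>, y))"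
          using st[of \<sigma> y] * u by (intro has_derivative_dir) auto
      qed
      then show "((\<lambda>y. u (\<sigma> * \<tau>, y)) has_derivative blinfun_apply (D (\<sigma> * \<tau>, y))) (at y within ball x d)"
        using st[of \<sigma> y] * by (simp add: D)
    next
      fix y assume "y \<in> ball x d"
      then have "continuous_on {0..1} (\<lambda>\<sigma>. u (\<sigma> * \<tau>, y))"
        using continuous_on_scaled_time_slice[OF contu, of "(\<tau>, y)"] \<tau> d by auto
      then show "(\<lambda>\<sigma>. u (\<sigma> * \<tau>, y)) integrable_on cbox 0 1"
        by (simp add: integrable_continuous_interval)
    next
      show "continuous_on (ball x d \<times> cbox 0 1) (\<lambda>(y, \<sigma>). D (\<sigma> * \<tau>, y))"
        unfolding split_beta
        by (rule continuous_on_compose2[OF contD]) (use st in \<open>auto intro!: continuous_intros\<close>)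
    qed (use y in auto)
    then have "((\<lambda>y. \<tau> *\<^sub>R integral (cbox 0 1) (\<lambda>\<sigma>. u (\<sigma> * \<tau>, y))) has_derivative
        (\<lambda>w. \<tau> *\<^sub>R blinfun_apply (integral (cbox 0 1) (\<lambda>\<sigma>. D (\<sigma> * \<tau>, y))) w)) (at y within ball x d)"
      by (rule has_derivative_scaleR_right)
    moreover have "blinfun_apply (time_integral D (\<tau>, y)) =
        (\<lambda>w. \<tau> *\<^sub>R blinfun_apply (integral (cbox 0 1) (\<lambda>\<sigma>. D (\<sigma> * \<tau>, y))) w)"
      by (simp add: time_integral_def scaleR_blinfun.rep_eq)
    ultimately show ?thesis
      by (simp add: time_integral_def)
  qed
  have contfy: "continuous (at (t, x) within {-\<epsilon><..<\<epsilon>} \<times> ball x d) (\<lambda>(\<tau>, y). time_integral D (\<tau>, y))"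
  proof -
    have "continuous_on ?S (\<lambda>(\<tau>, y). time_integral D (\<tau>, y))"
      using time_integral_continuous[OF contD] by (simp add: split_beta)
    then have "continuous_on ({-\<epsilon><..<\<epsilon>} \<times> ball x d) (\<lambda>(\<tau>, y). time_integral D (\<tau>, y))"
      by (rule continuous_on_subset) (use d in auto)
    then show ?thesis
      using t d by (auto simp: continuous_on_eq_continuous_within abs_less_iff minus_less_iff)
  qed
  have fx: "((\<lambda>\<tau>. time_integral u (\<tau>, x)) has_derivative (\<lambda>a. a *\<^sub>R u p)) (at t within {-\<epsilon><..<\<epsilon>})"
    using time_integral_deriv[OF contu t x] tx
    by (simp add: has_vector_derivative_def has_derivative_at_withinI)
  have "((\<lambda>(\<tau>, y). time_integral u (\<tau>, y)) has_derivative
      (\<lambda>(a, w). a *\<^sub>R u p + blinfun_apply (time_integral D (t, x)) w))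
      (at (t, x) within {-\<epsilon><..<\<epsilon>} \<times> ball x d)"
    by (rule has_derivative_partialsI[OF fx fy contfy]) (use d in auto)
  moreover have "at (t, x) within {-\<epsilon><..<\<epsilon>} \<times> ball x d = at (t, x)"
    using t d by (intro at_within_open) (auto intro: open_Times)
  moreover have "blinfun_apply (time_integral D p) w = time_integral (\<lambda>q. dir u q (0, w)) p" for w
  proof -
    have *: "(\<lambda>\<sigma>. D (\<sigma> * fst p, snd p)) integrable_on {0..1}"
      using continuous_on_scaled_time_slice[OF contD p] by (rule integrable_continuous_interval)
    have "integral {0..1} ((\<lambda>A. blinfun_apply A w) \<circ> (\<lambda>\<sigma>. D (\<sigma> * fst p, snd p))) =
        blinfun_apply (integral {0..1} (\<lambda>\<sigma>. D (\<sigma> * fst p, snd p))) w"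
      using * by (rule integral_linear) (intro bounded_linear_intros)
    moreover have "integral {0..1} ((\<lambda>A. blinfun_apply A w) \<circ> (\<lambda>\<sigma>. D (\<sigma> * fst p, snd p))) =
        integral {0..1} (\<lambda>\<sigma>. dir u (\<sigma> * fst p, snd p) (0, w))"
      using scaled_time_in[OF p] by (intro integral_cong) (simp add: D)
    ultimately show ?thesis
      by (simp add: time_integral_def scaleR_blinfun.rep_eq)
  qed
  ultimately show ?thesis
    by (simp add: tx case_prod_unfold)
qed

text \<open>Sweeping \<open>C\<close> towards time zero gives a compact set that contains, along
  with each of its points, all arguments at which \<open>time_integral\<close> evaluates its
  integrand there. Bounds on such a set can therefore be iterated.\<close>

lemma compact_time_hull:
  fixes C :: "(real \<times> 'a::topological_space) set"
  assumes "compact C" "C \<subseteq> {-\<epsilon><..<\<epsilon>} \<times> P"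
  obtains C' where "compact C'" "C \<subseteq> C'" "C' \<subseteq> {-\<epsilon><..<\<epsilon>} \<times> P"
    "\<And>p \<sigma>. p \<in> C' \<Longrightarrow> \<sigma> \<in> {0..1} \<Longrightarrow> (\<sigma> * fst p, snd p) \<in> C'"
proof
  let ?s = "\<lambda>z::real \<times> real \<times> 'a. (fst z * fst (snd z), snd (snd z))"
  let ?C = "?s ` ({0..1} \<times> C)"
  show "compact ?C"
    using assms by (intro compact_continuous_image compact_Times continuous_intros) auto
  show "C \<subseteq> ?C"
  proof
    fix p assume "p \<in> C"
    then show "p \<in> ?C" by (intro image_eqI[of _ _ "(1, p)"]) auto
  qed
  show "?C \<subseteq> {-\<epsilon><..<\<epsilon>} \<times> P"
  proof (rule image_subsetI)
    fix z assume "z \<in> {0..1::real} \<times> C"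
    then have "snd z \<in> {-\<epsilon><..<\<epsilon>} \<times> P" "fst z \<in> {0..1}"
      using assms(2) by (auto simp: mem_Times_iff)
    then show "?s z \<in> {-\<epsilon><..<\<epsilon>} \<times> P" by (rule scaled_time_in)
  qed
  show "(\<sigma> * fst p, snd p) \<in> ?C" if p: "p \<in> ?C" and \<sigma>: "\<sigma> \<in> {0..1}" for p \<sigma>
  proof -
    obtain \<tau> q where q: "\<tau> \<in> {0..1}" "q \<in> C" "p = (\<tau> * fst q, snd q)"
      using p by auto
    then have "(\<sigma> * fst p, snd p) = ?s (\<sigma> * \<tau>, q)"
      by (simp add: mult.assoc)
    moreover have "(\<sigma> * \<tau>, q) \<in> {0..1} \<times> C"
      using q \<sigma> by (auto simp: mult_le_one)
    ultimately show ?thesis by (rule image_eqI)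
  qed
qed

lemma time_integral_locally_convergent:
  fixes u :: "nat \<Rightarrow> real \<times> 'a::topological_space \<Rightarrow> 'b::banach"
  assumes \<epsilon>: "\<epsilon> > 0" and u: "locally_convergent ({-\<epsilon><..<\<epsilon>} \<times> P) u"
  shows "locally_convergent ({-\<epsilon><..<\<epsilon>} \<times> P) (\<lambda>j. time_integral (u j))"
proof -
  let ?S = "{-\<epsilon><..<\<epsilon>} \<times> P"
  have cont: "continuous_on ?S (u j)" for j
    using u by (auto simp: locally_convergent_def)
  have "uniformly_convergent_on C (\<lambda>j. time_integral (u j))" if C: "compact C" "C \<subseteq> ?S" for C
  proof -
    obtain C' where C': "compact C'" "C \<subseteq> C'" "C' \<subseteq> ?S"
      and hull: "\<And>p \<sigma>. p \<in> C' \<Longrightarrow> \<sigma> \<in> {0..1} \<Longrightarrow> (\<sigma> * fst p, snd p) \<in> C'"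
      using compact_time_hull[OF C] by metis
    have cauchy: "uniformly_Cauchy_on C' u"
      using u C' by (intro uniformly_convergent_Cauchy) (auto simp: locally_convergent_def)
    have "uniformly_Cauchy_on C (\<lambda>j. time_integral (u j))"
    proof (rule uniformly_Cauchy_onI)
      fix e :: real assume "e > 0"
      \<comment> \<open>Dividing by \<open>2 * \<epsilon>\<close> compensates the factor
        \<open>\<epsilon>\<close> of the integral and leaves room for a strict inequality.\<close>
      then obtain N where N: "\<And>p m n. p \<in> C' \<Longrightarrow> m \<ge> N \<Longrightarrow> n \<ge> N \<Longrightarrow> dist (u m p) (u n p) < e / (2 * \<epsilon>)"
        using cauchy \<epsilon> unfolding uniformly_Cauchy_on_def
        by (metis divide_pos_pos mult_pos_pos zero_less_numeral)
      have "dist (time_integral (u m) p) (time_integral (u n) p) < e" if "p \<in> C" "m \<ge> N" "n \<ge> N" for p m n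
      proof -
        have p: "p \<in> ?S" "p \<in> C'" using that C' by auto
        have "norm (time_integral (\<lambda>q. u m q - u n q) p) \<le> \<epsilon> * (e / (2 * \<epsilon>))"
        proof (rule time_integral_bound)
          show "continuous_on ?S (\<lambda>q. u m q - u n q)"
            by (intro continuous_intros cont)
          show "norm (u m (\<sigma> * fst p, snd p) - u n (\<sigma> * fst p, snd p)) \<le> e / (2 * \<epsilon>)" if "\<sigma> \<in> {0..1}" for \<sigma>
            using N[OF hull[OF p(2) that]] \<open>m \<ge> N\<close> \<open>n \<ge> N\<close> by (auto simp: dist_norm intro: less_imp_le)
        qed fact
        also have "\<epsilon> * (e / (2 * \<epsilon>)) < e" using \<open>e > 0\<close> \<epsilon> by simp
        finally show ?thesis
          by (simp add: time_integral_diff[OF cont cont p(1)] dist_norm)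
      qed
      then show "\<exists>M. \<forall>p\<in>C. \<forall>m\<ge>M. \<forall>n\<ge>M. dist (time_integral (u m) p) (time_integral (u n) p) < e"
        by blast
    qed
    then show ?thesis
      by (rule Cauchy_uniformly_convergent)
  qed
  then show ?thesis
    by (auto simp: locally_convergent_def intro: time_integral_continuous cont)
qed

text \<open>Differentiation in time returns \<open>u\<close> itself and differentiation in space
  commutes with the integral, so every first derivative is again built from sequences that converge
  to order \<open>r\<close>.\<close>

lemma Ck_seq_time_integral:
  fixes u :: "nat \<Rightarrow> real \<times> 'a::euclidean_space \<Rightarrow> 'b::euclidean_space"
  assumes \<epsilon>: "\<epsilon> > 0" and P: "open P" and u: "Ck_seq r ({-\<epsilon><..<\<epsilon>} \<times> P) u"
  shows "Ck_seq r ({-\<epsilon><..<\<epsilon>} \<times> P) (\<lambda>j. time_integral (u j))"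
  using u
proof (induction r arbitrary: u)
  case 0
  then show ?case by (simp add: time_integral_locally_convergent \<epsilon>)
next
  case (Suc r)
  let ?S = "{-\<epsilon><..<\<epsilon>} \<times> P"
  have S: "open ?S" using P by (simp add: open_Times)
  have cont: "continuous_on ?S (\<lambda>q. dir (u j) q w)" for j w
  proof -
    have "Ck_seq r ?S (\<lambda>j q. dir (u j) q w)"
      using Suc.prems unfolding Ck_seq.simps by blast
    from Ck_seq_locally_convergent[OF this] show ?thesis
      by (simp add: locally_convergent_def)
  qed
  have der: "(time_integral (u j) has_derivative
      (\<lambda>h. fst h *\<^sub>R u j p + time_integral (\<lambda>q. dir (u j) q (0, snd h)) p)) (at p)" if "p \<in> ?S" for j p
    using Suc.prems by (intro time_integral_has_derivative[OF P that] cont) auto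
  have "Ck_seq r ?S (\<lambda>j p. fst h *\<^sub>R u j p + time_integral (\<lambda>q. dir (u j) q (0, snd h)) p)" for h
    using Suc.prems Ck_seq_Suc[OF Suc.prems]
    by (intro Ck_seq_add[OF S] Suc.IH Ck_seq_bilinear[OF S bounded_bilinear_scaleR] Ck_seq_constant) auto
  then have "Ck_seq r ?S (\<lambda>j p. dir (time_integral (u j)) p h)" for h
    by (simp add: Ck_seq_cong[OF S dir_eq[OF der]])
  moreover have "locally_convergent ?S (\<lambda>j. time_integral (u j))"
    using Suc.prems by (intro time_integral_locally_convergent \<epsilon>) auto
  ultimately show ?case
    using differentiableI[OF der] by simp
qed

section \<open>Smooth flows\<close>

text \<open>By \<open>step\<close> the oscillation \<open>D\<close> is halved up to an error that
  can be made small by going far enough along the sequence. Both hypotheses concern only compact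
  sets closed under scaling time towards zero, the sets on which the integral operator sees nothing
  from outside.\<close>

lemma contraction_locally_convergent:
  fixes z :: "nat \<Rightarrow> real \<times> 'a::topological_space \<Rightarrow> 'b::banach"
  assumes cont: "\<And>j. continuous_on ({-\<epsilon><..<\<epsilon>} \<times> P) (z j)"
    and bdd: "\<And>C. compact C \<Longrightarrow> C \<subseteq> {-\<epsilon><..<\<epsilon>} \<times> P \<Longrightarrow>
      (\<And>p \<sigma>. p \<in> C \<Longrightarrow> \<sigma> \<in> {0..1} \<Longrightarrow> (\<sigma> * fst p, snd p) \<in> C) \<Longrightarrow> \<exists>B. \<forall>j. \<forall>p\<in>C. norm (z j p) \<le> B"
    and step: "\<And>C e. compact C \<Longrightarrow> C \<subseteq> {-\<epsilon><..<\<epsilon>} \<times> P \<Longrightarrow>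
      (\<And>p \<sigma>. p \<in> C \<Longrightarrow> \<sigma> \<in> {0..1} \<Longrightarrow> (\<sigma> * fst p, snd p) \<in> C) \<Longrightarrow> e > 0 \<Longrightarrow>
      \<exists>N. \<forall>i\<ge>N. \<forall>j\<ge>N. \<forall>D. (\<forall>p\<in>C. norm (z i p - z j p) \<le> D) \<longrightarrow>
        (\<forall>p\<in>C. norm (z (Suc i) p - z (Suc j) p) \<le> e + D / 2)"
  shows "locally_convergent ({-\<epsilon><..<\<epsilon>} \<times> P) z"
  unfolding locally_convergent_def
proof (intro conjI allI impI cont)
  fix C0 assume C0: "compact C0" "C0 \<subseteq> {-\<epsilon><..<\<epsilon>} \<times> P"
  obtain C where C: "compact C" "C0 \<subseteq> C" "C \<subseteq> {-\<epsilon><..<\<epsilon>} \<times> P"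
    and hull: "\<And>p \<sigma>. p \<in> C \<Longrightarrow> \<sigma> \<in> {0..1} \<Longrightarrow> (\<sigma> * fst p, snd p) \<in> C"
    using compact_time_hull[OF C0] by metis
  obtain B where B: "\<And>j p. p \<in> C \<Longrightarrow> norm (z j p) \<le> B"
    using bdd[OF C(1,3) hull] by blast
  \<comment> \<open>The crude bound \<open>2 * B\<close> is halved \<open>l\<close> times, while the
    error stays at \<open>e\<close>: each step adds \<open>e / 2\<close> to half of the old
    error.\<close>
  have geometric: "\<exists>N. \<forall>i\<ge>N. \<forall>j\<ge>N. \<forall>p\<in>C. norm (z i p - z j p) \<le> 2 * B / 2 ^ l + e"
    if e: "e > 0" for l e
  proof (induction l)
    case 0
    have "norm (z i p - z j p) \<le> 2 * B / 2 ^ 0 + e" if "p \<in> C" for i j p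
      using B[OF that, of i] B[OF that, of j] norm_triangle_ineq4[of "z i p" "z j p"] e by simp
    then show ?case by blast
  next
    case (Suc l)
    obtain N where N: "\<And>i j p. i \<ge> N \<Longrightarrow> j \<ge> N \<Longrightarrow> p \<in> C \<Longrightarrow> norm (z i p - z j p) \<le> 2 * B / 2 ^ l + e"
      using Suc by blast
    obtain M where M: "\<And>i j D p. i \<ge> M \<Longrightarrow> j \<ge> M \<Longrightarrow> (\<And>p. p \<in> C \<Longrightarrow> norm (z i p - z j p) \<le> D) \<Longrightarrow>
        p \<in> C \<Longrightarrow> norm (z (Suc i) p - z (Suc j) p) \<le> e / 2 + D / 2"
      using step[OF C(1,3) hull, of "e / 2"] e by (metis half_gt_zero)
    have "norm (z i p - z j p) \<le> 2 * B / 2 ^ Suc l + e"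
      if ij: "i \<ge> Suc (max N M)" "j \<ge> Suc (max N M)" and p: "p \<in> C" for i j p
    proof -
      obtain i' j' where ij': "i = Suc i'" "j = Suc j'"
        using ij by (metis Suc_le_D)
      have "norm (z (Suc i') p - z (Suc j') p) \<le> e / 2 + (2 * B / 2 ^ l + e) / 2"
        using ij ij' p by (intro M N) auto
      then show ?thesis using ij' by (simp add: field_simps)
    qed
    then show ?case by blast
  qed
  have "uniformly_Cauchy_on C0 z"
  proof (rule uniformly_Cauchy_onI)
    fix e :: real assume e: "e > 0"
    have "(\<lambda>l. (2 * B) * (1 / 2) ^ l) \<longlonglongrightarrow> 2 * B * 0"
      by (intro tendsto_intros LIMSEQ_power_zero) auto
    then have "\<forall>\<^sub>F l in sequentially. (2 * B) * (1 / 2) ^ l < e / 2"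
      using e by (intro order_tendstoD(2)[of _ "2 * B * 0"]) auto
    then obtain l where l: "(2 * B) * (1 / 2) ^ l < e / 2"
      by (auto simp: eventually_sequentially)
    obtain N where N: "\<And>i j p. i \<ge> N \<Longrightarrow> j \<ge> N \<Longrightarrow> p \<in> C \<Longrightarrow> norm (z i p - z j p) \<le> 2 * B / 2 ^ l + e / 2"
      using geometric[of "e / 2" l] e by auto
    have "dist (z i p) (z j p) < e" if "p \<in> C0" "i \<ge> N" "j \<ge> N" for i j p
      using N[of i j p] that C l by (auto simp: dist_norm power_one_over)
    then show "\<exists>M. \<forall>p\<in>C0. \<forall>m\<ge>M. \<forall>n\<ge>M. dist (z m p) (z n p) < e"
      by blast
  qed
  then show "uniformly_convergent_on C0 z"
    by (rule Cauchy_uniformly_convergent)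
qed

text \<open>Coefficients and inhomogeneity vary with the index, so this is only asymptotically a
  contraction: \<open>\<epsilon> * K \<le> 1 / 2\<close> halves the difference of two iterates, and
  the variation of \<open>a\<close> and \<open>b\<close> is absorbed in the vanishing error.\<close>

lemma linear_recursion_locally_convergent:
  fixes z :: "nat \<Rightarrow> real \<times> 'a::topological_space \<Rightarrow> 'b::euclidean_space"
  assumes \<epsilon>: "\<epsilon> > 0" and \<epsilon>K: "\<epsilon> * K \<le> 1 / 2" "K \<ge> 0"
    and b: "locally_convergent ({-\<epsilon><..<\<epsilon>} \<times> P) b"
    and a: "\<And>i. i \<in> Basis \<Longrightarrow> locally_convergent ({-\<epsilon><..<\<epsilon>} \<times> P) (a i)"
    and aK: "\<And>j p v. p \<in> {-\<epsilon><..<\<epsilon>} \<times> P \<Longrightarrow> norm (\<Sum>i\<in>Basis. (v \<bullet> i) *\<^sub>R a i j p) \<le> K * norm (v::'b)"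
    and z0: "continuous_on ({-\<epsilon><..<\<epsilon>} \<times> P) (z 0)"
    and z: "\<And>j p. p \<in> {-\<epsilon><..<\<epsilon>} \<times> P \<Longrightarrow>
      z (Suc j) p = b j p + time_integral (\<lambda>q. \<Sum>i\<in>Basis. (z j q \<bullet> i) *\<^sub>R a i j q) p"
  shows "locally_convergent ({-\<epsilon><..<\<epsilon>} \<times> P) z"
proof -
  let ?S = "{-\<epsilon><..<\<epsilon>} \<times> P"
  let ?A = "\<lambda>j q v. \<Sum>i\<in>Basis. (v \<bullet> i) *\<^sub>R a i j q"
  have contA: "continuous_on ?S (\<lambda>q. ?A j q (f q))" if "continuous_on ?S f" for j f
    using a that by (intro continuous_intros) (auto simp: locally_convergent_def)
  have cont: "continuous_on ?S (z j)" for j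
  proof (induction j)
    case (Suc j)
    have "continuous_on ?S (\<lambda>p. b j p + time_integral (\<lambda>q. ?A j q (z j q)) p)"
      using b by (intro continuous_intros time_integral_continuous contA Suc) (auto simp: locally_convergent_def)
    then show ?case
      using continuous_on_cong[of ?S ?S "z (Suc j)"] z by simp
  qed (rule z0)
  have bdd: "\<exists>B>0. \<forall>j. \<forall>p\<in>C. norm (z j p) \<le> B" if C: "compact C" "C \<subseteq> ?S"
    and hull: "\<And>p \<sigma>. p \<in> C \<Longrightarrow> \<sigma> \<in> {0..1} \<Longrightarrow> (\<sigma> * fst p, snd p) \<in> C" for C
  proof -
    obtain B1 where B1: "\<And>j p. p \<in> C \<Longrightarrow> norm (b j p) \<le> B1"
      using locally_convergent_bounded[OF b C] by blast
    have "continuous_on C (z 0)"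
      using z0 C by (auto intro: continuous_on_subset)
    then have "bounded (z 0 ` C)"
      using C by (intro compact_imp_bounded compact_continuous_image)
    then obtain B2 where B2: "\<And>p. p \<in> C \<Longrightarrow> norm (z 0 p) \<le> B2"
      by (auto simp: bounded_iff)
    \<comment> \<open>The bound \<open>2 * B\<close> reproduces itself: \<open>b\<close> contributes
      at most \<open>B\<close>, and the integral at most half of \<open>2 * B\<close>. The entry 1
      keeps \<open>B\<close> positive.\<close>
    define B where "B = max 1 (max B1 B2)"
    have B: "B > 0" "B1 \<le> B" "B2 \<le> B" by (auto simp: B_def)
    have "norm (z j p) \<le> 2 * B" if "p \<in> C" for j p
      using that
    proof (induction j arbitrary: p)
      case 0
      then show ?case using B2[of p] B by auto
    next
      case (Suc j)
      have p: "p \<in> ?S" using Suc C by auto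
      have "norm (time_integral (\<lambda>q. ?A j q (z j q)) p) \<le> \<epsilon> * (K * (2 * B))"
      proof (rule time_integral_bound[OF contA[OF cont] p])
        fix \<sigma> :: real assume "\<sigma> \<in> {0..1}"
        with hull Suc.prems have *: "(\<sigma> * fst p, snd p) \<in> C" by blast
        then have "(\<sigma> * fst p, snd p) \<in> ?S" using C by blast
        from aK[OF this, of "z j (\<sigma> * fst p, snd p)" j]
        show "norm (?A j (\<sigma> * fst p, snd p) (z j (\<sigma> * fst p, snd p))) \<le> K * (2 * B)"
          using Suc.IH[OF *] \<epsilon>K(2) mult_left_mono order_trans by blast
      qed
      also have "\<dots> = \<epsilon> * K * (2 * B)" by simp
      also have "\<dots> \<le> 1 / 2 * (2 * B)"
        using \<epsilon>K B by (intro mult_right_mono) auto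
      finally show ?case
        unfolding z[OF p] using B1[OF Suc.prems, of j] B
          norm_triangle_ineq[of "b j p" "time_integral (\<lambda>q. ?A j q (z j q)) p"] by simp
    qed
    then show ?thesis using B by (intro exI[of _ "2 * B"]) auto
  qed
  have uc: "\<exists>N. \<forall>i\<ge>N. \<forall>j\<ge>N. \<forall>p\<in>C. norm (u i p - u j p) \<le> e"
    if u: "locally_convergent ?S u" and C: "compact C" "C \<subseteq> ?S" and e: "e > 0"
    for u :: "nat \<Rightarrow> real \<times> 'a \<Rightarrow> 'b" and C e
  proof -
    have "uniformly_Cauchy_on C u"
      using u C by (intro uniformly_convergent_Cauchy) (auto simp: locally_convergent_def)
    then show ?thesis
      using e unfolding uniformly_Cauchy_on_def dist_norm by (meson less_imp_le)
  qed
  show ?thesis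
  proof (rule contraction_locally_convergent[OF cont])
    show "\<exists>B. \<forall>j. \<forall>p\<in>C. norm (z j p) \<le> B" if "compact C" "C \<subseteq> ?S"
      "\<And>p \<sigma>. p \<in> C \<Longrightarrow> \<sigma> \<in> {0..1} \<Longrightarrow> (\<sigma> * fst p, snd p) \<in> C" for C
      using bdd[OF that] by blast
  next
    fix C and e :: real
    assume C: "compact C" "C \<subseteq> ?S" and hull: "\<And>p \<sigma>. p \<in> C \<Longrightarrow> \<sigma> \<in> {0..1} \<Longrightarrow> (\<sigma> * fst p, snd p) \<in> C"
      and e: "e > 0"
    obtain B where B: "B > 0" "\<And>j p. p \<in> C \<Longrightarrow> norm (z j p) \<le> B"
      using bdd[OF C hull] by blast
    define d where "d = real DIM('b)"
    have d: "d > 0" by (simp add: d_def)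
    \<comment> \<open>Chosen so that the variation of the coefficients, summed over the
      \<open>d\<close> basis vectors and integrated, contributes
      \<open>\<epsilon> * d * B * e' = e / 2\<close>.\<close>
    define e' where "e' = e / (2 * \<epsilon> * B * d)"
    have e': "e' > 0" using e \<epsilon> B d by (simp add: e'_def)
    obtain Nb where Nb: "\<And>i j p. i \<ge> Nb \<Longrightarrow> j \<ge> Nb \<Longrightarrow> p \<in> C \<Longrightarrow> norm (b i p - b j p) \<le> e / 2"
      using uc[OF b C, of "e / 2"] e by auto
    have "\<forall>l\<in>Basis. \<exists>N. \<forall>i\<ge>N. \<forall>j\<ge>N. \<forall>p\<in>C. norm (a l i p - a l j p) \<le> e'"
      using uc[OF a C e'] by blast
    then obtain Na where Na: "\<And>l i j p. l \<in> Basis \<Longrightarrow> i \<ge> Na l \<Longrightarrow> j \<ge> Na l \<Longrightarrow> p \<in> C \<Longrightarrow> norm (a l i p - a l j p) \<le> e'"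
      by metis
    define N where "N = Nb + (\<Sum>l\<in>Basis. Na l)"
    have Na_le: "Na l \<le> N" if "l \<in> Basis" for l
      using member_le_sum[of l Basis Na] that by (simp add: N_def)
    have "norm (z (Suc i) p - z (Suc j) p) \<le> e + D / 2"
      if ij: "i \<ge> N" "j \<ge> N" and D: "\<forall>p\<in>C. norm (z i p - z j p) \<le> D" and p: "p \<in> C" for i j D p
    proof -
      have pS: "p \<in> ?S" using p C by auto
      let ?Fi = "\<lambda>q. ?A i q (z i q)" and ?Fj = "\<lambda>q. ?A j q (z j q)"
      have pt: "norm (?Fi q - ?Fj q) \<le> K * D + d * (B * e')" if q: "q \<in> C" for q
      proof -
        \<comment> \<open>Difference of products: the same coefficients on different vectors, plus
          different coefficients on the same vector.\<close>
        have "?Fi q - ?Fj q = ?A i q (z i q - z j q) + (\<Sum>l\<in>Basis. (z j q \<bullet> l) *\<^sub>R (a l i q - a l j q))"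
          by (simp add: sum.distrib[symmetric] sum_subtractf[symmetric] algebra_simps inner_diff_left)
        moreover have "norm (?A i q (z i q - z j q)) \<le> K * D"
        proof -
          have "norm (?A i q (z i q - z j q)) \<le> K * norm (z i q - z j q)"
            using q C by (intro aK) auto
          also have "\<dots> \<le> K * D" using D q \<epsilon>K by (intro mult_left_mono) auto
          finally show ?thesis .
        qed
        moreover have "norm (\<Sum>l\<in>Basis. (z j q \<bullet> l) *\<^sub>R (a l i q - a l j q)) \<le> (\<Sum>l\<in>(Basis::'b set). B * e')"
        proof (rule sum_norm_le)
          fix l :: 'b assume l: "l \<in> Basis"
          have "\<bar>z j q \<bullet> l\<bar> \<le> B"
            using Basis_le_norm[OF l, of "z j q"] B(2)[OF q, of j] by linarith
          moreover have "norm (a l i q - a l j q) \<le> e'"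
            using Na_le[OF l] ij l q by (intro Na) auto
          ultimately show "norm ((z j q \<bullet> l) *\<^sub>R (a l i q - a l j q)) \<le> B * e'"
            unfolding norm_scaleR using B by (intro mult_mono) auto
        qed
        ultimately show ?thesis
          using norm_triangle_ineq[of "?A i q (z i q - z j q)" "\<Sum>l\<in>Basis. (z j q \<bullet> l) *\<^sub>R (a l i q - a l j q)"]
          by (simp add: d_def)
      qed
      have "norm (time_integral (\<lambda>q. ?Fi q - ?Fj q) p) \<le> \<epsilon> * (K * D + d * (B * e'))"
      proof (rule time_integral_bound[OF _ pS])
        show "continuous_on ?S (\<lambda>q. ?Fi q - ?Fj q)"
          using contA[OF cont, of i i] contA[OF cont, of j j] by (rule continuous_on_diff)
        show "norm (?Fi (\<sigma> * fst p, snd p) - ?Fj (\<sigma> * fst p, snd p)) \<le> K * D + d * (B * e')"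
          if "\<sigma> \<in> {0..1}" for \<sigma>
          by (rule pt[OF hull[OF p that]])
      qed
      also have "\<dots> = \<epsilon> * K * D + e / 2"
        using \<epsilon> B d by (simp add: e'_def field_simps)
      also have "\<epsilon> * K * D \<le> 1 / 2 * D"
      proof (rule mult_right_mono[OF \<epsilon>K(1)])
        have "norm (z i p - z j p) \<le> D" using D p by blast
        then show "0 \<le> D" using norm_ge_zero[of "z i p - z j p"] by linarith
      qed
      finally have "norm (time_integral ?Fi p - time_integral ?Fj p) \<le> D / 2 + e / 2"
        using time_integral_diff[OF contA[OF cont] contA[OF cont] pS, of i i j j] by simp
      moreover have "norm (b i p - b j p) \<le> e / 2"
        using ij p by (intro Nb) (auto simp: N_def)
      moreover have "z (Suc i) p - z (Suc j) p = (b i p - b j p) + (time_integral ?Fi p - time_integral ?Fj p)"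
        by (simp add: z[OF pS])
      ultimately show ?thesis
        using norm_triangle_ineq[of "b i p - b j p" "time_integral ?Fi p - time_integral ?Fj p"] by simp
    qed
    then show "\<exists>N. \<forall>i\<ge>N. \<forall>j\<ge>N. \<forall>D. (\<forall>p\<in>C. norm (z i p - z j p) \<le> D) \<longrightarrow>
        (\<forall>p\<in>C. norm (z (Suc i) p - z (Suc j) p) \<le> e + D / 2)"
      by blast
  qed
qed

text \<open>Each spatial derivative of the iterates satisfies a recursion with the same linear part, which is
  what makes the induction on the order of differentiability go through.\<close>

lemma linear_recursion_Ck_seq:
  fixes z :: "nat \<Rightarrow> real \<times> 'a::euclidean_space \<Rightarrow> 'b::euclidean_space"
  assumes \<epsilon>: "\<epsilon> > 0" and \<epsilon>K: "\<epsilon> * K \<le> 1 / 2" "K \<ge> 0" and P: "open P"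
    and b: "Ck_seq r ({-\<epsilon><..<\<epsilon>} \<times> P) b"
    and a: "\<And>i. i \<in> Basis \<Longrightarrow> Ck_seq r ({-\<epsilon><..<\<epsilon>} \<times> P) (a i)"
    and aK: "\<And>j p v. p \<in> {-\<epsilon><..<\<epsilon>} \<times> P \<Longrightarrow> norm (\<Sum>i\<in>Basis. (v \<bullet> i) *\<^sub>R a i j p) \<le> K * norm (v::'b)"
    and z0: "Ck_on r ({-\<epsilon><..<\<epsilon>} \<times> P) (z 0)"
    and z: "\<And>j p. p \<in> {-\<epsilon><..<\<epsilon>} \<times> P \<Longrightarrow>
      z (Suc j) p = b j p + time_integral (\<lambda>q. \<Sum>i\<in>Basis. (z j q \<bullet> i) *\<^sub>R a i j q) p"
  shows "Ck_seq r ({-\<epsilon><..<\<epsilon>} \<times> P) z"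
  using b a z0 z
proof (induction r arbitrary: b z)
  case 0
  then show ?case
    using linear_recursion_locally_convergent[OF \<epsilon> \<epsilon>K, of P b a z] aK by simp
next
  case (Suc r)
  let ?S = "{-\<epsilon><..<\<epsilon>} \<times> P"
  note z = Suc.prems(4)
  let ?Az = "\<lambda>j q. \<Sum>i\<in>Basis. (z j q \<bullet> i) *\<^sub>R a i j q"
  have S: "open ?S" using P by (simp add: open_Times)
  have z0': "Ck_on r ?S (z 0)" 
    using Ck_seq_Suc[of r ?S "\<lambda>j. z 0"] Suc.prems(3) by (simp only: Ck_seq_const)
  have ar: "Ck_seq r ?S (a i)" if "i \<in> Basis" for i
    using Suc.prems(2)[OF that] by (rule Ck_seq_Suc)
  \<comment> \<open>Order \<open>r\<close> for \<open>z\<close> itself comes first, because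
    \<open>z\<close> enters the inhomogeneous term of the differentiated recursion.\<close>
  have zr: "Ck_seq r ?S z"
    by (rule Suc.IH[OF Ck_seq_Suc[OF Suc.prems(1)] ar z0' z])
  note b_Suc = Suc.prems(1) and a_Suc = Suc.prems(2)
  have zC: "Ck_on (Suc r) ?S (z j)" for j
  proof (induction j)
    case (Suc j)
    have "Ck_seq (Suc r) ?S (\<lambda>_ p. b j p + time_integral (?Az j) p)"
      by (intro Ck_seq_add[OF S] Ck_seq_time_integral[OF \<epsilon> P] Ck_seq_sum S
        Ck_seq_bilinear[OF S bounded_bilinear_scaleR] Ck_seq_bilinear[OF S bounded_bilinear_inner]
        Ck_seq_constant Ck_seq_term[OF b_Suc] Ck_seq_term[OF a_Suc] Suc[folded Ck_seq_const])
    then show ?case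
      by (simp only: Ck_seq_const Ck_on_cong[OF S z[of _ j]])
  qed (rule Suc.prems(3))
  note z_diff = zC[unfolded Ck_on.simps, THEN conjunct1, rule_format]
  have a_diff: "a i j differentiable (at p)" if "i \<in> Basis" "p \<in> ?S" for i j p
    using Suc.prems(2)[OF that(1)] that(2) unfolding Ck_seq.simps by blast
  have b_diff: "b j differentiable (at p)" if "p \<in> ?S" for j p
    using Suc.prems(1) that unfolding Ck_seq.simps by blast
  have a': "Ck_seq r ?S (\<lambda>j p. dir (a i j) p w)" if "i \<in> Basis" for i w
    using Suc.prems(2)[OF that] unfolding Ck_seq.simps by blast
  have b': "Ck_seq r ?S (\<lambda>j p. dir (b j) p w)" for w
    using Suc.prems(1) unfolding Ck_seq.simps by blast
  \<comment> \<open>The product rule splits the derivative of the integrand: \<open>?B\<close>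
    carries the derivative of the coefficients and joins the inhomogeneity, \<open>?A'\<close> is
    the old linear part applied to the derivative of \<open>z\<close>.\<close>
  let ?B = "\<lambda>w j q. \<Sum>i\<in>Basis. (z j q \<bullet> i) *\<^sub>R dir (a i j) q w"
  let ?A' = "\<lambda>w j q. \<Sum>i\<in>Basis. (dir (z j) q w \<bullet> i) *\<^sub>R a i j q"
  have Br: "Ck_seq r ?S (?B w)" for w
    by (intro Ck_seq_sum S Ck_seq_bilinear[OF S bounded_bilinear_scaleR]
        Ck_seq_bilinear[OF S bounded_bilinear_inner] zr Ck_seq_constant a')
  have Ar: "Ck_seq r ?S ?Az"
    by (intro Ck_seq_sum S Ck_seq_bilinear[OF S bounded_bilinear_scaleR]
        Ck_seq_bilinear[OF S bounded_bilinear_inner] zr Ck_seq_constant ar)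
  have Az_der: "(?Az j has_derivative (\<lambda>h. ?B h j p + ?A' h j p)) (at p)" if "p \<in> ?S" for j p
  proof -
    have "(?Az j has_derivative (\<lambda>h. \<Sum>i\<in>Basis. (z j p \<bullet> i) *\<^sub>R dir (a i j) p h + (dir (z j) p h \<bullet> i) *\<^sub>R a i j p)) (at p)"
      by (intro has_derivative_sum has_derivative_scaleR has_derivative_inner_left has_derivative_dir z_diff a_diff that)
    then show ?thesis by (simp add: sum.distrib)
  qed
  have contA': "continuous_on ?S (?A' w j)" for w j
  proof -
    have "Ck_on r ?S (\<lambda>q. dir (z j) q w)" using zC by (rule Ck_on_dir)
    moreover have "continuous_on ?S (a i j)" if "i \<in> Basis" for i
      using Ck_seq_locally_convergent[OF Suc.prems(2)[OF that]] by (simp add: locally_convergent_def)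
    ultimately show ?thesis by (intro continuous_intros) (auto intro: Ck_on_continuous)
  qed
  have contB: "continuous_on ?S (?B w j)" for w j
    using Ck_seq_locally_convergent[OF Br] by (simp add: locally_convergent_def)
  have dz: "dir (z (Suc j)) p h = dir (b j) p h +
      (fst h *\<^sub>R ?Az j p + (time_integral (?B (0, snd h) j) p + time_integral (?A' (0, snd h) j) p))"
    if p: "p \<in> ?S" for j p h
  proof -
    have d: "dir (?Az j) q w = ?B w j q + ?A' w j q" if "q \<in> ?S" for q w
      by (rule dir_eq[OF Az_der[OF that]])
    have "continuous_on ?S (\<lambda>q. dir (?Az j) q w)" for w
      using continuous_on_add[OF contB contA'] d by (subst continuous_on_cong[OF refl d]) auto
    then have "(time_integral (?Az j) has_derivative
        (\<lambda>h. fst h *\<^sub>R ?Az j p + time_integral (\<lambda>q. dir (?Az j) q (0, snd h)) p)) (at p)"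
      using differentiableI[OF Az_der] by (intro time_integral_has_derivative[OF P p]) auto
    from has_derivative_add[OF has_derivative_dir[OF b_diff[OF p, of j]] this]
    have "(z (Suc j) has_derivative
      (\<lambda>h. dir (b j) p h + (fst h *\<^sub>R ?Az j p + time_integral (\<lambda>q. dir (?Az j) q (0, snd h)) p))) (at p)"
      by (simp only: eq_on_open_derivative(1)[OF S p z[of _ j]])
    moreover have "time_integral (\<lambda>q. dir (?Az j) q w) p = time_integral (?B w j) p + time_integral (?A' w j) p" for w
      unfolding time_integral_add[OF contB contA' p, symmetric]
      by (rule time_integral_cong[OF _ p]) (rule d)
    ultimately show ?thesis
      by (simp add: dir_eq)
  qed
  \<comment> \<open>For a purely spatial direction the recursion closes up on
    \<open>dir (z j) p (0, w)\<close>, so the induction hypothesis applies with the same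
    coefficients \<open>a\<close>.\<close>
  have spatial: "Ck_seq r ?S (\<lambda>j p. dir (z j) p (0, w))" for w
  proof (rule Suc.IH[OF _ ar])
    show "Ck_seq r ?S (\<lambda>j p. dir (b j) p (0, w) + time_integral (?B (0, w) j) p)"
      by (intro Ck_seq_add[OF S] b' Ck_seq_time_integral[OF \<epsilon> P] Br)
    show "Ck_on r ?S (\<lambda>p. dir (z 0) p (0, w))"
      using Suc.prems(3) by (rule Ck_on_dir)
    show "dir (z (Suc j)) p (0, w) = dir (b j) p (0, w) + time_integral (?B (0, w) j) p + time_integral (?A' (0, w) j) p"
      if "p \<in> ?S" for j p
      using dz[OF that, of j "(0, w)"] by simp
  qed
  \<comment> \<open>A time component of \<open>h\<close> adds only a multiple of the integrand,
    which already converges; everything else is expressed by spatial derivatives.\<close>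
  have "Ck_seq r ?S (\<lambda>j p. dir (z j) p h)" for h
  proof (rule Ck_seq_shift)
    show "Ck_on r ?S (\<lambda>p. dir (z 0) p h)"
      using Suc.prems(3) by (rule Ck_on_dir)
    have "Ck_seq r ?S (\<lambda>j p. dir (b j) p h +
      (fst h *\<^sub>R ?Az j p + (time_integral (?B (0, snd h) j) p + time_integral (?A' (0, snd h) j) p)))"
      by (intro Ck_seq_add[OF S] b' Ck_seq_time_integral[OF \<epsilon> P] Br Ar Ck_seq_sum S
        Ck_seq_bilinear[OF S bounded_bilinear_scaleR] Ck_seq_bilinear[OF S bounded_bilinear_inner]
        spatial Ck_seq_constant ar)
    then show "Ck_seq r ?S (\<lambda>j p. dir (z (Suc j)) p h)"
      by (rule Ck_seq_eq[OF _ S]) (rule dz)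
  qed
  then show ?case
    using Ck_seq_locally_convergent[OF zr] z_diff unfolding Ck_seq.simps by blast
qed

text \<open>Order zero rests on the Lipschitz bound for \<open>X\<close>, every higher order on the
  linear recursion for the spatial derivatives of the iterates. The size of the box is restricted
  only by bounds on \<open>X\<close> and its first derivative, hence one box serves for all
  orders.\<close>

theorem smooth_local_flow:
  fixes X :: "'a::euclidean_space \<Rightarrow> 'a"
  assumes Q: "open Q" and X: "smooth_on Q X" and x0: "x0 \<in> Q"
  obtains \<epsilon> \<rho> :: real and \<phi> :: "real \<times> 'a \<Rightarrow> 'a" where "\<epsilon> > 0" "\<rho> > 0" "smooth_on ({-\<epsilon><..<\<epsilon>} \<times> ball x0 \<rho>) \<phi>"
    "\<And>p. p \<in> {-\<epsilon><..<\<epsilon>} \<times> ball x0 \<rho> \<Longrightarrow> \<phi> p \<in> Q"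
    "\<And>p. p \<in> {-\<epsilon><..<\<epsilon>} \<times> ball x0 \<rho> \<Longrightarrow> dir \<phi> p (1, 0) = X (\<phi> p)"
    "\<And>x. x \<in> ball x0 \<rho> \<Longrightarrow> \<phi> (0, x) = x"
proof -
  have X: "Ck_on r Q X" for r
    using X by (simp add: smooth_on_def)
  obtain R where R: "R > 0" "cball x0 R \<subseteq> Q"
    using Q x0 open_contains_cball by blast
  have bdd: "\<exists>B\<ge>1. \<forall>y\<in>cball x0 R. norm (f y) \<le> B" if "continuous_on Q f" for f :: "'a \<Rightarrow> 'a"
  proof -
    have "bounded (f ` cball x0 R)"
      using that R by (intro compact_imp_bounded compact_continuous_image) (auto intro: continuous_on_subset)
    then obtain B where "\<forall>y\<in>cball x0 R. norm (f y) \<le> B"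
      by (auto simp: bounded_iff)
    then show ?thesis by (intro exI[of _ "max 1 B"]) (auto simp: le_max_iff_disj)
  qed
  obtain M where M: "M \<ge> 1" "\<And>y. y \<in> cball x0 R \<Longrightarrow> norm (X y) \<le> M"
    using bdd[OF Ck_on_continuous[OF X]] by blast
  have X': "Ck_on r Q (\<lambda>y. dir X y b)" for r b
    by (rule Ck_on_dir[OF X])
  have X_diff: "X differentiable (at y)" if "y \<in> Q" for y
    by (rule Ck_on_differentiable[OF X that])
  obtain Kb where Kb: "\<And>b. Kb b \<ge> 1" "\<And>b y. y \<in> cball x0 R \<Longrightarrow> norm (dir X y b) \<le> Kb b"
    using bdd[OF Ck_on_continuous[OF X']] by metis
  define K where "K = (\<Sum>b\<in>(Basis::'a set). Kb b)"
  have K0: "K \<ge> 0" unfolding K_def using Kb(1) by (intro sum_nonneg) (meson order_trans zero_le_one)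
  have XK: "norm (\<Sum>b\<in>Basis. (v \<bullet> b) *\<^sub>R dir X y b) \<le> K * norm v" if y: "y \<in> cball x0 R" for y v
  proof -
    have "norm (\<Sum>b\<in>Basis. (v \<bullet> b) *\<^sub>R dir X y b) \<le> (\<Sum>b\<in>Basis. norm v * Kb b)"
    proof (rule sum_norm_le)
      fix b :: 'a assume "b \<in> Basis"
      then show "norm ((v \<bullet> b) *\<^sub>R dir X y b) \<le> norm v * Kb b"
        unfolding norm_scaleR using Kb(2)[OF y] by (intro mult_mono) (auto simp: Basis_le_norm)
    qed
    then show ?thesis by (simp add: K_def sum_distrib_left mult.commute)
  qed
  have lip: "norm (X y - X y') \<le> K * norm (y - y')" if "y \<in> cball x0 R" "y' \<in> cball x0 R" for y y'
  proof (rule differentiable_bound[of "cball x0 R" X "\<lambda>y. dir X y"])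
    show "(X has_derivative dir X y) (at y within cball x0 R)" if "y \<in> cball x0 R" for y
      using that R by (intro has_derivative_at_withinI[OF has_derivative_dir[OF X_diff]]) auto
    show "onorm (dir X y) \<le> K" if "y \<in> cball x0 R" for y
    proof (rule onorm_le)
      fix v
      have "dir X y v = (\<Sum>b\<in>Basis. (v \<bullet> b) *\<^sub>R dir X y b)"
        using X_diff that R by (intro dir_basis_expansion) auto
      then show "norm (dir X y v) \<le> K * norm v"
        using XK[OF that, of v] by simp
    qed
  qed (use that in auto)
  \<comment> \<open>Starting points use half of the radius \<open>R\<close>, and
    \<open>\<epsilon> * M \<le> \<rho>\<close> keeps the motion within the other half. The second
    entry of \<open>\<epsilon>\<close> gives \<open>\<epsilon> * K \<le> 1 / 2\<close>; writing
    \<open>K + 1\<close> keeps the denominator positive.\<close>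
  define \<rho> where "\<rho> = R / 2"
  define \<epsilon> where "\<epsilon> = min (\<rho> / M) (1 / (2 * (K + 1)))"
  have \<rho>: "\<rho> > 0" using R by (simp add: \<rho>_def)
  have \<epsilon>: "\<epsilon> > 0" using \<rho> M K0 by (simp add: \<epsilon>_def)
  have "\<epsilon> \<le> \<rho> / M" by (simp add: \<epsilon>_def)
  then have \<epsilon>M: "\<epsilon> * M \<le> \<rho>" using M by (simp add: field_simps)
  have "\<epsilon> \<le> 1 / (2 * (K + 1))" by (simp add: \<epsilon>_def)
  then have "\<epsilon> * (K + 1) \<le> 1 / 2" using K0 by (simp add: field_simps)
  then have \<epsilon>K: "\<epsilon> * K \<le> 1 / 2" using \<epsilon> by (simp add: algebra_simps)
  let ?P = "ball x0 \<rho>"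
  let ?S = "{-\<epsilon><..<\<epsilon>} \<times> ?P"
  have S: "open ?S" by (simp add: open_Times)
  \<comment> \<open>The Picard iteration, started at the flow that does not move.\<close>
  define u where "u = rec_nat snd (\<lambda>_ f p. snd p + time_integral (\<lambda>q. X (f q)) p)"
  have u0: "u 0 = snd" and u_Suc: "u (Suc j) = (\<lambda>p. snd p + time_integral (\<lambda>q. X (u j q)) p)" for j
    by (simp_all add: u_def)
  have u_in: "(\<forall>p\<in>?S. u j p \<in> cball x0 R) \<and> continuous_on ?S (u j)" for j
  proof (induction j)
    case 0
    have "ball x0 \<rho> \<subseteq> cball x0 R"
      using R by (intro order_trans[OF ball_subset_cball subset_cball]) (simp add: \<rho>_def)
    then show ?case by (auto simp: u0 subset_iff intro!: continuous_intros)
  next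
    case (Suc j)
    have cX: "continuous_on ?S (\<lambda>q. X (u j q))"
      using Suc R by (intro continuous_on_compose2[OF Ck_on_continuous[OF X]]) auto
    have "u (Suc j) p \<in> cball x0 R" if p: "p \<in> ?S" for p
    proof -
      have "norm (time_integral (\<lambda>q. X (u j q)) p) \<le> \<epsilon> * M"
        using Suc M by (intro time_integral_bound[OF cX p]) (use scaled_time_in[OF p] in blast)
      then have "norm (time_integral (\<lambda>q. X (u j q)) p) \<le> \<rho>" using \<epsilon>M by linarith
      moreover have "norm (snd p - x0) \<le> \<rho>" using p by (auto simp: dist_norm norm_minus_commute)
      ultimately have "norm ((snd p - x0) + time_integral (\<lambda>q. X (u j q)) p) \<le> R"
        using norm_triangle_ineq[of "snd p - x0" "time_integral (\<lambda>q. X (u j q)) p"] by (simp add: \<rho>_def)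
      then show ?thesis
        by (simp add: u_Suc dist_norm norm_minus_commute algebra_simps)
    qed
    moreover have "continuous_on ?S (u (Suc j))"
      unfolding u_Suc by (intro continuous_intros time_integral_continuous cX)
    ultimately show ?case by blast
  qed
  have u_cball: "u j p \<in> cball x0 R" if "p \<in> ?S" for j p using u_in that by blast
  have u_cont: "continuous_on ?S (u j)" for j using u_in by blast
  have cX: "continuous_on ?S (\<lambda>q. X (u j q))" for j
    using u_cball u_cont R by (intro continuous_on_compose2[OF Ck_on_continuous[OF X]]) auto
  \<comment> \<open>The nonlinear recursion contracts because \<open>X\<close> is Lipschitz with
    constant \<open>K\<close> on the ball that contains all iterates.\<close>
  have u_lc: "locally_convergent ?S u"
  proof (rule contraction_locally_convergent[OF u_cont])
    fix C assume C: "compact C" "C \<subseteq> ?S"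
    have "norm (u j p) \<le> norm x0 + R" if "p \<in> C" for j p
    proof -
      have "norm (u j p - x0) \<le> R"
        using u_cball[of p j] that C by (auto simp: dist_norm norm_minus_commute)
      then show ?thesis using norm_triangle_sub[of "u j p" x0] by linarith
    qed
    then show "\<exists>B. \<forall>j. \<forall>p\<in>C. norm (u j p) \<le> B" by blast
  next
    fix C and e :: real
    assume C: "compact C" "C \<subseteq> ?S" and hull: "\<And>p \<sigma>. p \<in> C \<Longrightarrow> \<sigma> \<in> {0..1} \<Longrightarrow> (\<sigma> * fst p, snd p) \<in> C"
      and e: "e > 0"
    have "norm (u (Suc i) p - u (Suc j) p) \<le> e + D / 2"
      if D: "\<forall>p\<in>C. norm (u i p - u j p) \<le> D" and p: "p \<in> C" for i j D p
    proof -
      have pS: "p \<in> ?S" using p C by auto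
      have "norm (time_integral (\<lambda>q. X (u i q) - X (u j q)) p) \<le> \<epsilon> * (K * D)"
      proof (rule time_integral_bound[OF continuous_on_diff[OF cX cX] pS])
        fix \<sigma> :: real assume "\<sigma> \<in> {0..1}"
        then have q: "(\<sigma> * fst p, snd p) \<in> C" by (rule hull[OF p])
        then have "norm (X (u i (\<sigma> * fst p, snd p)) - X (u j (\<sigma> * fst p, snd p))) \<le>
            K * norm (u i (\<sigma> * fst p, snd p) - u j (\<sigma> * fst p, snd p))"
          using C by (intro lip u_cball) auto
        also have "\<dots> \<le> K * D" using D q K0 by (intro mult_left_mono) auto
        finally show "norm (X (u i (\<sigma> * fst p, snd p)) - X (u j (\<sigma> * fst p, snd p))) \<le> K * D" .
      qed
      also have "\<epsilon> * (K * D) = \<epsilon> * K * D" by simp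
      also have "\<dots> \<le> 1 / 2 * D"
      proof (rule mult_right_mono[OF \<epsilon>K])
        have "norm (u i p - u j p) \<le> D" using D p by blast
        then show "0 \<le> D" using norm_ge_zero[of "u i p - u j p"] by linarith
      qed
      finally show ?thesis
        using e by (simp add: u_Suc time_integral_diff[OF cX cX pS])
    qed
    then show "\<exists>N. \<forall>i\<ge>N. \<forall>j\<ge>N. \<forall>D. (\<forall>p\<in>C. norm (u i p - u j p) \<le> D) \<longrightarrow>
        (\<forall>p\<in>C. norm (u (Suc i) p - u (Suc j) p) \<le> e + D / 2)"
      by blast
  qed
  have comp: "Ck_seq r ?S (\<lambda>j p. f (v j p))"
    if "Ck_on r Q f" "Ck_seq r ?S v" "\<And>j p. p \<in> ?S \<Longrightarrow> v j p \<in> cball x0 R" for r v and f :: "'a \<Rightarrow> 'a"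
  proof (rule Ck_seq_compose[OF S that(1,2)])
    show "\<exists>K\<subseteq>Q. compact K \<and> (\<forall>j. v j ` C \<subseteq> K)" if "compact C" "C \<subseteq> ?S" for C
      using that \<open>\<And>j p. p \<in> ?S \<Longrightarrow> v j p \<in> cball x0 R\<close> R by (intro exI[of _ "cball x0 R"]) auto
  qed
  have snd_Ck: "Ck_seq r ?S (\<lambda>_. snd)" for r
    using Ck_on_bounded_linear[OF bounded_linear_snd] by (simp only: Ck_seq_const)
  have uC: "Ck_on r ?S (u j)" for r j
  proof (induction j)
    case 0
    then show ?case using snd_Ck by (simp add: u0 Ck_seq_const)
  next
    case (Suc j)
    have "Ck_seq r ?S (\<lambda>_ p. snd p + time_integral (\<lambda>q. X (u j q)) p)"
      using Suc u_cball unfolding Ck_seq_const[symmetric, of r ?S "u j"]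
      by (intro Ck_seq_add[OF S] snd_Ck Ck_seq_time_integral[OF \<epsilon> open_ball] comp[OF X]) auto
    then show ?case by (simp add: u_Suc Ck_seq_const)
  qed
  have u_diff: "u j differentiable (at p)" if "p \<in> ?S" for j p
    by (rule Ck_on_differentiable[OF uC that])
  have Xu_der: "((\<lambda>q. X (u j q)) has_derivative (\<lambda>w. dir X (u j q) (dir (u j) q w))) (at q)" if "q \<in> ?S" for j q
    using that u_cball[OF that] R
    by (intro has_derivative_compose[of "u j" _ q UNIV X] has_derivative_dir u_diff X_diff) auto
  have Xu_dir: "dir (\<lambda>q. X (u j q)) q w = (\<Sum>b\<in>Basis. (dir (u j) q w \<bullet> b) *\<^sub>R dir X (u j q) b)" if "q \<in> ?S" for j q w
    unfolding dir_eq[OF Xu_der[OF that]] using u_cball[OF that] R by (intro dir_basis_expansion X_diff) auto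
  have u_step: "dir (u (Suc j)) p h = snd h +
      (fst h *\<^sub>R X (u j p) + time_integral (\<lambda>q. \<Sum>b\<in>Basis. (dir (u j) q (0, snd h) \<bullet> b) *\<^sub>R dir X (u j q) b) p)"
    if p: "p \<in> ?S" for j p h
  proof -
    have "continuous_on ?S (\<lambda>q. dir (\<lambda>q. X (u j q)) q w)" for w
    proof -
      have "Ck_on 0 ?S (\<lambda>q. dir (u j) q w)" by (rule Ck_on_dir[OF uC])
      moreover have "continuous_on ?S (\<lambda>q. dir X (u j q) b)" for b
        using u_cball u_cont R by (intro continuous_on_compose2[OF Ck_on_continuous[OF X']]) auto
      ultimately show ?thesis
        by (subst continuous_on_cong[OF refl Xu_dir]) (auto intro!: continuous_intros)
    qed
    then have "(time_integral (\<lambda>q. X (u j q)) has_derivative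
        (\<lambda>h. fst h *\<^sub>R X (u j p) + time_integral (\<lambda>q. dir (\<lambda>q. X (u j q)) q (0, snd h)) p)) (at p)"
      using differentiableI[OF Xu_der] by (intro time_integral_has_derivative[OF open_ball p]) auto
    from has_derivative_add[OF bounded_linear_imp_has_derivative[OF bounded_linear_snd] this]
    have "dir (u (Suc j)) p h = snd h +
      (fst h *\<^sub>R X (u j p) + time_integral (\<lambda>q. dir (\<lambda>q. X (u j q)) q (0, snd h)) p)"
      unfolding u_Suc by (rule dir_eq)
    also have "time_integral (\<lambda>q. dir (\<lambda>q. X (u j q)) q (0, snd h)) p =
        time_integral (\<lambda>q. \<Sum>b\<in>Basis. (dir (u j) q (0, snd h) \<bullet> b) *\<^sub>R dir X (u j q) b) p"
      by (rule time_integral_cong[OF Xu_dir p])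
    finally show ?thesis .
  qed
  \<comment> \<open>Order \<open>r\<close> of the iterates makes the coefficients
    \<open>dir X (u j p) b\<close> converge to order \<open>r\<close>; the linear recursion then
    gives order \<open>r\<close> for the first derivatives, that is, order \<open>Suc r\<close> for
    the iterates.\<close>
  have u_Ck: "Ck_seq r ?S u" for r
  proof (induction r)
    case (Suc r)
    have a: "Ck_seq r ?S (\<lambda>j p. dir X (u j p) b)" for b
      using u_cball by (rule comp[OF X' Suc])
    have w: "Ck_seq r ?S (\<lambda>j p. dir (u j) p (0, w))" for w
    proof (rule linear_recursion_Ck_seq[OF \<epsilon> \<epsilon>K K0 open_ball Ck_seq_constant[of _ _ w] a])
      show "Ck_on r ?S (\<lambda>p. dir (u 0) p (0, w))"
        by (rule Ck_on_dir[OF uC])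
      show "norm (\<Sum>i\<in>Basis. (v \<bullet> i) *\<^sub>R dir X (u j p) i) \<le> K * norm v" if "p \<in> ?S" for j p v
        by (rule XK[OF u_cball[OF that]])
      show "dir (u (Suc j)) p (0, w) = w + time_integral (\<lambda>q. \<Sum>b\<in>Basis. (dir (u j) q (0, w) \<bullet> b) *\<^sub>R dir X (u j q) b) p"
        if "p \<in> ?S" for j p
        using u_step[OF that, of j "(0, w)"] by simp
    qed
    have "Ck_seq r ?S (\<lambda>j p. dir (u j) p h)" for h
    proof (rule Ck_seq_shift)
      show "Ck_on r ?S (\<lambda>p. dir (u 0) p h)"
        by (rule Ck_on_dir[OF uC])
      have "Ck_seq r ?S (\<lambda>j p. snd h + (fst h *\<^sub>R X (u j p) +
          time_integral (\<lambda>q. \<Sum>b\<in>Basis. (dir (u j) q (0, snd h) \<bullet> b) *\<^sub>R dir X (u j q) b) p))"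
        by (intro Ck_seq_add[OF S] Ck_seq_time_integral[OF \<epsilon> open_ball] Ck_seq_sum S
          Ck_seq_bilinear[OF S bounded_bilinear_scaleR] Ck_seq_bilinear[OF S bounded_bilinear_inner]
          Ck_seq_constant w a comp[OF X Suc u_cball])
      then show "Ck_seq r ?S (\<lambda>j p. dir (u (Suc j)) p h)"
        by (rule Ck_seq_eq[OF _ S]) (rule u_step)
    qed
    then show ?case
      using u_lc u_diff unfolding Ck_seq.simps by blast
  qed (simp add: u_lc)
  define \<phi> where "\<phi> = (\<lambda>p. lim (\<lambda>j. u j p))"
  have lim: "(\<lambda>j. u j p) \<longlonglongrightarrow> \<phi> p" if "p \<in> ?S" for p
    unfolding \<phi>_def by (rule Ck_seq_limit(2)[OF S u_Ck[of 0] that])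
  have \<phi>_in: "\<phi> p \<in> Q" if "p \<in> ?S" for p
  proof -
    have "\<phi> p \<in> cball x0 R"
      using u_cball[OF that] by (intro closed_sequentially[OF closed_cball _ lim[OF that]]) blast
    then show ?thesis using R by blast
  qed
  show ?thesis
  proof (rule that[of \<epsilon> \<rho> \<phi>])
    show "\<epsilon> > 0" "\<rho> > 0" by fact+
    show "smooth_on ?S \<phi>"
      using Ck_seq_limit(1)[OF S u_Ck] by (simp add: smooth_on_def \<phi>_def)
    show "\<And>p. p \<in> ?S \<Longrightarrow> \<phi> p \<in> Q" by (rule \<phi>_in)
    show "dir \<phi> p (1, 0) = X (\<phi> p)" if p: "p \<in> ?S" for p
    proof -
      \<comment> \<open>The flow equation is the limit of
        \<open>dir (u (Suc j)) p (1, 0) = X (u j p)\<close>, where the integral term has vanished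
        because the spatial direction is zero.\<close>
      have d: "dir \<phi> p (1, 0) = lim (\<lambda>j. dir (u j) p (1, 0))"
        unfolding \<phi>_def by (rule dir_eq[OF Ck_seq_limit(3)[OF S u_Ck[of 1] _ p]]) simp
      have "isCont X (\<phi> p)"
        using Ck_on_continuous[OF X] Q \<phi>_in[OF p] continuous_on_eq_continuous_at by blast
      then have "(\<lambda>j. X (u j p)) \<longlonglongrightarrow> X (\<phi> p)"
        using lim[OF p] by (rule isCont_tendsto_compose)
      moreover have "dir (u (Suc j)) p (1, 0) = X (u j p)" for j
      proof -
        have "dir (u j) q (0, 0) = 0" if "q \<in> ?S" for q
          using linear_frechet_derivative[OF u_diff[OF that]] linear_0 by (metis zero_prod_def)
        then have "time_integral (\<lambda>q. \<Sum>b\<in>Basis. (dir (u j) q (0, 0) \<bullet> b) *\<^sub>R dir X (u j q) b) p =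
            time_integral (\<lambda>q. 0) p"
          by (intro time_integral_cong[OF _ p]) simp
        then show ?thesis
          using u_step[OF p, of j "(1, 0)"] by (simp add: time_integral_def)
      qed
      ultimately have "(\<lambda>j. dir (u (Suc j)) p (1, 0)) \<longlonglongrightarrow> X (\<phi> p)" by simp
      then have "(\<lambda>j. dir (u j) p (1, 0)) \<longlonglongrightarrow> X (\<phi> p)"
        by (rule LIMSEQ_imp_Suc)
      then show ?thesis by (simp add: d limI)
    qed
    show "\<phi> (0, x) = x" if "x \<in> ?P" for x
    proof -
      have "u j (0, x) = x" for j
        by (cases j) (simp_all add: u0 u_Suc time_integral_def)
      then show ?thesis by (simp add: \<phi>_def limI)
    qed
  qed
qed

section \<open>Inverse functions and mixed derivatives\<close>

text \<open>The derivative of the inverse solves a linear system whose matrix is that of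
  \<open>dir f (g y)\<close>. By Cramer's rule this derivative is as regular as \<open>g\<close>,
  which raises the regularity of \<open>g\<close> one order at a time.\<close>

theorem smooth_inverse_function:
  fixes f :: "real^'n \<Rightarrow> real^'n"
  assumes U: "open U" and f: "smooth_on U f" and x0: "x0 \<in> U" and inj: "\<And>v. dir f x0 v = 0 \<Longrightarrow> v = 0"
  obtains U' V g where "open U'" "U' \<subseteq> U" "x0 \<in> U'" "open V" "f x0 \<in> V" "homeomorphism U' V f g" "smooth_on V g"
proof -
  have f: "Ck_on r U f" for r using f by (simp add: smooth_on_def)
  have f': "Ck_on r U (\<lambda>x. dir f x w)" for r w by (rule Ck_on_dir[OF f])
  have der: "(f has_derivative dir f x) (at x)" if "x \<in> U" for x
    by (rule has_derivative_dir[OF Ck_on_differentiable[OF f that]])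
  define D where "D = (\<lambda>x. Blinfun (dir f x))"
  have D: "blinfun_apply (D x) = dir f x" if "x \<in> U" for x
    unfolding D_def using der[OF that] by (intro bounded_linear_Blinfun_apply has_derivative_bounded_linear)
  have contD: "continuous_on U D"
  proof (rule continuous_on_blinfun_componentwise)
    fix b :: "real^'n"
    show "continuous_on U (\<lambda>x. blinfun_apply (D x) b)"
      using Ck_on_continuous[OF f'] by (subst continuous_on_cong[OF refl]) (auto simp: D)
  qed
  have lin0: "linear (dir f x0)"
    using der[OF x0] has_derivative_linear by blast
  have "inj (dir f x0)"
    using linear_injective_0[OF lin0] inj by blast
  then obtain h where h: "linear h" "h \<circ> dir f x0 = id"
    using linear_injective_left_inverse[OF lin0] by blast
  have invf: "Blinfun h o\<^sub>L D x0 = id_blinfun"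
    using h by (intro blinfun_eqI) (simp add: D[OF x0] bounded_linear_Blinfun_apply linear_linear o_def fun_eq_iff)
  have derD: "(f has_derivative blinfun_apply (D x)) (at x)" if "x \<in> U" for x
    using der[OF that] D[OF that] by simp
  show ?thesis
  proof (rule inverse_function_theorem[OF U derD contD x0 invf], assumption)
    fix U' V g g'
    assume UV: "open U'" "U' \<subseteq> U" "x0 \<in> U'" "open V" "f x0 \<in> V" and hom: "homeomorphism U' V f g"
      and g: "\<And>y. y \<in> V \<Longrightarrow> (g has_derivative g' y) (at y)"
      and g': "\<And>y. y \<in> V \<Longrightarrow> g' y = inv (blinfun_apply (D (g y)))"
      and bij: "\<And>y. y \<in> V \<Longrightarrow> bij (blinfun_apply (D (g y)))"
    have gU: "g y \<in> U" if "y \<in> V" for y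
      using hom UV that by (auto simp: homeomorphism_def)
    define M where "M = (\<lambda>y. matrix (dir f (g y)))"
    have M: "M y *v v = dir f (g y) v" if "y \<in> V" for y v
      unfolding M_def using has_derivative_linear[OF der[OF gU[OF that]]]
      by (intro matrix_works) (simp add: linear_matrix_vector_mul_eq)
    have "Ck_on r V g" for r
    proof (induction r)
      case 0
      then show ?case using hom by (simp add: homeomorphism_def)
    next
      case (Suc r)
      have "Ck_on r V (\<lambda>y. dir g y w)" for w
      proof (rule Ck_on_linear_solve[where M=M and b="\<lambda>_. w"])
        show "open V" by fact
        have "Ck_on r V (\<lambda>y. dir f (g y) (axis j 1) $ i)" for i j
          using gU by (intro Ck_on_nth \<open>open V\<close> Ck_on_compose[OF _ f' Suc]) auto
        then show "Ck_on r V (\<lambda>y. M y $ i $ j)" for i j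
          by (simp add: M_def matrix_def)
        show "det (M y) \<noteq> 0" if "y \<in> V" for y
        proof -
          have "inj ((*v) (M y))"
            using bij[OF that] D[OF gU[OF that]] M[OF that] by (simp add: bij_def inj_def)
          then show ?thesis
            using invertible_det_nz invertible_left_inverse matrix_left_invertible_injective by blast
        qed
        show "M y *v dir g y w = w" if "y \<in> V" for y
          unfolding M[OF that] dir_eq[OF g[OF that]] g'[OF that]
          using bij[OF that] D[OF gU[OF that]] by (metis bij_inv_eq_iff)
      qed (rule Ck_on_const)
      then show ?case
        using differentiableI[OF g] by simp
    qed
    then show ?thesis
      using that[OF UV hom] by (simp add: smooth_on_def)
  qed
qed

text \<open>Write \<open>F (s, t) = u (p + s v + t w)\<close> as \<open>F (0, t)\<close> plus the time integral of its \<open>s\<close>-derivative and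
  differentiate the integral in \<open>t\<close>.\<close>

lemma dir_commute:
  fixes u :: "'a::euclidean_space \<Rightarrow> 'b::euclidean_space"
  assumes S: "open S" and u: "Ck_on (Suc (Suc 0)) S u" and p: "p \<in> S"
  shows "dir (\<lambda>x. dir u x v) p w = dir (\<lambda>x. dir u x w) p v"
proof -
  define a where "a = (\<lambda>q::real \<times> real. p + fst q *\<^sub>R v + snd q *\<^sub>R w)"
  have a_der: "(a has_derivative (\<lambda>h. fst h *\<^sub>R v + snd h *\<^sub>R w)) (at q)" for q
    unfolding a_def by (auto intro!: derivative_eq_intros)
  have a_cont: "continuous_on UNIV a"
    unfolding a_def by (intro continuous_intros)
  have "open (a -` S)"
    using open_vimage[OF S a_cont] .
  moreover have "(0, 0) \<in> a -` S" using p by (simp add: a_def)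
  ultimately obtain A B where AB: "open A" "open B" "0 \<in> A" "0 \<in> B" "A \<times> B \<subseteq> a -` S"
    using open_prod_elim by (metis mem_Sigma_iff)
  obtain \<epsilon> where \<epsilon>: "\<epsilon> > 0" "ball 0 \<epsilon> \<subseteq> A"
    using AB openE by blast
  let ?S = "{-\<epsilon><..<\<epsilon>} \<times> B"
  have aS: "a q \<in> S" if "q \<in> ?S" for q
  proof -
    have "fst q \<in> ball 0 \<epsilon>" using that by (auto simp: dist_real_def)
    then have "q \<in> A \<times> B" using that \<epsilon> by (auto simp: mem_Times_iff)
    then show ?thesis using AB by blast
  qed
  have u_diff: "u differentiable (at x)" "(\<lambda>x. dir u x h) differentiable (at x)" if "x \<in> S" for x h
    using Ck_on_differentiable[OF u that] Ck_on_differentiable[OF Ck_on_dir[OF u] that] by auto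
  have contu'': "continuous_on S (\<lambda>x. dir (\<lambda>x. dir u x h) x h')" for h h'
    by (rule Ck_on_continuous[OF Ck_on_dir[OF Ck_on_dir[OF u]]])
  define F where "F = (\<lambda>q. dir u (a q) v)"
  have F_der: "(F has_derivative (\<lambda>h. dir (\<lambda>x. dir u x v) (a q) (fst h *\<^sub>R v + snd h *\<^sub>R w))) (at q)" if "q \<in> ?S" for q
    unfolding F_def using has_derivative_compose[OF a_der has_derivative_dir[OF u_diff(2)[OF aS[OF that]]]] .
  have contF': "continuous_on ?S (\<lambda>q. dir F q h)" for h
  proof -
    have "continuous_on ?S (\<lambda>q. dir (\<lambda>x. dir u x v) (a q) (fst h *\<^sub>R v + snd h *\<^sub>R w))"
      by (rule continuous_on_compose2[OF contu'']) (use a_cont aS in \<open>auto intro: continuous_on_subset\<close>)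
    then show ?thesis
      by (subst continuous_on_cong[OF refl dir_eq[OF F_der]]) auto
  qed
  have contF: "continuous_on ?S F"
    using has_derivative_continuous[OF F_der] by (intro continuous_at_imp_continuous_on ballI)
  have u_a: "u (a (s, t)) = u (a (0, t)) + time_integral F (s, t)" if s: "\<bar>s\<bar> < \<epsilon>" and t: "t \<in> B" for s t
  proof -
    have "((\<lambda>s. u (a (s, t)) - time_integral F (s, t)) has_derivative (\<lambda>h. 0)) (at s within {-\<epsilon><..<\<epsilon>})"
      if "s \<in> {-\<epsilon><..<\<epsilon>}" for s
    proof -
      have "(s, t) \<in> ?S" using that t by auto
      have "((\<lambda>s. a (s, t)) has_derivative (\<lambda>h. h *\<^sub>R v)) (at s)"
        unfolding a_def by (auto intro!: derivative_eq_intros)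
      from has_derivative_compose[OF this has_derivative_dir[OF u_diff(1)[OF aS]]]
      have "((\<lambda>s. u (a (s, t))) has_derivative (\<lambda>h. dir u (a (s, t)) (h *\<^sub>R v))) (at s)"
        using \<open>(s, t) \<in> ?S\<close> by blast
      moreover have "((\<lambda>s. time_integral F (s, t)) has_derivative (\<lambda>h. h *\<^sub>R F (s, t))) (at s)"
        using time_integral_deriv[OF contF _ t, of s] that by (auto simp: has_vector_derivative_def abs_less_iff)
      moreover have "dir u (a (s, t)) (h *\<^sub>R v) = h *\<^sub>R F (s, t)" for h
        unfolding F_def using linear_frechet_derivative[OF u_diff(1)[OF aS[OF \<open>(s, t) \<in> ?S\<close>]]]
        by (rule linear_scale)
      ultimately have "((\<lambda>s. u (a (s, t)) - time_integral F (s, t)) has_derivative (\<lambda>h. h *\<^sub>R F (s, t) - h *\<^sub>R F (s, t))) (at s)"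
        by (intro has_derivative_diff) simp_all
      then show ?thesis by (simp add: has_derivative_at_withinI)
    qed
    from has_derivative_zero_constant[OF convex_real_interval(8) this]
    obtain c where "\<And>s. s \<in> {-\<epsilon><..<\<epsilon>} \<Longrightarrow> u (a (s, t)) - time_integral F (s, t) = c"
      by blast
    from this[of s] this[of 0] have "u (a (s, t)) - time_integral F (s, t) = u (a (0, t)) - time_integral F (0, t)"
      using s \<epsilon> by (auto simp: abs_less_iff)
    then show ?thesis by (simp add: time_integral_def algebra_simps)
  qed
  have at0: "((\<lambda>t. a (s, t)) has_derivative (\<lambda>h. h *\<^sub>R w)) (at t)" for s t
    unfolding a_def by (auto intro!: derivative_eq_intros)
  have ut: "((\<lambda>t. u (a (s, t))) has_derivative (\<lambda>h. dir u (a (s, t)) (h *\<^sub>R w))) (at t)" if "(s, t) \<in> ?S" for s t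
    by (rule has_derivative_compose[OF at0 has_derivative_dir[OF u_diff(1)[OF aS[OF that]]]])
  have key: "dir u (a (s, 0)) w = dir u (a (0, 0)) w + time_integral (\<lambda>q. dir F q (0, 1)) (s, 0)" if s: "\<bar>s\<bar> < \<epsilon>" for s
  proof -
    have in0: "(s, 0) \<in> ?S" "(0, 0) \<in> ?S" using s \<epsilon> AB by auto
    have "((\<lambda>t. (s, t)) has_derivative (\<lambda>h. (0, h))) (at 0)"
      by (auto intro!: derivative_eq_intros)
    from has_derivative_compose[OF this time_integral_has_derivative[OF AB(2) in0(1) differentiableI[OF F_der] contF']]
    have "((\<lambda>t. time_integral F (s, t)) has_derivative (\<lambda>h. time_integral (\<lambda>q. dir F q (0, h)) (s, 0))) (at 0)"
      by simp
    from has_derivative_add[OF ut[OF in0(2)] this]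
    have "((\<lambda>t. u (a (0, t)) + time_integral F (s, t)) has_derivative
        (\<lambda>h. dir u (a (0, 0)) (h *\<^sub>R w) + time_integral (\<lambda>q. dir F q (0, h)) (s, 0))) (at 0)" .
    then have "((\<lambda>t. u (a (s, t))) has_derivative
        (\<lambda>h. dir u (a (0, 0)) (h *\<^sub>R w) + time_integral (\<lambda>q. dir F q (0, h)) (s, 0))) (at 0)"
      using eq_on_open_derivative(1)[OF AB(2,4) u_a[OF s]] by simp
    from fun_cong[OF has_derivative_unique[OF ut[OF in0(1)] this], of 1] show ?thesis
      by simp
  qed
  \<comment> \<open>The right-hand side of \<open>key\<close> depends on \<open>s\<close> only
    through the time integral, so its derivative at zero is the integrand there. Comparison with the
    chain rule identifies the two mixed derivatives.\<close>
  have "((\<lambda>s. dir u (a (0, 0)) w + time_integral (\<lambda>q. dir F q (0, 1)) (s, 0)) has_vector_derivative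
      0 + dir F (0, 0) (0, 1)) (at 0)"
    using \<epsilon> AB by (intro has_vector_derivative_add has_vector_derivative_const time_integral_deriv[OF contF']) auto
  then have 0: "((\<lambda>s. dir u (a (0, 0)) w + time_integral (\<lambda>q. dir F q (0, 1)) (s, 0)) has_derivative
      (\<lambda>h. h *\<^sub>R dir F (0, 0) (0, 1))) (at 0)"
    by (simp add: has_vector_derivative_def)
  have 1: "((\<lambda>s. dir u (a (s, 0)) w) has_derivative (\<lambda>h. h *\<^sub>R dir F (0, 0) (0, 1))) (at 0)"
  proof (rule iffD2[OF eq_on_open_derivative(1) 0])
    show "open {-\<epsilon><..<\<epsilon>}" "0 \<in> {-\<epsilon><..<\<epsilon>}" using \<epsilon> by auto
    show "dir u (a (s, 0)) w = dir u (a (0, 0)) w + time_integral (\<lambda>q. dir F q (0, 1)) (s, 0)"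
      if "s \<in> {-\<epsilon><..<\<epsilon>}" for s
      using key[of s] that by (simp add: abs_less_iff)
  qed
  have a0: "((\<lambda>s. a (s, 0)) has_derivative (\<lambda>h. h *\<^sub>R v)) (at 0)"
    unfolding a_def by (auto intro!: derivative_eq_intros)
  have a00: "a (0, 0) = p" by (simp add: a_def)
  have "((\<lambda>s. dir u (a (s, 0)) w) has_derivative (\<lambda>h. dir (\<lambda>x. dir u x w) p (h *\<^sub>R v))) (at 0)"
    using has_derivative_compose[OF a0 has_derivative_dir[OF u_diff(2)]] a00 p by simp
  from fun_cong[OF has_derivative_unique[OF this 1], of 1]
  have "dir (\<lambda>x. dir u x w) p v = dir F (0, 0) (0, 1)" by simp
  moreover have "dir F (0, 0) (0, 1) = dir (\<lambda>x. dir u x v) p w"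
    using dir_eq[OF F_der, of "(0, 0)"] a00 \<epsilon> AB by simp
  ultimately show ?thesis by simp
qed

section \<open>Flow boxes\<close>

text \<open>Only the time coordinate of the flow is normalised: \<open>T\<close> increases at unit speed along \<open>X\<close>, so shifting
  the starting time by \<open>T\<close> makes \<open>T\<close> itself the first coordinate.\<close>

theorem smooth_flow_box:
  fixes X :: "real^'n::finite \<Rightarrow> real^'n" and T :: "real^'n \<Rightarrow> real"
  assumes card: "CARD('n) = CARD('k::finite) + 1"
    and D: "open D" "z0 \<in> D" and X: "smooth_on D X" and T: "smooth_on D T"
    and XT: "\<And>z. z \<in> D \<Longrightarrow> dir T z (X z) = 1" and J: "open J" "T z0 \<in> J"
  obtains V \<alpha> \<beta> and \<Omega> :: "(real^'k) set" and Y :: "real^'n \<Rightarrow> real^'k" and E :: "real \<times> (real^'k) \<Rightarrow> real^'n" where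
    "open V" "z0 \<in> V" "V \<subseteq> D" "open \<Omega>" "{\<alpha><..<\<beta>} \<subseteq> J"
    "homeomorphism V ({\<alpha><..<\<beta>} \<times> \<Omega>) (\<lambda>z. (T z, Y z)) E"
    "smooth_on V Y" "smooth_on ({\<alpha><..<\<beta>} \<times> \<Omega>) E"
    "\<And>p. p \<in> {\<alpha><..<\<beta>} \<times> \<Omega> \<Longrightarrow> dir E p (1, 0) = X (E p)"
proof -
  have T: "Ck_on r D T" for r using T by (simp add: smooth_on_def)
  have T_diff: "T differentiable (at z)" if "z \<in> D" for z by (rule Ck_on_differentiable[OF T that])
  obtain \<epsilon> \<rho> :: real and \<phi> :: "real \<times> (real^'n) \<Rightarrow> real^'n" where \<epsilon>: "\<epsilon> > 0" and \<rho>: "\<rho> > 0"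
    and \<phi>: "smooth_on ({-\<epsilon><..<\<epsilon>} \<times> ball z0 \<rho>) \<phi>"
    and \<phi>D: "\<And>p. p \<in> {-\<epsilon><..<\<epsilon>} \<times> ball z0 \<rho> \<Longrightarrow> \<phi> p \<in> D"
    and \<phi>X: "\<And>p. p \<in> {-\<epsilon><..<\<epsilon>} \<times> ball z0 \<rho> \<Longrightarrow> dir \<phi> p (1, 0) = X (\<phi> p)"
    and \<phi>0: "\<And>x. x \<in> ball z0 \<rho> \<Longrightarrow> \<phi> (0, x) = x"
    by (rule smooth_local_flow[OF D(1) X D(2)]) blast
  let ?S = "{-\<epsilon><..<\<epsilon>} \<times> ball z0 \<rho>"
  have S: "open ?S" by (simp add: open_Times)
  have \<phi>: "Ck_on r ?S \<phi>" for r using \<phi> by (simp add: smooth_on_def)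
  have \<phi>_diff: "\<phi> differentiable (at p)" if "p \<in> ?S" for p by (rule Ck_on_differentiable[OF \<phi> that])
  have ballD: "ball z0 \<rho> \<subseteq> D"
  proof
    fix x assume "x \<in> ball z0 \<rho>"
    then show "x \<in> D" using \<phi>D[of "(0, x)"] \<phi>0 \<epsilon> by auto
  qed
  have z0: "z0 \<in> ball z0 \<rho>" using \<rho> by simp
  have T\<phi>: "T (\<phi> (\<tau>, x)) = T x + \<tau>" if \<tau>: "\<tau> \<in> {-\<epsilon><..<\<epsilon>}" and x: "x \<in> ball z0 \<rho>" for \<tau> x
  proof -
    have "((\<lambda>\<tau>. T (\<phi> (\<tau>, x)) - \<tau>) has_derivative (\<lambda>h. 0)) (at \<tau> within {-\<epsilon><..<\<epsilon>})"
      if \<tau>: "\<tau> \<in> {-\<epsilon><..<\<epsilon>}" for \<tau>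
    proof -
      have p: "(\<tau>, x) \<in> ?S" using \<tau> x by simp
      have "((\<lambda>\<tau>. (\<tau>, x)) has_derivative (\<lambda>h. (h, 0))) (at \<tau>)"
        by (auto intro!: derivative_eq_intros)
      from has_derivative_compose[OF this has_derivative_dir[OF \<phi>_diff[OF p]]]
      have 1: "((\<lambda>\<tau>. \<phi> (\<tau>, x)) has_derivative (\<lambda>h. dir \<phi> (\<tau>, x) (h, 0))) (at \<tau>)" .
      have 2: "((\<lambda>\<tau>. T (\<phi> (\<tau>, x)) - \<tau>) has_derivative
          (\<lambda>h. dir T (\<phi> (\<tau>, x)) (dir \<phi> (\<tau>, x) (h, 0)) - h)) (at \<tau>)"
        by (intro has_derivative_diff has_derivative_ident
            has_derivative_compose[OF 1 has_derivative_dir[OF T_diff[OF \<phi>D[OF p]]]])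
      have "dir \<phi> (\<tau>, x) (h, 0) = h *\<^sub>R X (\<phi> (\<tau>, x))" for h
        using linear_scale[OF linear_frechet_derivative[OF \<phi>_diff[OF p]], of h "(1, 0)"] \<phi>X[OF p] by simp
      then have "dir T (\<phi> (\<tau>, x)) (dir \<phi> (\<tau>, x) (h, 0)) = h" for h
        using linear_scale[OF linear_frechet_derivative[OF T_diff[OF \<phi>D[OF p]]]] XT[OF \<phi>D[OF p]] by simp
      with 2 show ?thesis by (simp add: has_derivative_at_withinI)
    qed
    from has_derivative_zero_unique[OF convex_real_interval(8) this \<tau>, of 0] show ?thesis
      using \<epsilon> \<phi>0[OF x] by simp
  qed
  \<comment> \<open>\<open>a\<close> represents the differential of \<open>T\<close> at
    \<open>z0\<close>; its kernel supplies the transverse directions, and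
    \<open>a \<bullet> X z0 = 1\<close> says that \<open>X z0\<close> lies outside that
    kernel.\<close>
  obtain a :: "real^'n" where a: "\<And>v. dir T z0 v = a \<bullet> v"
  proof
    show "dir T z0 v = (\<Sum>b\<in>Basis. dir T z0 b *\<^sub>R b) \<bullet> v" for v
      unfolding dir_basis_expansion[OF T_diff[OF D(2)], of v]
      by (simp add: inner_sum_left inner_sum_right inner_commute mult.commute)
  qed
  have aX: "a \<bullet> X z0 = 1" using a XT[OF D(2)] by simp
  then have "a \<noteq> 0" by auto
  have dim_eq: "dim (UNIV :: (real^'k) set) = dim {v. a \<bullet> v = 0}"
    using dim_hyperplane[OF \<open>a \<noteq> 0\<close>] card by simp
  \<comment> \<open>Parametrises the hyperplane by the transverse coordinates; \<open>card\<close>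
    makes the dimensions agree.\<close>
  obtain l :: "real^'k \<Rightarrow> real^'n" and l' :: "real^'n \<Rightarrow> real^'k" where l: "linear l" "linear l'"
    "l ` UNIV = {v. a \<bullet> v = 0}" "\<And>y. l' (l y) = y"
    by (rule isometries_subspaces[OF subspace_UNIV subspace_hyperplane dim_eq]) auto
  have al: "a \<bullet> l y = 0" for y using l(3) by blast
  have l0: "l 0 = 0" using l(1) by (rule linear_0)
  have bl: "bounded_linear l" using l(1) by (simp add: linear_conv_bounded_linear)
  define N0 where "N0 = (UNIV :: real set) \<times> ((\<lambda>y. z0 + l y) -` ball z0 \<rho>)"
  have N0: "open N0"
    unfolding N0_def using linear_continuous_on[OF bl]
    by (intro open_Times open_vimage continuous_intros) auto
  have N0_in: "z0 + l (snd p) \<in> ball z0 \<rho>" if "p \<in> N0" for p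
    using that by (auto simp: N0_def)
  \<comment> \<open>Flow data for the coordinates \<open>(t, y)\<close>: start at
    \<open>z0 + l y\<close> and run for time \<open>t - T (z0 + l y)\<close>, so that
    \<open>T\<close> takes the value \<open>t\<close> at the end.\<close>
  define b where "b = (\<lambda>p. (fst p - T (z0 + l (snd p)), z0 + l (snd p)))"
  have aff: "Ck_on r N0 (\<lambda>p. z0 + l (snd p))" for r
    by (intro Ck_on_add[OF N0] Ck_on_const Ck_on_bounded_linear bounded_linear_compose[OF bl] bounded_linear_snd)
  have T_aff: "Ck_on r N0 (\<lambda>p. T (z0 + l (snd p)))" for r
    by (rule Ck_on_compose[OF N0 T aff]) (use N0_in ballD in auto)
  have b_Ck: "Ck_on r N0 b" for r
  proof -
    have "Ck_on r N0 (\<lambda>p. (fst p + (-1) * T (z0 + l (snd p)), z0 + l (snd p)))"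
      by (intro Ck_on_Pair[OF N0] Ck_on_add[OF N0] aff Ck_on_mult[OF N0] T_aff Ck_on_const
          Ck_on_bounded_linear bounded_linear_fst)
    then show ?thesis by (simp add: b_def)
  qed
  define N where "N = N0 \<inter> b -` ?S"
  have N: "open N"
    unfolding N_def using Ck_on_continuous[OF b_Ck] N0 S by (intro continuous_open_preimage) auto
  have bS: "b p \<in> ?S" if "p \<in> N" for p using that by (simp add: N_def)
  define E where "E = (\<lambda>p. \<phi> (b p))"
  have E_Ck: "Ck_on r N E" for r
    unfolding E_def by (rule Ck_on_compose[OF N \<phi> Ck_on_subset[OF b_Ck]]) (auto simp: N_def)
  have E_diff: "E differentiable (at p)" if "p \<in> N" for p by (rule Ck_on_differentiable[OF E_Ck that])
  have ED: "E p \<in> D" if "p \<in> N" for p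
    unfolding E_def by (rule \<phi>D[OF bS[OF that]])
  have aff_der: "((\<lambda>p. z0 + l (snd p)) has_derivative (\<lambda>h. l (snd h))) (at p)" for p
  proof -
    have "((\<lambda>p. l (snd p)) has_derivative (\<lambda>h. l (snd h))) (at p)"
      by (intro bounded_linear_imp_has_derivative bounded_linear_compose[OF bl] bounded_linear_snd)
    from has_derivative_add[OF has_derivative_const this] show ?thesis by simp
  qed
  have b_der: "(b has_derivative (\<lambda>h. (fst h - dir T (z0 + l (snd p)) (l (snd h)), l (snd h)))) (at p)" if "p \<in> N" for p
    unfolding b_def
  proof (intro has_derivative_Pair has_derivative_diff aff_der)
    show "(fst has_derivative fst) (at p)" by (rule bounded_linear_imp_has_derivative[OF bounded_linear_fst])
    have "z0 + l (snd p) \<in> D" using N0_in[of p] that ballD by (auto simp: N_def)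
    then show "((\<lambda>p. T (z0 + l (snd p))) has_derivative (\<lambda>h. dir T (z0 + l (snd p)) (l (snd h)))) (at p)"
      by (intro has_derivative_compose[OF aff_der has_derivative_dir] T_diff)
  qed
  have E_dir: "dir E p h = dir \<phi> (b p) (fst h - dir T (z0 + l (snd p)) (l (snd h)), l (snd h))" if "p \<in> N" for p h
    unfolding E_def by (rule dir_eq[OF has_derivative_compose[OF b_der[OF that] has_derivative_dir[OF \<phi>_diff[OF bS[OF that]]]]])
  have E_t: "dir E p (1, 0) = X (E p)" if p: "p \<in> N" for p
  proof -
    have "z0 + l (snd p) \<in> D" using N0_in[of p] p ballD by (auto simp: N_def)
    then have "dir T (z0 + l (snd p)) 0 = 0"
      using linear_0[OF linear_frechet_derivative[OF T_diff]] by blast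
    then show ?thesis
      using E_dir[OF p, of "(1, 0)"] \<phi>X[OF bS[OF p]] l0 by (simp add: E_def)
  qed
  have TE: "T (E p) = fst p" if p: "p \<in> N" for p
    using T\<phi>[of "fst (b p)" "snd (b p)"] bS[OF p] by (auto simp: E_def b_def mem_Times_iff)
  define p0 where "p0 = (T z0, 0 :: real^'k)"
  have p0: "p0 \<in> N"
    using \<epsilon> \<rho> by (simp add: p0_def N_def N0_def b_def l0)
  have b0: "b p0 = (0, z0)" by (simp add: b_def p0_def l0)
  have E0: "E p0 = z0" using \<phi>0[OF z0] by (simp add: E_def b0)
  have \<phi>_space: "dir \<phi> (0, z0) (0, v) = v" for v
  proof -
    have S0: "(0, z0) \<in> ?S" using \<epsilon> \<rho> by simp
    have "((\<lambda>x. (0, x)) has_derivative (\<lambda>v. (0, v))) (at z0)"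
      by (auto intro!: derivative_eq_intros)
    from has_derivative_compose[OF this has_derivative_dir[OF \<phi>_diff[OF S0]]]
    have "((\<lambda>x. \<phi> (0, x)) has_derivative (\<lambda>v. dir \<phi> (0, z0) (0, v))) (at z0)" .
    then have "((\<lambda>x. x) has_derivative (\<lambda>v. dir \<phi> (0, z0) (0, v))) (at z0)"
      by (rule has_derivative_transform_within_open[OF _ open_ball z0]) (rule \<phi>0)
    from fun_cong[OF has_derivative_unique[OF this has_derivative_ident]] show ?thesis .
  qed
  \<comment> \<open>At the base point the derivative is
    \<open>fst h *\<^sub>R X z0 + l (snd h)\<close>; pairing with \<open>a\<close> isolates the
    first component, since \<open>a\<close> annihilates the range of \<open>l\<close>.\<close>
  have E_inj: "h = 0" if "dir E p0 h = 0" for h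
  proof -
    have S0: "(0, z0) \<in> ?S" using \<epsilon> \<rho> by simp
    have lin: "linear (dir \<phi> (0, z0))" by (rule linear_frechet_derivative[OF \<phi>_diff[OF S0]])
    have "dir E p0 h = dir \<phi> (0, z0) (fst h, l (snd h))"
      using E_dir[OF p0, of h] a al by (simp add: b0, simp add: p0_def l0)
    also have "\<dots> = dir \<phi> (0, z0) (fst h *\<^sub>R (1, 0) + (0, l (snd h)))" by simp
    also have "\<dots> = fst h *\<^sub>R X z0 + l (snd h)"
      unfolding linear_add[OF lin] linear_scale[OF lin] \<phi>_space \<phi>X[OF S0] \<phi>0[OF z0] ..
    finally have 0: "fst h *\<^sub>R X z0 + l (snd h) = 0" using that by simp
    then have "a \<bullet> (fst h *\<^sub>R X z0 + l (snd h)) = 0" by simp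
    then have "fst h = 0" by (simp add: inner_add_right al aX)
    with 0 have "l (snd h) = 0" by simp
    then have "snd h = 0" using l(4)[of "snd h"] linear_0[OF l(2)] by simp
    with \<open>fst h = 0\<close> show ?thesis by (simp add: prod_eq_iff)
  qed
  have "DIM(real^'n) = DIM(real \<times> (real^'k))" using card by simp
  \<comment> \<open>The inverse function theorem above concerns maps from \<open>real^'n\<close> to
    itself, so the product space is replaced by a linearly isomorphic copy.\<close>
  then obtain L :: "real^'n \<Rightarrow> real \<times> (real^'k)" and M where LM: "linear L" "linear M"
    "\<And>x. M (L x) = x" "\<And>p. L (M p) = p"
    by (rule isomorphisms_UNIV_UNIV) blast
  have bL: "bounded_linear L" and bM: "bounded_linear M"
    using LM by (simp_all add: linear_conv_bounded_linear)
  let ?N = "L -` N"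
  have LN: "open ?N" using N linear_continuous_on[OF bL] by (rule open_vimage)
  have G_Ck: "Ck_on r ?N (\<lambda>x. E (L x))" for r
    by (rule Ck_on_compose[OF LN E_Ck Ck_on_bounded_linear[OF bL]]) auto
  have G_dir: "dir (\<lambda>x. E (L x)) x v = dir E (L x) (L v)" if "x \<in> ?N" for x v
    using that by (intro dir_eq has_derivative_compose[OF bounded_linear_imp_has_derivative[OF bL]]
        has_derivative_dir E_diff) auto
  have "M p0 \<in> ?N" using LM p0 by simp
  moreover have "v = 0" if "dir (\<lambda>x. E (L x)) (M p0) v = 0" for v
  proof -
    have "L v = 0" using that G_dir[OF \<open>M p0 \<in> ?N\<close>] LM E_inj by simp
    then show ?thesis using LM(3)[of v] linear_0[OF LM(2)] by simp
  qed
  moreover have "smooth_on ?N (\<lambda>x. E (L x))" using G_Ck by (simp add: smooth_on_def)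
  ultimately obtain U' V' g where U': "open U'" "U' \<subseteq> ?N" "M p0 \<in> U'" and V': "open V'"
    and hom: "homeomorphism U' V' (\<lambda>x. E (L x)) g" and g: "smooth_on V' g"
    using smooth_inverse_function[OF LN, of "\<lambda>x. E (L x)" "M p0"] by metis
  have g: "Ck_on r V' g" for r using g by (simp add: smooth_on_def)
  have U'M: "open (M -` U')" using U'(1) linear_continuous_on[OF bM] by (rule open_vimage)
  have "(T z0, 0) \<in> M -` U'" using U'(3) by (simp add: p0_def)
  \<comment> \<open>The domain of the local inverse is cut down to a product, so that the image of
    the coordinates is an interval times \<open>\<Omega>\<close>.\<close>
  then obtain A \<Omega> where A: "open A" "open \<Omega>" "T z0 \<in> A" "0 \<in> \<Omega>" "A \<times> \<Omega> \<subseteq> M -` U'"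
    by (rule open_prod_elim[OF U'M]) auto
  have "open (A \<inter> J)" "T z0 \<in> A \<inter> J" using A J by auto
  then obtain d where d: "d > 0" "ball (T z0) d \<subseteq> A \<inter> J" using openE by blast
  define \<alpha> \<beta> where "\<alpha> = T z0 - d" and "\<beta> = T z0 + d"
  have I: "{\<alpha><..<\<beta>} = ball (T z0) d" by (auto simp: \<alpha>_def \<beta>_def dist_real_def)
  let ?B = "{\<alpha><..<\<beta>} \<times> \<Omega>"
  have B: "open ?B" using A by (simp add: open_Times)
  have BU: "M p \<in> U'" if "p \<in> ?B" for p
  proof -
    have "p \<in> A \<times> \<Omega>" using that d I by auto
    then show ?thesis using A by blast
  qed
  have BN: "p \<in> N" if "p \<in> ?B" for p
    using BU[OF that] U' LM(4)[of p] by auto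
  define F where "F = (\<lambda>z. L (g z))"
  have contF: "continuous_on V' F"
    unfolding F_def using hom linear_continuous_on[OF bL, of UNIV]
    by (auto simp: homeomorphism_def intro: continuous_on_compose2)
  define V where "V = V' \<inter> F -` ?B"
  have V: "open V" unfolding V_def using contF V' B by (rule continuous_open_preimage)
  have EF: "E (F z) = z" if "z \<in> V'" for z
    using hom that by (simp add: F_def homeomorphism_def)
  have FE: "F (E p) = p" "E p \<in> V'" if "p \<in> ?B" for p
  proof -
    have "g (E (L (M p))) = M p" "E (L (M p)) \<in> V'"
      using hom BU[OF that] by (auto simp: homeomorphism_def)
    then show "F (E p) = p" "E p \<in> V'" by (simp_all add: F_def LM)
  qed
  have FB: "F z \<in> ?B" if "z \<in> V" for z using that by (simp add: V_def)
  have F_eq: "(T z, snd (F z)) = F z" if "z \<in> V" for z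
    using TE[OF BN[OF FB[OF that]]] EF[of z] that by (simp add: V_def prod_eq_iff)
  have VF_Ck: "Ck_on r V F" for r
    unfolding F_def using Ck_on_linear[OF bL V Ck_on_subset[OF g, of V]] by (simp add: V_def)
  have p0B: "p0 \<in> ?B" using A d by (simp add: p0_def \<alpha>_def \<beta>_def)
  show ?thesis
  proof (rule that[of V \<Omega> \<alpha> \<beta> "\<lambda>z. snd (F z)" E])
    show "open V" "open \<Omega>" by fact+
    show "z0 \<in> V" using FE[OF p0B] p0B by (simp add: V_def E0)
    show "V \<subseteq> D"
    proof
      fix z assume "z \<in> V"
      then show "z \<in> D" using ED[OF BN[OF FB[OF \<open>z \<in> V\<close>]]] EF[of z] by (simp add: V_def)
    qed
    show "{\<alpha><..<\<beta>} \<subseteq> J" using I d by auto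
    show "smooth_on V (\<lambda>z. snd (F z))"
      using Ck_on_linear[OF bounded_linear_snd V VF_Ck] by (simp add: smooth_on_def)
    show "smooth_on ?B E"
      unfolding smooth_on_def using BN by (auto intro!: Ck_on_subset[OF E_Ck])
    show "dir E p (1, 0) = X (E p)" if "p \<in> ?B" for p by (rule E_t[OF BN[OF that]])
    show "homeomorphism V ?B (\<lambda>z. (T z, snd (F z))) E"
    proof (rule homeomorphismI)
      show "continuous_on V (\<lambda>z. (T z, snd (F z)))"
        using Ck_on_continuous[OF VF_Ck] F_eq by (subst continuous_on_cong[OF refl, of V _ F]) auto
      show "continuous_on ?B E"
        using Ck_on_continuous[OF E_Ck] BN by (auto intro: continuous_on_subset)
      show "(\<lambda>z. (T z, snd (F z))) ` V \<subseteq> ?B"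
        using FB F_eq by (intro image_subsetI) simp
      show "E ` ?B \<subseteq> V"
        using FE by (auto simp: V_def)
      show "E (T z, snd (F z)) = z" if "z \<in> V" for z
        unfolding F_eq[OF that] using EF[of z] that by (simp add: V_def)
      show "(T (E p), snd (F (E p))) = p" if "p \<in> ?B" for p
        using FE[OF that] TE[OF BN[OF that]] by simp
    qed
  qed
qed

section \<open>Warped products in Euclidean coordinates\<close>

text \<open>The solution with \<open>t\<^sub>0 = 0\<close> of
  \<open>(S')\<^sup>2 = c * S - k * S\<^sup>2\<close>, the equation satisfied by
  \<open>s\<^sup>2\<close> along unit-speed gradient lines.\<close>

definition warp_profile :: "real \<Rightarrow> real \<Rightarrow> real \<Rightarrow> real" where
  "warp_profile c k t = c / k * (sin (sqrt k * t / 2))\<^sup>2"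

definition warp_slope :: "real \<Rightarrow> real \<Rightarrow> real \<Rightarrow> real" where
  "warp_slope c k t = c / sqrt k * sin (sqrt k * t / 2) * cos (sqrt k * t / 2)"

text \<open>The integral of \<open>1 / sqrt (c * x - k * x\<^sup>2)\<close> from zero; it inverts
  \<open>warp_profile\<close> on its first rising branch.\<close>

definition warp_time :: "real \<Rightarrow> real \<Rightarrow> real \<Rightarrow> real" where
  "warp_time c k x = 2 / sqrt k * arcsin (sqrt (k * x / c))"

lemma warp_profile_deriv:
  assumes "k > 0"
  shows "(warp_profile c k has_real_derivative warp_slope c k t) (at t)"
proof -
  define r where "r = sqrt k"
  have r: "sqrt k = r" "r > 0" and kr: "k = r * r" using assms by (auto simp: r_def)
  have "((\<lambda>t. c / k * (sin (r * t / 2))\<^sup>2) has_real_derivative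
      c / k * (2 * sin (r * t / 2) * (cos (r * t / 2) * (r / 2)))) (at t)"
    using assms by (auto intro!: derivative_eq_intros)
  moreover have "c / k * (2 * sin (r * t / 2) * (cos (r * t / 2) * (r / 2))) = warp_slope c k t"
    unfolding warp_slope_def r(1) unfolding kr using r(2) by (simp add: field_simps)
  ultimately show ?thesis
    unfolding warp_profile_def r(1) by (simp only:)
qed

text \<open>The right-hand side is the conformal factor \<open>c / 2 - k * w\<close> at
  \<open>w = warp_profile c k t\<close>. This match is why dividing by the squared slope later
  cancels the conformal stretching of the metric.\<close>

lemma warp_slope_deriv:
  assumes "k > 0"
  shows "(warp_slope c k has_real_derivative c / 2 - k * warp_profile c k t) (at t)"
proof -
  define r where "r = sqrt k"
  have r: "sqrt k = r" "r > 0" and kr: "k = r * r" using assms by (auto simp: r_def)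
  have "(warp_slope c k has_real_derivative
      c / 2 * ((cos (r * t / 2))\<^sup>2 - (sin (r * t / 2))\<^sup>2)) (at t)"
    unfolding warp_slope_def r(1) using r(2)
    by (auto intro!: derivative_eq_intros simp: field_simps power2_eq_square)
  moreover have "c / 2 * ((cos (r * t / 2))\<^sup>2 - (sin (r * t / 2))\<^sup>2) = c / 2 - k * warp_profile c k t"
    unfolding warp_profile_def r(1) cos_squared_eq using r(2) by (simp add: kr field_simps)
  ultimately show ?thesis by (simp only:)
qed

lemma warp_slope_square:
  assumes "k > 0"
  shows "(warp_slope c k t)\<^sup>2 = c * warp_profile c k t - k * (warp_profile c k t)\<^sup>2"
proof -
  define x where "x = sqrt k * t / 2"
  have "(warp_slope c k t)\<^sup>2 = c\<^sup>2 / k * (sin x)\<^sup>2 * (cos x)\<^sup>2"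
    using assms by (simp add: warp_slope_def x_def power_mult_distrib power_divide)
  also have "\<dots> = c * warp_profile c k t - k * (warp_profile c k t)\<^sup>2"
    unfolding warp_profile_def x_def[symmetric] cos_squared_eq using assms
    by (simp add: field_simps power2_eq_square)
  finally show ?thesis .
qed

text \<open>Sine and cosine are both positive before a quarter period, that is for \<open>t\<close>
  below \<open>pi / sqrt k\<close>, the time at which the profile attains its maximum
  \<open>c / k\<close>.\<close>

lemma warp_slope_pos:
  assumes "c > 0" "k > 0" "0 < t" "t < pi / sqrt k"
  shows "warp_slope c k t > 0"
proof -
  have "0 < sqrt k * t / 2" "sqrt k * t / 2 < pi / 2"
    using assms by (auto simp: field_simps)
  then have "0 < sin (sqrt k * t / 2)" "0 < cos (sqrt k * t / 2)"
    by (auto intro: sin_gt_zero cos_gt_zero)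
  then show ?thesis using assms by (simp add: warp_slope_def)
qed

text \<open>Everything reduces to arcsin at \<open>sqrt q\<close> with \<open>q = k * x / c\<close>;
  the bounds on \<open>x\<close> put this argument strictly between 0 and 1, where arcsin is
  differentiable.\<close>

lemma warp_time:
  assumes c: "c > 0" and k: "k > 0" and x: "0 < x" "k * x < c"
  shows "0 < warp_time c k x" "warp_time c k x < pi / sqrt k" "warp_profile c k (warp_time c k x) = x"
    "(warp_time c k has_real_derivative 1 / sqrt (c * x - k * x\<^sup>2)) (at x)"
proof -
  define q where "q = k * x / c"
  have q: "0 < q" "q < 1" using assms by (auto simp: q_def field_simps)
  then have sq: "0 < sqrt q" "sqrt q < 1" by auto
  have "0 < arcsin (sqrt q)" "arcsin (sqrt q) < pi / 2"
    using arcsin_less_mono[of 0 "sqrt q"] arcsin_lt_bounded[of "sqrt q"] sq by auto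
  then show "0 < warp_time c k x" "warp_time c k x < pi / sqrt k"
    using k by (auto simp: warp_time_def q_def[symmetric] field_simps)
  have "sqrt k * warp_time c k x / 2 = arcsin (sqrt q)"
    using k by (simp add: warp_time_def q_def)
  moreover have "sin (arcsin (sqrt q)) = sqrt q" by (rule sin_arcsin) (use sq in linarith)+
  ultimately have "warp_profile c k (warp_time c k x) = c / k * (sqrt q)\<^sup>2"
    by (simp only: warp_profile_def)
  also have "\<dots> = c / k * q" using q by simp
  also have "\<dots> = x" using c k by (simp add: q_def)
  finally show "warp_profile c k (warp_time c k x) = x" .
  have 1: "((\<lambda>x. k * x / c) has_real_derivative k / c) (at x)"
    using c by (auto intro!: derivative_eq_intros)
  have 2: "((\<lambda>x. sqrt (k * x / c)) has_real_derivative inverse (sqrt q) / 2 * (k / c)) (at x)"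
    unfolding q_def by (rule DERIV_chain2[OF DERIV_real_sqrt 1]) (use q in \<open>simp only: q_def\<close>)
  have "((\<lambda>x. arcsin (sqrt (k * x / c))) has_real_derivative
      inverse (sqrt (1 - (sqrt q)\<^sup>2)) * (inverse (sqrt q) / 2 * (k / c))) (at x)"
    by (rule DERIV_chain2[OF _ 2], unfold q_def[symmetric], rule DERIV_arcsin) (use sq in linarith)+
  then have "(warp_time c k has_real_derivative
      2 / sqrt k * (inverse (sqrt (1 - (sqrt q)\<^sup>2)) * (inverse (sqrt q) / 2 * (k / c)))) (at x)"
    unfolding warp_time_def by (rule DERIV_cmult)
  moreover have "2 / sqrt k * (inverse (sqrt (1 - (sqrt q)\<^sup>2)) * (inverse (sqrt q) / 2 * (k / c))) =
      1 / sqrt (c * x - k * x\<^sup>2)"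
  proof -
    have "c * x - k * x\<^sup>2 = (1 - q) * q * (c\<^sup>2 / k)"
      using c k by (simp add: q_def field_simps power2_eq_square)
    then have 1: "sqrt (c * x - k * x\<^sup>2) = sqrt (1 - q) * sqrt q * (c / sqrt k)"
      using c k by (simp add: real_sqrt_mult real_sqrt_divide)
    define r where "r = sqrt k"
    have r: "sqrt k = r" "r > 0" and kr: "k = r * r" using k by (auto simp: r_def)
    have 2: "2 / sqrt k * (A * (B / 2 * (k / c))) = A * B * (sqrt k / c)" for A B
      unfolding r(1) unfolding kr using r(2) c by (simp add: field_simps)
    show ?thesis
      unfolding 1 2 using q by (simp add: field_simps)
  qed
  ultimately show "(warp_time c k has_real_derivative 1 / sqrt (c * x - k * x\<^sup>2)) (at x)"
    by simp
qed

section \<open>From a conformal gradient field to the warped product form on an open set of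
  R^n\<close>

lemma bounded_bilinear_matrix_vector: "bounded_bilinear ((*v) :: real^'n^'m \<Rightarrow> real^'n \<Rightarrow> real^'m)"
proof (rule bilinear_conv_bounded_bilinear[THEN iffD1])
  show "bilinear ((*v) :: real^'n^'m \<Rightarrow> real^'n \<Rightarrow> real^'m)"
    unfolding bilinear_def
    by (intro conjI allI linearI)
       (simp_all only: matrix_vector_mult_add_rdistrib matrix_vector_right_distrib
        matrix_vector_mult_scaleR scaleR_matrix_vector_assoc[symmetric])
qed

lemma bilinear_form_has_derivative:
  fixes H :: "'a::real_normed_vector \<Rightarrow> real^'n^'n" and u v :: "'a \<Rightarrow> real^'n"
  assumes "u differentiable (at p)" "H differentiable (at p)" "v differentiable (at p)"
  shows "((\<lambda>p. u p \<bullet> (H p *v v p)) has_derivative (\<lambda>w. dir u p w \<bullet> (H p *v v p) +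
      u p \<bullet> (dir H p w *v v p) + u p \<bullet> (H p *v dir v p w))) (at p)"
proof -
  note d = assms[THEN has_derivative_dir]
  from has_derivative_inner[OF d(1) bounded_bilinear.FDERIV[OF bounded_bilinear_matrix_vector d(2,3)]]
  show ?thesis by (simp add: inner_add_right add_ac)
qed

lemma has_real_derivative_first_coordinate:
  fixes u :: "real \<times> 'a::real_normed_vector \<Rightarrow> real"
  assumes "u differentiable (at (t, y))"
  shows "((\<lambda>t. u (t, y)) has_real_derivative dir u (t, y) (1, 0)) (at t)"
proof -
  have "((\<lambda>t. (t, y)) has_derivative (\<lambda>h. (h, 0))) (at t)"
    by (auto intro!: derivative_eq_intros)
  from has_derivative_compose[OF this has_derivative_dir[OF assms]]
  have "((\<lambda>t. u (t, y)) has_derivative (\<lambda>h. dir u (t, y) (h, 0))) (at t)" .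
  moreover have "(\<lambda>h. dir u (t, y) (h, 0)) = (*) (dir u (t, y) (1, 0))"
  proof
    show "dir u (t, y) (h, 0) = dir u (t, y) (1, 0) * h" for h
      using linear_scale[OF linear_frechet_derivative[OF assms], of h "(1, 0)"] by simp
  qed
  ultimately show ?thesis by (simp only: has_field_derivative_def)
qed

text \<open>\<open>W\<close> is the gradient of \<open>w\<close>, and \<open>conf\<close> says that
  the Lie derivative of \<open>h\<close> along \<open>W\<close> is
  \<open>2 * (c / 2 - k * w)\<close> times \<open>h\<close>. In the coordinates of the unit-speed
  flow, \<open>conf\<close> and \<open>dfW\<close> become ordinary differential equations in
  \<open>t\<close>, integrated by dividing by the squared slope and by adding a multiple of its
  logarithm. The constant \<open>\<mu>\<close> stands for \<open>m - n\<close>.\<close>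

theorem warped_product_normal_form:
  fixes h :: "real^'n::finite \<Rightarrow> real^'n^'n" and w f :: "real^'n \<Rightarrow> real" and W :: "real^'n \<Rightarrow> real^'n"
    and c k \<mu> :: real
  assumes card: "CARD('n) = CARD('k::finite) + 1"
    and D: "open D" "z0 \<in> D" and h: "metric_components D h" and w: "smooth_on D w" and f: "smooth_on D f"
    and c: "c > 0" and k: "k > 0"
    and grad: "\<And>z v. z \<in> D \<Longrightarrow> dir w z v = v \<bullet> (h z *v W z)"
    and conf: "\<And>z \<xi> \<eta>. z \<in> D \<Longrightarrow> \<xi> \<bullet> (dir h z (W z) *v \<eta>) + dir W z \<xi> \<bullet> (h z *v \<eta>) + \<xi> \<bullet> (h z *v dir W z \<eta>)
        = 2 * (c / 2 - k * w z) * (\<xi> \<bullet> (h z *v \<eta>))"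
    and w_pos: "\<And>z. z \<in> D \<Longrightarrow> w z > 0" and W_nz: "\<And>z. z \<in> D \<Longrightarrow> W z \<noteq> 0"
    and norm_W: "\<And>z. z \<in> D \<Longrightarrow> dir w z (W z) = c * w z - k * (w z)\<^sup>2"
    and dfW: "\<And>z. z \<in> D \<Longrightarrow> dir f z (W z) = - \<mu> * (c / 2 - k * w z)"
  obtains V T \<alpha> \<beta> and \<Omega> :: "(real^'k) set" and Y :: "real^'n \<Rightarrow> real^'k" and E g\<^sub>\<Sigma> f\<^sub>\<Sigma> where
    "open V" "z0 \<in> V" "V \<subseteq> D" "open \<Omega>" "{\<alpha><..<\<beta>} \<subseteq> {0<..<pi / sqrt k}"
    "homeomorphism V ({\<alpha><..<\<beta>} \<times> \<Omega>) (\<lambda>z. (T z, Y z)) E"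
    "smooth_on V T" "smooth_on V Y" "smooth_on ({\<alpha><..<\<beta>} \<times> \<Omega>) E"
    "\<And>z. T z = warp_time c k (w z)"
    "\<And>z. z \<in> V \<Longrightarrow> w z = warp_profile c k (T z)"
    "\<And>z v. z \<in> V \<Longrightarrow> dir T z v = dir w z v / warp_slope c k (T z)"
    "metric_components \<Omega> g\<^sub>\<Sigma>" "smooth_on \<Omega> f\<^sub>\<Sigma>"
    "\<And>z \<xi> \<eta>. z \<in> V \<Longrightarrow> \<xi> \<bullet> (h z *v \<eta>) = dir T z \<xi> * dir T z \<eta> +
        (warp_slope c k (T z))\<^sup>2 * (dir Y z \<xi> \<bullet> (g\<^sub>\<Sigma> (Y z) *v dir Y z \<eta>))"
    "\<And>z. z \<in> V \<Longrightarrow> f z = - \<mu> * ln (warp_slope c k (T z)) + f\<^sub>\<Sigma> (Y z)"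
proof -
  have w: "Ck_on r D w" for r using w by (simp add: smooth_on_def)
  have f: "Ck_on r D f" for r using f by (simp add: smooth_on_def)
  have h_Ck: "Ck_on r D h" for r using h by (simp add: metric_components_def smooth_on_def)
  have h_sym: "transpose (h z) = h z" if "z \<in> D" for z
    using h that by (simp add: metric_components_def)
  have h_pos: "\<xi> \<bullet> (h z *v \<xi>) > 0" if "z \<in> D" "\<xi> \<noteq> 0" for z \<xi>
    using h that by (simp add: metric_components_def)
  have h_comm: "\<xi> \<bullet> (h z *v \<eta>) = \<eta> \<bullet> (h z *v \<xi>)" if "z \<in> D" for z \<xi> \<eta>
    by (metis dot_lmul_matrix h_sym[OF that] inner_commute transpose_matrix_vector)
  have w_diff: "w differentiable (at z)" if "z \<in> D" for z by (rule Ck_on_differentiable[OF w that])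
  have f_diff: "f differentiable (at z)" if "z \<in> D" for z by (rule Ck_on_differentiable[OF f that])
  have h_diff: "h differentiable (at z)" if "z \<in> D" for z by (rule Ck_on_differentiable[OF h_Ck that])
  \<comment> \<open>\<open>W\<close> solves the linear system with matrix \<open>h\<close> and the
    partial derivatives of \<open>w\<close> on the right, hence is smooth.\<close>
  have W: "Ck_on r D W" for r
  proof (rule Ck_on_linear_solve[OF D(1), where M=h and b="\<lambda>z. \<chi> i. dir w z (axis i 1)"])
    show "Ck_on r D (\<lambda>z. h z $ i $ j)" for i j
      by (intro Ck_on_nth D h_Ck)
    show "Ck_on r D (\<lambda>z. (\<chi> i. dir w z (axis i 1)) $ i)" for i
      using Ck_on_dir[OF w] by simp
    show "det (h z) \<noteq> 0" if "z \<in> D" for z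
    proof -
      have "\<xi> = 0" if "h z *v \<xi> = 0" for \<xi>
        using h_pos[OF \<open>z \<in> D\<close>, of \<xi>] that by auto
      then show ?thesis
        using invertible_det_nz invertible_left_inverse matrix_left_invertible_ker by metis
    qed
    show "h z *v W z = (\<chi> i. dir w z (axis i 1))" if "z \<in> D" for z
      by (simp add: vec_eq_iff grad[OF that] inner_axis_axis inner_axis')
  qed
  have W_diff: "W differentiable (at z)" if "z \<in> D" for z by (rule Ck_on_differentiable[OF W that])
  define N where "N = (\<lambda>z. c * w z - k * (w z)\<^sup>2)"
  have N_pos: "N z > 0" if "z \<in> D" for z
    unfolding N_def norm_W[OF that, symmetric] grad[OF that] using h_pos[OF that W_nz[OF that]] .
  \<comment> \<open>The squared gradient factors as \<open>w * (c - k * w)\<close>; its positivity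
    keeps \<open>w\<close> strictly below \<open>c / k\<close>, where the inverse of the profile is
    differentiable.\<close>
  have w_lt: "k * w z < c" if "z \<in> D" for z
  proof -
    have "0 < w z * (c - k * w z)" using N_pos[OF that] by (simp add: N_def power2_eq_square algebra_simps)
    then show ?thesis using w_pos[OF that] by (simp add: zero_less_mult_iff)
  qed
  define T where "T = (\<lambda>z. warp_time c k (w z))"
  note wt = warp_time[OF c k w_pos w_lt]
  have T_range: "0 < T z" "T z < pi / sqrt k" and wT: "warp_profile c k (T z) = w z" if "z \<in> D" for z
    using wt[OF that that] by (auto simp: T_def)
  have slope_pos: "warp_slope c k (T z) > 0" if "z \<in> D" for z
    using warp_slope_pos[OF c k T_range[OF that]] .
  have slope_N: "sqrt (N z) = warp_slope c k (T z)" if "z \<in> D" for z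
    using warp_slope_square[OF k, of c "T z"] slope_pos[OF that]
    by (simp add: wT[OF that] N_def real_sqrt_unique)
  have T_der: "(T has_derivative (\<lambda>v. dir w z v / warp_slope c k (T z))) (at z)" if "z \<in> D" for z
  proof -
    have "(warp_time c k has_derivative (\<lambda>v. 1 / warp_slope c k (T z) * v)) (at (w z))"
      using wt(4)[OF that that] slope_N[OF that] by (simp only: has_field_derivative_def N_def)
    from has_derivative_compose[OF has_derivative_dir[OF w_diff[OF that]] this]
    show ?thesis unfolding T_def by simp
  qed
  have T_dir: "dir T z v = dir w z v / warp_slope c k (T z)" if "z \<in> D" for z v
    by (rule dir_eq[OF T_der[OF that]])
  have T_diff: "T differentiable (at z)" if "z \<in> D" for z
    by (rule differentiableI[OF T_der[OF that]])
  have N_Ck: "Ck_on r D N" for r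
  proof -
    have "Ck_on r D (\<lambda>z. c * w z + (- k) * (w z * w z))"
      by (intro Ck_on_add Ck_on_mult D(1) w Ck_on_const)
    then show ?thesis by (simp add: N_def power2_eq_square)
  qed
  \<comment> \<open>The reciprocal slope is written as a power of \<open>N\<close>, so that its
    smoothness does not presuppose that of \<open>T\<close>.\<close>
  have i_Ck: "Ck_on r D (\<lambda>z. N z powr (- 1 / 2))" for r
    by (rule Ck_on_compose[OF D(1) Ck_on_powr N_Ck]) (use N_pos in auto)
  have i_eq: "N z powr (- 1 / 2) = 1 / warp_slope c k (T z)" if "z \<in> D" for z
    using N_pos[OF that] slope_N[OF that] by (simp add: powr_minus_divide powr_half_sqrt)
  have T: "Ck_on r D T" for r
  proof (cases r)
    case 0
    then show ?thesis
      using T_diff by (auto intro!: continuous_at_imp_continuous_on differentiable_imp_continuous_within)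
  next
    case (Suc q)
    have "Ck_on q D (\<lambda>z. N z powr (- 1 / 2) * dir w z v)" for v
      by (intro Ck_on_mult D(1) i_Ck Ck_on_dir[OF w])
    moreover have "dir T z v = N z powr (- 1 / 2) * dir w z v" if "z \<in> D" for z v
      unfolding T_dir[OF that] i_eq[OF that] by simp
    ultimately have "Ck_on q D (\<lambda>z. dir T z v)" for v
      by (simp only: Ck_on_cong[OF D(1), of "\<lambda>z. dir T z v" "\<lambda>z. N z powr (- 1 / 2) * dir w z v"])
    then show ?thesis using Suc T_diff by simp
  qed
  \<comment> \<open>The gradient of \<open>T\<close>, a unit field parallel to
    \<open>W\<close>.\<close>
  define X where "X = (\<lambda>z. (N z powr (- 1 / 2)) *\<^sub>R W z)"
  have X_eq: "X z = (1 / warp_slope c k (T z)) *\<^sub>R W z" if "z \<in> D" for z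
    by (simp only: X_def i_eq[OF that])
  have X: "Ck_on r D X" for r
    unfolding X_def by (rule Ck_on_bilinear[OF bounded_bilinear_scaleR D(1) i_Ck W])
  have wX: "dir w z (X z) = warp_slope c k (T z)" if "z \<in> D" for z
  proof -
    have "dir w z (X z) = 1 / warp_slope c k (T z) * (warp_slope c k (T z))\<^sup>2"
      unfolding X_eq[OF that] grad[OF that] warp_slope_square[OF k] wT[OF that] norm_W[OF that, symmetric] by simp
    then show ?thesis using slope_pos[OF that] by (simp add: power2_eq_square)
  qed
  obtain V \<alpha> \<beta> and \<Omega> :: "(real^'k) set" and Y :: "real^'n \<Rightarrow> real^'k" and E :: "real \<times> (real^'k) \<Rightarrow> real^'n" where
    V: "open V" "z0 \<in> V" "V \<subseteq> D" "open \<Omega>" "{\<alpha><..<\<beta>} \<subseteq> {0<..<pi / sqrt k}"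
    and hom: "homeomorphism V ({\<alpha><..<\<beta>} \<times> \<Omega>) (\<lambda>z. (T z, Y z)) E"
    and Y: "smooth_on V Y" and E: "smooth_on ({\<alpha><..<\<beta>} \<times> \<Omega>) E"
    and E_t: "\<And>p. p \<in> {\<alpha><..<\<beta>} \<times> \<Omega> \<Longrightarrow> dir E p (1, 0) = X (E p)"
  proof (rule smooth_flow_box[OF card D, of X T "{0<..<pi / sqrt k}"])
    show "smooth_on D X" "smooth_on D T" using X T by (auto simp: smooth_on_def)
    show "dir T z (X z) = 1" if "z \<in> D" for z
      using slope_pos[OF that] by (simp add: T_dir[OF that] wX[OF that])
    show "open {0<..<pi / sqrt k}" "T z0 \<in> {0<..<pi / sqrt k}"
      using T_range[OF D(2)] by auto
  qed blast
  let ?B = "{\<alpha><..<\<beta>} \<times> \<Omega>"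
  have B: "open ?B" using V by (simp add: open_Times)
  have Y_Ck: "Ck_on r V Y" and E_Ck: "Ck_on r ?B E" for r using Y E by (auto simp: smooth_on_def)
  have Y_diff: "Y differentiable (at z)" if "z \<in> V" for z by (rule Ck_on_differentiable[OF Y_Ck that])
  have E_diff: "E differentiable (at p)" if "p \<in> ?B" for p by (rule Ck_on_differentiable[OF E_Ck that])
  have FB: "(T z, Y z) \<in> ?B" and EF: "E (T z, Y z) = z" if "z \<in> V" for z
    using hom that by (auto simp: homeomorphism_def)
  have EV: "E p \<in> V" and TE: "T (E p) = fst p" and YE: "Y (E p) = snd p" if "p \<in> ?B" for p
    using hom that by (force simp: homeomorphism_def)+
  have ED: "E p \<in> D" if "p \<in> ?B" for p using EV[OF that] V by blast
  have slope_pos': "warp_slope c k t > 0" if "t \<in> {\<alpha><..<\<beta>}" for t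
    using that V by (intro warp_slope_pos c k) auto
  define \<tau> where "\<tau> = T z0"
  have \<tau>: "\<tau> \<in> {\<alpha><..<\<beta>}" using FB[OF V(2)] by (auto simp: \<tau>_def)
  \<comment> \<open>The coordinate vector field of the transverse direction
    \<open>\<eta>\<close>.\<close>
  define A where "A = (\<lambda>\<eta> p. dir E p (0, \<eta>))"
  have A_Ck: "Ck_on r ?B (A \<eta>)" for r \<eta> unfolding A_def by (rule Ck_on_dir[OF E_Ck])
  have A_diff: "A \<eta> differentiable (at p)" if "p \<in> ?B" for \<eta> p by (rule Ck_on_differentiable[OF A_Ck that])
  have A_lin: "linear (\<lambda>\<eta>. A \<eta> p)" if "p \<in> ?B" for p
  proof -
    have "linear (dir E p)" by (rule linear_frechet_derivative[OF E_diff[OF that]])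
    then have "linear (dir E p \<circ> (\<lambda>\<eta>. (0, \<eta>)))"
      by (intro linear_compose) (auto intro!: linearI)
    then show ?thesis by (simp add: A_def o_def)
  qed
  have wE: "w (E p) = warp_profile c k (fst p)" if "p \<in> ?B" for p
    using wT[OF ED[OF that]] TE[OF that] by simp
  \<comment> \<open>In the new coordinates \<open>w\<close> depends on \<open>t\<close> alone, so
    transverse fields are tangent to its level sets and hence orthogonal to
    \<open>X\<close>.\<close>
  have wA: "dir w (E p) (A \<eta> p) = 0" if p: "p \<in> ?B" for p \<eta>
  proof -
    have "((\<lambda>p. warp_profile c k (fst p)) has_derivative (\<lambda>v. warp_slope c k (fst p) * fst v)) (at p)"
      using has_derivative_compose[OF bounded_linear_imp_has_derivative[OF bounded_linear_fst]
          warp_profile_deriv[OF k, unfolded has_field_derivative_def]] .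
    then have "((\<lambda>p. w (E p)) has_derivative (\<lambda>v. warp_slope c k (fst p) * fst v)) (at p)"
      by (rule iffD1[OF eq_on_open_derivative(1)[OF B p], rotated]) (simp add: wE)
    from fun_cong[OF has_derivative_unique[OF this has_derivative_compose[OF
          has_derivative_dir[OF E_diff[OF p]] has_derivative_dir[OF w_diff[OF ED[OF p]]]]], of "(0, \<eta>)"]
    show ?thesis by (simp add: A_def)
  qed
  have hX: "X z \<bullet> (h z *v \<xi>) = dir w z \<xi> / warp_slope c k (T z)" if "z \<in> D" for z \<xi>
    using h_comm[OF that, of "W z" \<xi>] by (simp add: X_eq[OF that] grad[OF that])
  \<comment> \<open>Mixed derivatives of \<open>E\<close> commute, so the time derivative of a
    transverse field is the transverse derivative of \<open>X\<close>; the scalar factor of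
    \<open>X\<close> depends on \<open>t\<close> alone and contributes no term.\<close>
  have A_t: "dir (A \<eta>) p (1, 0) = (1 / warp_slope c k (fst p)) *\<^sub>R dir W (E p) (A \<eta> p)" if p: "p \<in> ?B" for p \<eta>
  proof -
    have "dir (A \<eta>) p (1, 0) = dir (\<lambda>p. dir E p (1, 0)) p (0, \<eta>)"
      unfolding A_def by (rule dir_commute[OF B E_Ck p])
    also have "\<dots> = dir (\<lambda>p. (1 / warp_slope c k (fst p)) *\<^sub>R W (E p)) p (0, \<eta>)"
      by (rule fun_cong[OF eq_on_open_derivative(3)[OF B p]]) (simp add: E_t X_eq ED TE)
    also have "\<dots> = (1 / warp_slope c k (fst p)) *\<^sub>R dir W (E p) (A \<eta> p)"
    proof -
      have "warp_slope c k (fst p) \<noteq> 0" using slope_pos'[of "fst p"] p by (auto simp: mem_Times_iff)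
      then have "((\<lambda>t. 1 / warp_slope c k t) has_real_derivative
          - (c / 2 - k * warp_profile c k (fst p)) / (warp_slope c k (fst p))\<^sup>2) (at (fst p))"
        using warp_slope_deriv[OF k, of c "fst p"]
        by (auto intro!: derivative_eq_intros simp: power2_eq_square)
      from has_derivative_compose[OF bounded_linear_imp_has_derivative[OF bounded_linear_fst]
          this[unfolded has_field_derivative_def]]
      have "((\<lambda>p. 1 / warp_slope c k (fst p)) has_derivative (\<lambda>v.
          - (c / 2 - k * warp_profile c k (fst p)) / (warp_slope c k (fst p))\<^sup>2 * fst v)) (at p)" .
      from dir_eq[OF has_derivative_scaleR[OF this has_derivative_compose[OF
          has_derivative_dir[OF E_diff[OF p]] has_derivative_dir[OF W_diff[OF ED[OF p]]]]], of "(0, \<eta>)"]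
      show ?thesis by (simp add: A_def)
    qed
    finally show ?thesis .
  qed
  have hE_diff: "(\<lambda>p. h (E p)) differentiable (at p)"
    and hE_t: "dir (\<lambda>p. h (E p)) p (1, 0) = (1 / warp_slope c k (fst p)) *\<^sub>R dir h (E p) (W (E p))" if p: "p \<in> ?B" for p
  proof -
    note d = dir_compose[OF E_diff[OF p] h_diff[OF ED[OF p]]]
    show "(\<lambda>p. h (E p)) differentiable (at p)" by (rule d(2))
    show "dir (\<lambda>p. h (E p)) p (1, 0) = (1 / warp_slope c k (fst p)) *\<^sub>R dir h (E p) (W (E p))"
      unfolding d(1) E_t[OF p] X_eq[OF ED[OF p]] TE[OF p]
      by (rule linear_scale[OF linear_frechet_derivative[OF h_diff[OF ED[OF p]]]])
  qed
  define Q where "Q = (\<lambda>\<xi> \<eta> p. A \<xi> p \<bullet> (h (E p) *v A \<eta> p))"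
  have Q_fun: "Q \<xi> \<eta> = (\<lambda>p. A \<xi> p \<bullet> (h (E p) *v A \<eta> p))" for \<xi> \<eta>
    by (simp add: Q_def)
  \<comment> \<open>Let \<open>\<sigma>\<close> be the slope, with derivative \<open>\<psi>\<close>.
    Both \<open>Q\<close> and \<open>\<sigma>\<^sup>2\<close> have logarithmic derivative
    \<open>2 * \<psi> / \<sigma>\<close> in \<open>t\<close>, the former by \<open>conf\<close>, so
    their quotient is constant. The proof uses the quotient rule, since \<open>Q\<close> may
    vanish.\<close>
  have Q_const: "Q \<xi> \<eta> (t, y) / (warp_slope c k t)\<^sup>2 = Q \<xi> \<eta> (\<tau>, y) / (warp_slope c k \<tau>)\<^sup>2"
    if t: "t \<in> {\<alpha><..<\<beta>}" and y: "y \<in> \<Omega>" for \<xi> \<eta> t y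
  proof (rule has_derivative_zero_unique[OF convex_real_interval(8) _ t \<tau>])
    fix t assume t: "t \<in> {\<alpha><..<\<beta>}"
    then have p: "(t, y) \<in> ?B" using y by simp
    define \<sigma> where "\<sigma> = warp_slope c k t"
    define \<psi> where "\<psi> = c / 2 - k * warp_profile c k t"
    have \<sigma>: "\<sigma> > 0" using slope_pos'[OF t] by (simp add: \<sigma>_def)
    note Qd = bilinear_form_has_derivative[OF A_diff[OF p] hE_diff[OF p] A_diff[OF p], of \<xi> \<eta>, folded Q_fun]
    note dir_eq[OF Qd, of "(1, 0)"]
    also have "dir (A \<xi>) (t, y) (1, 0) \<bullet> (h (E (t, y)) *v A \<eta> (t, y)) +
        A \<xi> (t, y) \<bullet> (dir (\<lambda>p. h (E p)) (t, y) (1, 0) *v A \<eta> (t, y)) +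
        A \<xi> (t, y) \<bullet> (h (E (t, y)) *v dir (A \<eta>) (t, y) (1, 0)) = 1 / \<sigma> * (2 * \<psi> * Q \<xi> \<eta> (t, y))"
      unfolding A_t[OF p] hE_t[OF p] Q_def \<psi>_def
      using conf[OF ED[OF p], of "A \<xi> (t, y)" "A \<eta> (t, y)"] wE[OF p]
      by (simp add: \<sigma>_def matrix_vector_mult_scaleR scaleR_matrix_vector_assoc[symmetric] add_divide_distrib[symmetric] add_ac)
    finally have "dir (Q \<xi> \<eta>) (t, y) (1, 0) = 1 / \<sigma> * (2 * \<psi> * Q \<xi> \<eta> (t, y))" .
    with has_real_derivative_first_coordinate[OF differentiableI[OF Qd]]
    have 1: "((\<lambda>t. Q \<xi> \<eta> (t, y)) has_real_derivative 1 / \<sigma> * (2 * \<psi> * Q \<xi> \<eta> (t, y))) (at t)"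
      by (simp only:)
    have "((\<lambda>t. Q \<xi> \<eta> (t, y) / (warp_slope c k t)\<^sup>2) has_real_derivative
       (1 / \<sigma> * (2 * \<psi> * Q \<xi> \<eta> (t, y)) * \<sigma>\<^sup>2 - Q \<xi> \<eta> (t, y) * (2 * \<sigma> * \<psi>)) / (\<sigma>\<^sup>2)\<^sup>2) (at t)"
      using \<sigma> warp_slope_deriv[OF k, of c t]
      by (auto intro!: derivative_eq_intros 1 simp: \<sigma>_def \<psi>_def power2_eq_square)
    moreover have "(1 / \<sigma> * (2 * \<psi> * Q \<xi> \<eta> (t, y)) * \<sigma>\<^sup>2 - Q \<xi> \<eta> (t, y) * (2 * \<sigma> * \<psi>)) = 0"
      using \<sigma> by (simp add: power2_eq_square)
    ultimately have "((\<lambda>t. Q \<xi> \<eta> (t, y) / (warp_slope c k t)\<^sup>2) has_real_derivative 0) (at t)"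
      by simp
    then show "((\<lambda>t. Q \<xi> \<eta> (t, y) / (warp_slope c k t)\<^sup>2) has_derivative (\<lambda>h. 0)) (at t within {\<alpha><..<\<beta>})"
      by (simp add: has_field_derivative_def has_derivative_at_withinI lambda_zero)
  qed
  \<comment> \<open>Along flow lines \<open>f\<close> has derivative
    \<open>- \<mu> * \<psi> / \<sigma>\<close>, the negative of the derivative of
    \<open>\<mu> * ln \<sigma>\<close>.\<close>
  have f_const: "f (E (t, y)) + \<mu> * ln (warp_slope c k t) = f (E (\<tau>, y)) + \<mu> * ln (warp_slope c k \<tau>)"
    if t: "t \<in> {\<alpha><..<\<beta>}" and y: "y \<in> \<Omega>" for t y
  proof (rule has_derivative_zero_unique[OF convex_real_interval(8) _ t \<tau>])
    fix t assume t: "t \<in> {\<alpha><..<\<beta>}"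
    then have p: "(t, y) \<in> ?B" using y by simp
    define \<sigma> where "\<sigma> = warp_slope c k t"
    define \<psi> where "\<psi> = c / 2 - k * warp_profile c k t"
    have \<sigma>: "\<sigma> > 0" using slope_pos'[OF t] by (simp add: \<sigma>_def)
    note d = dir_compose[OF E_diff[OF p] f_diff[OF ED[OF p]]]
    have "dir (\<lambda>p. f (E p)) (t, y) (1, 0) = 1 / \<sigma> * (- \<mu> * \<psi>)"
      unfolding d(1) E_t[OF p] X_eq[OF ED[OF p]] TE[OF p]
        linear_scale[OF linear_frechet_derivative[OF f_diff[OF ED[OF p]]]] dfW[OF ED[OF p]] wE[OF p]
      by (simp add: \<sigma>_def \<psi>_def)
    with has_real_derivative_first_coordinate[OF d(2)]
    have 1: "((\<lambda>t. f (E (t, y))) has_real_derivative 1 / \<sigma> * (- \<mu> * \<psi>)) (at t)"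
      by (simp only:)
    have "((\<lambda>t. f (E (t, y)) + \<mu> * ln (warp_slope c k t)) has_real_derivative
       1 / \<sigma> * (- \<mu> * \<psi>) + \<mu> * (1 / \<sigma> * \<psi>)) (at t)"
      using \<sigma> warp_slope_deriv[OF k, of c t]
      by (auto intro!: derivative_eq_intros 1 simp: \<sigma>_def \<psi>_def)
    then have "((\<lambda>t. f (E (t, y)) + \<mu> * ln (warp_slope c k t)) has_real_derivative 0) (at t)"
      by simp
    then show "((\<lambda>t. f (E (t, y)) + \<mu> * ln (warp_slope c k t)) has_derivative (\<lambda>h. 0)) (at t within {\<alpha><..<\<beta>})"
      by (simp add: has_field_derivative_def has_derivative_at_withinI lambda_zero)
  qed
  have EF_dir: "dir E (T z, Y z) (dir T z \<xi>, dir Y z \<xi>) = \<xi>" if z: "z \<in> V" for z \<xi>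
  proof -
    have "((\<lambda>z. (T z, Y z)) has_derivative (\<lambda>\<xi>. (dir T z \<xi>, dir Y z \<xi>))) (at z)"
      using z V by (intro has_derivative_Pair has_derivative_dir T_diff Y_diff) auto
    from has_derivative_compose[OF this has_derivative_dir[OF E_diff[OF FB[OF z]]]]
    have "((\<lambda>z. z) has_derivative (\<lambda>\<xi>. dir E (T z, Y z) (dir T z \<xi>, dir Y z \<xi>))) (at z)"
      by (rule has_derivative_transform_within_open[OF _ V(1) z]) (rule EF)
    from fun_cong[OF has_derivative_unique[OF this has_derivative_ident]] show ?thesis .
  qed
  \<comment> \<open>Shows that a transverse field with nonzero \<open>\<eta>\<close> does not
    vanish, which is needed for the definiteness of the transverse metric.\<close>
  have YA: "dir Y (E p) (A \<eta> p) = \<eta>" if p: "p \<in> ?B" for p \<eta>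
  proof -
    have "(snd has_derivative (\<lambda>v. dir Y (E p) (dir E p v))) (at p)"
      by (rule has_derivative_transform_within_open[OF has_derivative_compose[OF
          has_derivative_dir[OF E_diff[OF p]] has_derivative_dir[OF Y_diff[OF EV[OF p]]]] B p]) (rule YE)
    from fun_cong[OF has_derivative_unique[OF this bounded_linear_imp_has_derivative[OF bounded_linear_snd]], of "(0, \<eta>)"]
    show ?thesis by (simp add: A_def)
  qed
  define M where "M = (\<lambda>y. matrix (\<lambda>\<eta>. A \<eta> (\<tau>, y)))"
  have M: "M y *v \<eta> = A \<eta> (\<tau>, y)" if "y \<in> \<Omega>" for y \<eta>
    unfolding M_def using A_lin[of "(\<tau>, y)"] that \<tau>
    by (intro matrix_works) (simp add: linear_matrix_vector_mul_eq)
  \<comment> \<open>The metric induced on the slice \<open>t = \<tau>\<close>, divided by the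
    squared slope there: the constant of integration in \<open>Q_const\<close>.\<close>
  define g\<^sub>\<Sigma> where "g\<^sub>\<Sigma> = (\<lambda>y. (1 / (warp_slope c k \<tau>)\<^sup>2) *\<^sub>R (transpose (M y) ** h (E (\<tau>, y)) ** M y))"
  define f\<^sub>\<Sigma> where "f\<^sub>\<Sigma> = (\<lambda>y. f (E (\<tau>, y)) + \<mu> * ln (warp_slope c k \<tau>))"
  have g_form: "\<xi> \<bullet> (g\<^sub>\<Sigma> y *v \<eta>) = Q \<xi> \<eta> (\<tau>, y) / (warp_slope c k \<tau>)\<^sup>2" if y: "y \<in> \<Omega>" for \<xi> \<eta> y
  proof -
    have "\<xi> \<bullet> (g\<^sub>\<Sigma> y *v \<eta>) = 1 / (warp_slope c k \<tau>)\<^sup>2 * (\<xi> \<bullet> (transpose (M y) *v (h (E (\<tau>, y)) *v (M y *v \<eta>))))"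
      by (simp add: g\<^sub>\<Sigma>_def scaleR_matrix_vector_assoc[symmetric] matrix_vector_mul_assoc[symmetric] del: transpose_matrix_vector)
    also have "\<xi> \<bullet> (transpose (M y) *v v) = (M y *v \<xi>) \<bullet> v" for v
      by (metis dot_lmul_matrix vector_transpose_matrix)
    finally show ?thesis by (simp add: Q_def M[OF y])
  qed
  have slice: "Ck_on r \<Omega> (\<lambda>y. u (\<tau>, y))" if "Ck_on r ?B u" for r and u :: "real \<times> (real^'k) \<Rightarrow> 'b::real_normed_vector"
  proof (rule Ck_on_compose[OF V(4) that])
    show "Ck_on r \<Omega> (\<lambda>y. (\<tau>, y))"
      by (intro Ck_on_Pair V Ck_on_const Ck_on_bounded_linear bounded_linear_ident)
  qed (use \<tau> in auto)
  have g_metric: "metric_components \<Omega> g\<^sub>\<Sigma>"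
    unfolding metric_components_def smooth_on_def
  proof (intro conjI allI ballI impI)
    fix r
    have M_Ck: "Ck_on r \<Omega> (\<lambda>y. M y $ i $ j)" for i j
      unfolding M_def matrix_def using Ck_on_nth[OF V(4) slice[OF A_Ck]] by simp
    have hE_Ck: "Ck_on r \<Omega> (\<lambda>y. h (E (\<tau>, y)) $ i $ j)" for i j
      by (intro Ck_on_nth V slice[of r "\<lambda>p. h (E p)"] Ck_on_compose[OF B h_Ck E_Ck]) (use ED in blast)
    have "Ck_on r \<Omega> (\<lambda>y. \<chi> i j. 1 / (warp_slope c k \<tau>)\<^sup>2 *
        (\<Sum>b\<in>UNIV. (\<Sum>a\<in>UNIV. M y $ a $ i * h (E (\<tau>, y)) $ a $ b) * M y $ b $ j))"
      by (intro Ck_on_vec Ck_on_mult Ck_on_sum Ck_on_const V(4) M_Ck hE_Ck)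
    moreover have "g\<^sub>\<Sigma> = (\<lambda>y. \<chi> i j. 1 / (warp_slope c k \<tau>)\<^sup>2 *
        (\<Sum>b\<in>UNIV. (\<Sum>a\<in>UNIV. M y $ a $ i * h (E (\<tau>, y)) $ a $ b) * M y $ b $ j))"
      by (simp add: g\<^sub>\<Sigma>_def fun_eq_iff vec_eq_iff matrix_matrix_mult_def transpose_def)
    ultimately show "Ck_on r \<Omega> g\<^sub>\<Sigma>" by simp
  next
    fix y assume "y \<in> \<Omega>"
    then have p: "(\<tau>, y) \<in> ?B" using \<tau> by simp
    show "transpose (g\<^sub>\<Sigma> y) = g\<^sub>\<Sigma> y"
      by (simp add: g\<^sub>\<Sigma>_def transpose_scalar matrix_transpose_mul h_sym[OF ED[OF p]] matrix_mul_assoc)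
    fix \<xi> :: "real^'k" assume \<xi>: "\<xi> \<noteq> 0"
    have "dir Y (E (\<tau>, y)) 0 = 0"
      by (rule linear_0[OF linear_frechet_derivative[OF Y_diff[OF EV[OF p]]]])
    then have "A \<xi> (\<tau>, y) \<noteq> 0" using YA[OF p, of \<xi>] \<xi> by auto
    then have "Q \<xi> \<xi> (\<tau>, y) > 0" unfolding Q_def by (rule h_pos[OF ED[OF p]])
    then show "\<xi> \<bullet> (g\<^sub>\<Sigma> y *v \<xi>) > 0"
      using slope_pos'[OF \<tau>] by (simp add: g_form[OF \<open>y \<in> \<Omega>\<close>])
  qed
  show ?thesis
  proof (rule that[of V \<Omega> \<alpha> \<beta> T Y E g\<^sub>\<Sigma> f\<^sub>\<Sigma>])
    show "smooth_on V T"
      unfolding smooth_on_def using V by (auto intro!: Ck_on_subset[OF T])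
    show "T z = warp_time c k (w z)" for z by (simp add: T_def)
    show "w z = warp_profile c k (T z)" if "z \<in> V" for z using that V wT by auto
    show "dir T z v = dir w z v / warp_slope c k (T z)" if "z \<in> V" for z v using that V T_dir by blast
    have "Ck_on r \<Omega> (\<lambda>y. f (E (\<tau>, y)))" for r
      by (rule slice[of r "\<lambda>p. f (E p)"], rule Ck_on_compose[OF B f E_Ck]) (use ED in blast)
    then show "smooth_on \<Omega> f\<^sub>\<Sigma>"
      unfolding smooth_on_def f\<^sub>\<Sigma>_def by (auto intro!: Ck_on_add V Ck_on_const)
    show "f z = - \<mu> * ln (warp_slope c k (T z)) + f\<^sub>\<Sigma> (Y z)" if "z \<in> V" for z
      using f_const[of "T z" "Y z"] FB[OF that] EF[OF that] by (simp add: f\<^sub>\<Sigma>_def)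
    show "\<xi> \<bullet> (h z *v \<eta>) = dir T z \<xi> * dir T z \<eta> +
        (warp_slope c k (T z))\<^sup>2 * (dir Y z \<xi> \<bullet> (g\<^sub>\<Sigma> (Y z) *v dir Y z \<eta>))" if z: "z \<in> V" for z \<xi> \<eta>
    proof -
      let ?p = "(T z, Y z)"
      note p = FB[OF z]
      have zD: "z \<in> D" using z V by blast
      have lin: "linear (dir E ?p)" by (rule linear_frechet_derivative[OF E_diff[OF p]])
      \<comment> \<open>Every vector splits into a part along \<open>X\<close> and a part tangent to
        the slice; orthogonality of the two leaves only the diagonal blocks of the metric.\<close>
      have dec: "dir T z \<zeta> *\<^sub>R X z + A (dir Y z \<zeta>) ?p = \<zeta>" for \<zeta>
      proof -
        have "\<zeta> = dir E ?p (dir T z \<zeta> *\<^sub>R (1, 0) + (0, dir Y z \<zeta>))"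
          using EF_dir[OF z, of \<zeta>] by simp
        also have "\<dots> = dir T z \<zeta> *\<^sub>R X z + A (dir Y z \<zeta>) ?p"
          unfolding linear_add[OF lin] linear_scale[OF lin] E_t[OF p] EF[OF z] A_def ..
        finally show ?thesis ..
      qed
      have XA: "X z \<bullet> (h z *v A \<zeta> ?p) = 0" for \<zeta>
        using hX[OF zD] wA[OF p, of \<zeta>] EF[OF z] by simp
      have XX: "X z \<bullet> (h z *v X z) = 1"
        using hX[OF zD] wX[OF zD] slope_pos[OF zD] by simp
      have "\<xi> \<bullet> (h z *v \<eta>) = (dir T z \<xi> *\<^sub>R X z + A (dir Y z \<xi>) ?p) \<bullet> (h z *v (dir T z \<eta> *\<^sub>R X z + A (dir Y z \<eta>) ?p))"
        unfolding dec ..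
      also have "\<dots> = dir T z \<xi> * dir T z \<eta> + A (dir Y z \<xi>) ?p \<bullet> (h z *v A (dir Y z \<eta>) ?p)"
        using h_comm[OF zD, of "A (dir Y z \<xi>) ?p" "X z"]
        by (simp add: inner_add_left inner_add_right matrix_vector_right_distrib matrix_vector_mult_scaleR XA XX)
      also have "A (dir Y z \<xi>) ?p \<bullet> (h z *v A (dir Y z \<eta>) ?p) = Q (dir Y z \<xi>) (dir Y z \<eta>) ?p"
        by (simp add: Q_def EF[OF z])
      also have "\<dots> = (warp_slope c k (T z))\<^sup>2 * (dir Y z \<xi> \<bullet> (g\<^sub>\<Sigma> (Y z) *v dir Y z \<eta>))"
        using g_form[of "Y z"] Q_const[of "T z" "Y z"] p slope_pos[OF zD] by (simp add: field_simps)
      finally show ?thesis .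
    qed
  qed (fact V hom Y E g_metric)+
qed

section \<open>Gradient fields with pure-trace Hessian, computed in coordinates\<close>

lemma matrix_form_eq:
  fixes L :: "real^'n \<Rightarrow> real^'n" and B H :: "real^'n^'n"
  assumes "linear L" and "\<And>i j. B $ i $ j + (L (axis i 1) \<bullet> column j H) + (row i H \<bullet> L (axis j 1)) = r * H $ i $ j"
  shows "\<xi> \<bullet> (B *v \<eta>) + L \<xi> \<bullet> (H *v \<eta>) + \<xi> \<bullet> (H *v L \<eta>) = r * (\<xi> \<bullet> (H *v \<eta>))"
proof -
  define M where "M = matrix L"
  have M: "L v = M *v v" for v
    unfolding M_def using assms(1) by (intro matrix_works[symmetric]) (simp add: linear_matrix_vector_mul_eq)
  have "B + transpose M ** H + H ** M = r *\<^sub>R H"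
  proof -
    have "(transpose M ** H) $ i $ j = L (axis i 1) \<bullet> column j H" for i j
      by (simp add: M matrix_vector_mul_component matrix_matrix_mult_def transpose_def inner_vec_def column_def
          matrix_vector_mult_basis)
    moreover have "(H ** M) $ i $ j = row i H \<bullet> L (axis j 1)" for i j
      by (simp add: M matrix_matrix_mult_def inner_vec_def row_def column_def matrix_vector_mult_basis)
    ultimately show ?thesis using assms(2) by (simp add: vec_eq_iff)
  qed
  then have "\<xi> \<bullet> ((B + transpose M ** H + H ** M) *v \<eta>) = r * (\<xi> \<bullet> (H *v \<eta>))"
    by (simp add: scaleR_matrix_vector_assoc[symmetric])
  moreover have "\<xi> \<bullet> ((transpose M ** H) *v \<eta>) = (M *v \<xi>) \<bullet> (H *v \<eta>)"
    by (metis dot_lmul_matrix matrix_vector_mul_assoc vector_transpose_matrix)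
  ultimately show ?thesis
    by (simp add: M matrix_vector_mult_add_rdistrib inner_add_right matrix_vector_mul_assoc)
qed

lemma component_derivatives:
  fixes h :: "real^'n \<Rightarrow> real^'n^'n" and W :: "real^'n \<Rightarrow> real^'n"
  assumes "h differentiable (at z)" "W differentiable (at z)"
  shows "dir (\<lambda>z. h z $ i $ j) z v = dir h z v $ i $ j" "(\<lambda>z. h z $ i $ j) differentiable (at z)"
    and "dir (\<lambda>z. W z $ i) z v = dir W z v $ i" "(\<lambda>z. W z $ i) differentiable (at z)"
proof -
  have "((\<lambda>z. W z $ i) has_derivative (\<lambda>v. dir W z v $ i)) (at z)"
    by (intro bounded_linear.has_derivative[OF bounded_linear_vec_nth] has_derivative_dir assms)
  then show "dir (\<lambda>z. W z $ i) z v = dir W z v $ i" "(\<lambda>z. W z $ i) differentiable (at z)"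
    by (auto simp: dir_eq intro: differentiableI)
  have "((\<lambda>z. h z $ i $ j) has_derivative (\<lambda>v. dir h z v $ i $ j)) (at z)"
    by (intro bounded_linear.has_derivative[OF bounded_linear_vec_nth]
        bounded_linear.has_derivative[OF bounded_linear_vec_nth] has_derivative_dir assms)
  then show "dir (\<lambda>z. h z $ i $ j) z v = dir h z v $ i $ j" "(\<lambda>z. h z $ i $ j) differentiable (at z)"
    by (auto simp: dir_eq intro: differentiableI)
qed

lemma dir_axis_expansion:
  fixes F :: "real^'n::finite \<Rightarrow> real"
  assumes "F differentiable (at z)"
  shows "dir F z v = (\<Sum>i\<in>UNIV. v $ i * dir F z (axis i 1))"
proof -
  have lin: "linear (dir F z)" by (rule linear_frechet_derivative[OF assms])
  have "dir F z v = dir F z (\<Sum>i\<in>UNIV. v $ i *\<^sub>R axis i 1)"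
    using basis_expansion[of v] by (simp add: scalar_mult_eq_scaleR)
  also have "\<dots> = (\<Sum>i\<in>UNIV. v $ i * dir F z (axis i 1))"
    by (simp only: linear_sum[OF lin] linear_scale[OF lin] real_scaleR_def)
  finally show ?thesis .
qed

text \<open>The hypothesis \<open>hess\<close> is \<open>Hess w = \<psi> h\<close>, with the Christoffel symbols contracted against the gradient
  \<open>W\<close> of \<open>w\<close> so that the inverse metric does not occur.\<close>

lemma
  fixes h :: "real^'n::finite \<Rightarrow> real^'n^'n" and w :: "real^'n \<Rightarrow> real" and W :: "real^'n \<Rightarrow> real^'n"
  assumes D: "open D" "z \<in> D" and sym: "\<And>z. z \<in> D \<Longrightarrow> transpose (h z) = h z"
    and h: "h differentiable (at z)" and W: "W differentiable (at z)"
    and dw: "\<And>j. (\<lambda>z. dir w z (axis j 1)) differentiable (at z)" and w: "\<And>z. z \<in> D \<Longrightarrow> w differentiable (at z)"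
    and grad: "\<And>z j. z \<in> D \<Longrightarrow> (h z *v W z) $ j = dir w z (axis j 1)"
    and hess: "\<And>i j. dir (\<lambda>z. dir w z (axis j 1)) z (axis i 1) - 1/2 * (\<Sum>r\<in>UNIV. W z $ r *
        (dir (\<lambda>z. h z $ j $ r) z (axis i 1) + dir (\<lambda>z. h z $ i $ r) z (axis j 1) - dir (\<lambda>z. h z $ i $ j) z (axis r 1)))
        = \<psi> * h z $ i $ j"
  shows closed_conformal_field: "\<xi> \<bullet> (dir h z (W z) *v \<eta>) + dir W z \<xi> \<bullet> (h z *v \<eta>) + \<xi> \<bullet> (h z *v dir W z \<eta>)
      = 2 * \<psi> * (\<xi> \<bullet> (h z *v \<eta>))"
    and closed_conformal_norm: "((\<lambda>z. dir w z (W z)) has_derivative (\<lambda>v. 2 * \<psi> * dir w z v)) (at z)"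
proof -
  define H where "H = (\<lambda>r i j. dir h z (axis r 1) $ i $ j)"
  define DW where "DW = (\<lambda>i r. dir W z (axis i 1) $ r)"
  define w2 where "w2 = (\<lambda>i j. dir (\<lambda>z. dir w z (axis j 1)) z (axis i 1))"
  note comp = component_derivatives[OF h W]
  have h_sym: "h z $ i $ j = h z $ j $ i" if "z \<in> D" for z i j
    using sym[OF that] by (simp add: vec_eq_iff transpose_def)
  have H_sym: "H r i j = H r j i" for r i j
  proof -
    have "dir (\<lambda>z. h z $ i $ j) z = dir (\<lambda>z. h z $ j $ i) z"
      by (rule eq_on_open_derivative(3)[OF D]) (rule h_sym)
    then show ?thesis by (simp add: H_def comp(1)[symmetric])
  qed
  have hess': "w2 i j - 1/2 * (\<Sum>r\<in>UNIV. W z $ r * (H i j r + H j i r - H r i j)) = \<psi> * h z $ i $ j" for i j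
    using hess[of j i] by (simp add: w2_def H_def comp(1))
  \<comment> \<open>Differentiating \<open>h W = dw\<close> along the i-th coordinate trades the
    Jacobian \<open>DW\<close> for second derivatives of \<open>w\<close>.\<close>
  have dgrad: "(\<Sum>r\<in>UNIV. H i j r * W z $ r + h z $ j $ r * DW i r) = w2 i j" for i j
  proof -
    have "((\<lambda>z. \<Sum>r\<in>UNIV. h z $ j $ r * W z $ r) has_derivative
        (\<lambda>v. \<Sum>r\<in>UNIV. h z $ j $ r * dir (\<lambda>z. W z $ r) z v + dir (\<lambda>z. h z $ j $ r) z v * W z $ r)) (at z)"
      by (intro has_derivative_sum has_derivative_mult has_derivative_dir comp(2,4))
    moreover have "(\<Sum>r\<in>UNIV. h z $ j $ r * W z $ r) = dir w z (axis j 1)" if "z \<in> D" for z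
      using grad[OF that, of j] by (simp add: matrix_vector_mult_def)
    ultimately have "((\<lambda>z. dir w z (axis j 1)) has_derivative
        (\<lambda>v. \<Sum>r\<in>UNIV. h z $ j $ r * dir (\<lambda>z. W z $ r) z v + dir (\<lambda>z. h z $ j $ r) z v * W z $ r)) (at z)"
      by (rule iffD1[OF eq_on_open_derivative(1)[OF D], rotated])
    from dir_eq[OF this, of "axis i 1"] show ?thesis
      by (simp add: w2_def H_def DW_def comp(1,3) add.commute)
  qed
  have grad_z: "(\<Sum>r\<in>UNIV. h z $ j $ r * W z $ r) = dir w z (axis j 1)" for j
    using grad[OF D(2), of j] by (simp add: matrix_vector_mult_def)
  have hW: "dir h z (W z) $ i $ j = (\<Sum>r\<in>UNIV. W z $ r * H r i j)" for i j
    using dir_axis_expansion[OF comp(2), of i j "W z"] by (simp add: H_def comp(1))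
  show "\<xi> \<bullet> (dir h z (W z) *v \<eta>) + dir W z \<xi> \<bullet> (h z *v \<eta>) + \<xi> \<bullet> (h z *v dir W z \<eta>)
      = 2 * \<psi> * (\<xi> \<bullet> (h z *v \<eta>))"
  proof (rule matrix_form_eq)
    show "linear (dir W z)" by (rule linear_frechet_derivative[OF W])
    fix i j
    have 1: "dir W z (axis i 1) \<bullet> column j (h z) = w2 i j - (\<Sum>r\<in>UNIV. H i j r * W z $ r)"
      using dgrad[of i j] h_sym[OF D(2), of _ j]
      by (simp add: inner_vec_def column_def DW_def sum.distrib mult.commute)
    have 2: "row i (h z) \<bullet> dir W z (axis j 1) = w2 j i - (\<Sum>r\<in>UNIV. H j i r * W z $ r)"
      using dgrad[of j i] by (simp add: inner_vec_def row_def DW_def sum.distrib)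
    \<comment> \<open>Adding the Hessian equations for \<open>(i, j)\<close> and
      \<open>(j, i)\<close> makes the symmetry of second derivatives unnecessary to invoke.\<close>
    have 3: "w2 i j + w2 j i = 2 * \<psi> * h z $ i $ j + (\<Sum>r\<in>UNIV. W z $ r * (H i j r + H j i r - H r i j))"
      using hess'[of i j] hess'[of j i] h_sym[OF D(2), of j i] H_sym[of _ j i]
      by (simp add: add.commute)
    show "dir h z (W z) $ i $ j + dir W z (axis i 1) \<bullet> column j (h z) + row i (h z) \<bullet> dir W z (axis j 1)
        = 2 * \<psi> * h z $ i $ j"
      unfolding 1 2 hW using 3
      by (simp add: algebra_simps sum.distrib sum_subtractf)
  qed
  \<comment> \<open>The i-th derivative of the squared gradient norm, by the product rule. Below,
    \<open>dgrad\<close> eliminates \<open>DW\<close> and the Hessian equation eliminates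
    \<open>w2\<close>; the remaining derivatives of the metric cancel.\<close>
  define n' where "n' = (\<lambda>i. \<Sum>j\<in>UNIV. DW i j * dir w z (axis j 1) + W z $ j * w2 i j)"
  have n'_eq: "n' i = 2 * \<psi> * dir w z (axis i 1)" for i
  proof -
    have "(\<Sum>j\<in>UNIV. DW i j * dir w z (axis j 1)) = (\<Sum>j\<in>UNIV. \<Sum>r\<in>UNIV. W z $ r * (h z $ r $ j * DW i j))"
      unfolding grad_z[symmetric] sum_distrib_left
      using h_sym[OF D(2)] by (intro sum.cong refl) (simp add: mult_ac)
    also have "\<dots> = (\<Sum>r\<in>UNIV. W z $ r * (\<Sum>j\<in>UNIV. h z $ r $ j * DW i j))"
      by (subst sum.swap) (simp add: sum_distrib_left)
    also have "\<dots> = (\<Sum>r\<in>UNIV. W z $ r * (w2 i r - (\<Sum>j\<in>UNIV. H i r j * W z $ j)))"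
      using dgrad[of i] by (intro sum.cong refl arg_cong2[where f="(*)"]) (simp add: sum.distrib[symmetric] sum_subtractf[symmetric] algebra_simps)
    finally have 1: "(\<Sum>j\<in>UNIV. DW i j * dir w z (axis j 1)) =
        (\<Sum>r\<in>UNIV. W z $ r * w2 i r) - (\<Sum>r\<in>UNIV. \<Sum>j\<in>UNIV. W z $ r * W z $ j * H i r j)"
      by (simp add: sum_subtractf[symmetric] right_diff_distrib sum_distrib_left mult_ac)
    \<comment> \<open>After a double contraction with \<open>W\<close>, the second and third metric
      derivatives of the Christoffel symbol agree by relabelling and drop out.\<close>
    have "(\<Sum>j\<in>UNIV. \<Sum>r\<in>UNIV. W z $ j * W z $ r * H j i r) = (\<Sum>j\<in>UNIV. \<Sum>r\<in>UNIV. W z $ j * W z $ r * H r i j)"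
      by (subst sum.swap) (simp add: mult_ac)
    then have 2: "(\<Sum>j\<in>UNIV. W z $ j * (\<Sum>r\<in>UNIV. W z $ r * (H i j r + H j i r - H r i j))) =
        (\<Sum>r\<in>UNIV. \<Sum>j\<in>UNIV. W z $ r * W z $ j * H i r j)"
      by (simp add: sum_distrib_left sum.distrib sum_subtractf algebra_simps)
    have "(\<Sum>j\<in>UNIV. W z $ j * w2 i j) =
        (\<Sum>j\<in>UNIV. W z $ j * (\<psi> * h z $ i $ j + 1/2 * (\<Sum>r\<in>UNIV. W z $ r * (H i j r + H j i r - H r i j))))"
      using hess'[of i] by (intro sum.cong refl arg_cong2[where f="(*)"]) (simp add: algebra_simps)
    also have "\<dots> = \<psi> * (\<Sum>j\<in>UNIV. h z $ i $ j * W z $ j) +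
        1/2 * (\<Sum>j\<in>UNIV. W z $ j * (\<Sum>r\<in>UNIV. W z $ r * (H i j r + H j i r - H r i j)))"
      by (simp add: sum_distrib_left sum.distrib distrib_left mult_ac)
    finally have "(\<Sum>j\<in>UNIV. W z $ j * w2 i j) = \<psi> * dir w z (axis i 1) +
        1/2 * (\<Sum>r\<in>UNIV. \<Sum>j\<in>UNIV. W z $ r * W z $ j * H i r j)"
      unfolding grad_z 2 .
    then show ?thesis by (simp add: n'_def sum.distrib 1)
  qed
  define n where "n = (\<lambda>z. \<Sum>j\<in>UNIV. W z $ j * dir w z (axis j 1))"
  have n_der: "(n has_derivative (\<lambda>v. \<Sum>j\<in>UNIV. W z $ j * dir (\<lambda>z. dir w z (axis j 1)) z v +
      dir (\<lambda>z. W z $ j) z v * dir w z (axis j 1))) (at z)"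
    unfolding n_def by (intro has_derivative_sum has_derivative_mult has_derivative_dir comp(4) dw)
  have n_axis: "dir n z (axis i 1) = 2 * \<psi> * dir w z (axis i 1)" for i
    using n'_eq[of i] dir_eq[OF n_der, of "axis i 1"] by (simp add: n'_def w2_def DW_def comp(3) add.commute)
  have "dir n z v = 2 * \<psi> * dir w z v" for v
    unfolding dir_axis_expansion[OF differentiableI[OF n_der], of v] dir_axis_expansion[OF w[OF D(2)], of v]
    by (simp add: n_axis sum_distrib_left mult_ac)
  then have "(n has_derivative (\<lambda>v. 2 * \<psi> * dir w z v)) (at z)"
    using has_derivative_dir[OF differentiableI[OF n_der]] by presburger
  moreover have "n y = dir w y (W y)" if "y \<in> D" for y
    unfolding n_def by (rule dir_axis_expansion[OF w[OF that], symmetric])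
  ultimately show "((\<lambda>z. dir w z (W z)) has_derivative (\<lambda>v. 2 * \<psi> * dir w z v)) (at z)"
    by (rule iffD1[OF eq_on_open_derivative(1)[OF D], rotated])
qed

section \<open>Calculus in charts\<close>

locale riemannian_atlas =
  fixes A :: "('a::t2_space, 'n::finite) chart set" and g :: "('a, 'n) tensor2"
  assumes atlas: "smooth_atlas A" and metric: "riemannian_metric A g"
begin

lemma chart_at: "chart_at A x \<in> A" "x \<in> fst (chart_at A x)"
proof -
  have "x \<in> (\<Union>c\<in>A. fst c)" using atlas by (simp add: smooth_atlas_def)
  then have "\<exists>c. c \<in> A \<and> x \<in> fst c" by blast
  then have "chart_at A x \<in> A \<and> x \<in> fst (chart_at A x)"
    unfolding chart_at_def by (rule someI_ex)
  then show "chart_at A x \<in> A" "x \<in> fst (chart_at A x)" by auto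
qed

lemma chart_hom: "c \<in> A \<Longrightarrow> homeomorphism (fst c) (snd c ` fst c) (snd c) (chart_inv c)"
  using atlas by (auto simp: smooth_atlas_def is_chart_def)

lemma chart_open: "c \<in> A \<Longrightarrow> open (fst c)"
  using atlas by (auto simp: smooth_atlas_def is_chart_def)

lemma chart_inv_left [simp]: "c \<in> A \<Longrightarrow> x \<in> fst c \<Longrightarrow> chart_inv c (snd c x) = x"
  using chart_hom by (auto simp: homeomorphism_def)

lemma chart_image_open:
  assumes "c \<in> A" "open W"
  shows "open (snd c ` (fst c \<inter> W))"
proof -
  have "openin (top_of_set (snd c ` fst c)) (snd c ` (fst c \<inter> W))"
    by (rule homeomorphism_imp_open_map[OF chart_hom[OF assms(1)]]) (use assms in \<open>auto simp: openin_open\<close>)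
  moreover have "open (snd c ` fst c)"
    using atlas assms(1) by (auto simp: smooth_atlas_def is_chart_def)
  ultimately show ?thesis by (simp add: openin_open_eq)
qed

lemma transition_Ck:
  "c \<in> A \<Longrightarrow> d \<in> A \<Longrightarrow> Ck_on r (snd c ` (fst c \<inter> fst d)) (snd d \<circ> chart_inv c)"
  using atlas by (auto simp: smooth_atlas_def smooth_on_def)

lemma transition_differentiable:
  "c \<in> A \<Longrightarrow> d \<in> A \<Longrightarrow> x \<in> fst c \<inter> fst d \<Longrightarrow> (snd d \<circ> chart_inv c) differentiable (at (snd c x))"
  by (rule Ck_on_differentiable[OF transition_Ck]) auto

lemma chart_change:
  assumes c: "c \<in> A" and d: "d \<in> A" and x: "x \<in> fst c \<inter> fst d"
    and u: "(u \<circ> chart_inv d) differentiable (at (snd d x))"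
  shows "(u \<circ> chart_inv c) differentiable (at (snd c x))"
    and "dir (u \<circ> chart_inv c) (snd c x) v = dir (u \<circ> chart_inv d) (snd d x) (dir (snd d \<circ> chart_inv c) (snd c x) v)"
proof -
  let ?O = "snd c ` (fst c \<inter> fst d)"
  have O: "open ?O" "snd c x \<in> ?O"
    using chart_image_open[OF c chart_open[OF d]] x by auto
  have u': "(u \<circ> chart_inv d) differentiable (at ((snd d \<circ> chart_inv c) (snd c x)))"
    using u x c by simp
  note dc = dir_compose[OF transition_differentiable[OF c d x] u']
  have "(u \<circ> chart_inv c) z = (u \<circ> chart_inv d) ((snd d \<circ> chart_inv c) z)" if "z \<in> ?O" for z
    using that c d by auto
  note eq = eq_on_open_derivative[of ?O "snd c x" "u \<circ> chart_inv c" "\<lambda>z. (u \<circ> chart_inv d) ((snd d \<circ> chart_inv c) z)", OF O this]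
  show "(u \<circ> chart_inv c) differentiable (at (snd c x))"
    by (rule iffD2[OF eq(2) dc(2)])
  show "dir (u \<circ> chart_inv c) (snd c x) v = dir (u \<circ> chart_inv d) (snd d x) (dir (snd d \<circ> chart_inv c) (snd c x) v)"
  proof -
    note fun_cong[OF eq(3), of v]
    also note dc(1)[of v]
    also have "(snd d \<circ> chart_inv c) (snd c x) = snd d x" using x c by simp
    finally show ?thesis .
  qed
qed

lemma metric_smooth: "c \<in> A \<Longrightarrow> metric_components (snd c ` fst c) (g c \<circ> chart_inv c)"
  using metric by (simp add: riemannian_metric_def)

lemma metric_sym: "c \<in> A \<Longrightarrow> x \<in> fst c \<Longrightarrow> transpose (g c x) = g c x"
  using metric_smooth[of c] by (fastforce simp: metric_components_def)

lemma metric_pos: "c \<in> A \<Longrightarrow> x \<in> fst c \<Longrightarrow> \<xi> \<noteq> 0 \<Longrightarrow> \<xi> \<bullet> (g c x *v \<xi>) > 0"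
  using metric_smooth[of c] by (fastforce simp: metric_components_def)

lemma metric_invertible:
  assumes "c \<in> A" "x \<in> fst c"
  shows "invertible (g c x)"
proof -
  have "\<xi> = 0" if "g c x *v \<xi> = 0" for \<xi>
    using metric_pos[OF assms, of \<xi>] that by auto
  then show ?thesis
    using invertible_left_inverse matrix_left_invertible_ker by metis
qed

text \<open>The second identity is stated for the transpose because contracting Christoffel symbols
  with a differential sums over the row index of the inverse.\<close>

lemma metric_inverse:
  assumes "c \<in> A" "x \<in> fst c"
  shows "g c x ** matrix_inv (g c x) = mat 1" "transpose (matrix_inv (g c x)) ** g c x = mat 1"
proof -
  have "\<exists>B. g c x ** B = mat 1 \<and> B ** g c x = mat 1"
    using metric_invertible[OF assms] by (simp add: invertible_def)
  then have "g c x ** matrix_inv (g c x) = mat 1 \<and> matrix_inv (g c x) ** g c x = mat 1"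
    unfolding matrix_inv_def by (rule someI_ex)
  then show 1: "g c x ** matrix_inv (g c x) = mat 1" by blast
  have "transpose (g c x ** matrix_inv (g c x)) = mat 1" by (simp add: 1 transpose_mat)
  then show "transpose (matrix_inv (g c x)) ** g c x = mat 1"
    by (simp add: matrix_transpose_mul metric_sym[OF assms])
qed

lemma metric_grad:
  assumes "c \<in> A" "x \<in> fst c"
  shows "g c x *v grad g c u x = (\<chi> i. pd c i u x)"
  by (simp add: grad_def matrix_vector_mul_assoc metric_inverse[OF assms])

lemma dir_eq_inner_grad:
  assumes "c \<in> A" "x \<in> fst c" "(u \<circ> chart_inv c) differentiable (at (snd c x))"
  shows "dir (u \<circ> chart_inv c) (snd c x) v = v \<bullet> (g c x *v grad g c u x)"
  unfolding dir_axis_expansion[OF assms(3), of v] metric_grad[OF assms(1,2)]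
  by (simp add: inner_vec_def pd_def)

text \<open>Recasts the componentwise pullback condition as invariance of the bilinear form under
  the Jacobian \<open>J\<close>, the form in which chart independence is checked below.\<close>

lemma metric_chart_change:
  assumes c: "c \<in> A" and d: "d \<in> A" and x: "x \<in> fst c \<inter> fst d"
  defines "J \<equiv> dir (snd d \<circ> chart_inv c) (snd c x)"
  shows "\<xi> \<bullet> (g c x *v \<eta>) = J \<xi> \<bullet> (g d x *v J \<eta>)" and "linear J"
proof -
  note diff = transition_differentiable[OF c d x]
  show lin: "linear J" unfolding J_def by (rule linear_frechet_derivative[OF diff])
  have J_entry: "pd c i (\<lambda>y. snd d y $ a) x = J (axis i 1) $ a" for i a
  proof -
    have "((\<lambda>z. (snd d \<circ> chart_inv c) z $ a) has_derivative (\<lambda>v. J v $ a)) (at (snd c x))"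
      unfolding J_def by (intro bounded_linear.has_derivative[OF bounded_linear_vec_nth] has_derivative_dir diff)
    then show ?thesis by (simp add: pd_def o_def dir_eq)
  qed
  have g_entry: "g c x $ i $ j = (\<Sum>a\<in>UNIV. \<Sum>b\<in>UNIV. g d x $ a $ b * J (axis i 1) $ a * J (axis j 1) $ b)" for i j
  proof -
    have "g c x = pullback c (snd d) (g d x) x"
      using metric c d x unfolding riemannian_metric_def by blast
    then show ?thesis by (simp add: pullback_def J_entry)
  qed
  define P where "P = matrix J"
  have P: "J v = P *v v" for v
    unfolding P_def using lin by (intro matrix_works[symmetric]) (simp add: linear_matrix_vector_mul_eq)
  have "g c x = transpose P ** g d x ** P"
  proof -
    have "P $ a $ i = J (axis i 1) $ a" for a i by (simp add: P_def matrix_def)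
    then have "(transpose P ** g d x ** P) $ i $ j = (\<Sum>b\<in>UNIV. \<Sum>a\<in>UNIV. g d x $ a $ b * J (axis i 1) $ a * J (axis j 1) $ b)" for i j
      by (simp add: matrix_matrix_mult_def transpose_def sum_distrib_left mult_ac)
    then show ?thesis
      unfolding vec_eq_iff g_entry by (subst sum.swap) simp
  qed
  then have "\<xi> \<bullet> (g c x *v \<eta>) = \<xi> \<bullet> (transpose P *v (g d x *v (P *v \<eta>)))"
    by (simp add: matrix_vector_mul_assoc[symmetric] del: transpose_matrix_vector)
  also have "\<dots> = (P *v \<xi>) \<bullet> (g d x *v (P *v \<eta>))"
    by (metis dot_lmul_matrix vector_transpose_matrix)
  finally show "\<xi> \<bullet> (g c x *v \<eta>) = J \<xi> \<bullet> (g d x *v J \<eta>)" by (simp add: P)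
qed

text \<open>The gradient is determined by its pairing with all vectors. Definiteness makes
  \<open>J\<close> injective, hence surjective, so the difference \<open>e\<close> of the two
  candidates has a preimage and turns out to be orthogonal to itself.\<close>

lemma grad_chart_change:
  assumes c: "c \<in> A" and d: "d \<in> A" and x: "x \<in> fst c \<inter> fst d"
    and u: "(u \<circ> chart_inv d) differentiable (at (snd d x))"
  shows "grad g d u x = dir (snd d \<circ> chart_inv c) (snd c x) (grad g c u x)"
proof -
  define J where "J = dir (snd d \<circ> chart_inv c) (snd c x)"
  note mc = metric_chart_change[OF c d x, folded J_def]
  have xc: "x \<in> fst c" "x \<in> fst d" using x by auto
  have "J \<xi> = 0 \<Longrightarrow> \<xi> = 0" for \<xi>
    using mc(1)[of \<xi> \<xi>] metric_pos[OF c xc(1), of \<xi>] by auto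
  then have "inj J" using linear_injective_0[OF mc(2)] by blast
  then have "surj J" using linear_injective_imp_surjective[OF mc(2)] by simp
  define e where "e = grad g d u x - J (grad g c u x)"
  obtain \<xi> where \<xi>: "J \<xi> = e" using \<open>surj J\<close> by (metis surjD)
  have "J \<xi> \<bullet> (g d x *v grad g d u x) = dir (u \<circ> chart_inv d) (snd d x) (J \<xi>)"
    by (rule dir_eq_inner_grad[OF d xc(2) u, symmetric])
  also have "\<dots> = dir (u \<circ> chart_inv c) (snd c x) \<xi>"
    unfolding J_def by (rule chart_change(2)[OF c d x u, symmetric])
  also have "\<dots> = \<xi> \<bullet> (g c x *v grad g c u x)"
    by (rule dir_eq_inner_grad[OF c xc(1) chart_change(1)[OF c d x u]])
  also have "\<dots> = J \<xi> \<bullet> (g d x *v J (grad g c u x))" by (rule mc(1))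
  finally have "e \<bullet> (g d x *v e) = 0"
    unfolding \<xi> by (simp add: e_def matrix_vector_mult_diff_distrib inner_diff_right)
  then have "e = 0" using metric_pos[OF d xc(2), of e] by auto
  then show ?thesis by (simp add: e_def J_def)
qed

text \<open>Frees the inner product from the chart picked by \<open>chart_at\<close> and turns it
  into a directional derivative, the form used by the Euclidean theorem.\<close>

lemma grad_inner_chart:
  assumes c: "c \<in> A" and x: "x \<in> fst c"
    and u: "(u \<circ> chart_inv c) differentiable (at (snd c x))"
    and v: "(v \<circ> chart_inv c) differentiable (at (snd c x))"
  shows "grad_inner A g u v x = dir (v \<circ> chart_inv c) (snd c x) (grad g c u x)"
proof -
  let ?d = "chart_at A x"
  have xx: "x \<in> fst ?d \<inter> fst c" using x chart_at by auto
  note mc = metric_chart_change[OF chart_at(1) c xx]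
  have gc: "grad g c q x = dir (snd c \<circ> chart_inv ?d) (snd ?d x) (grad g ?d q x)"
    if "(q \<circ> chart_inv c) differentiable (at (snd c x))" for q
    by (rule grad_chart_change[OF chart_at(1) c xx that])
  have "grad_inner A g u v x = grad g ?d u x \<bullet> (g ?d x *v grad g ?d v x)"
    by (simp add: grad_inner_def Let_def)
  also have "\<dots> = grad g c u x \<bullet> (g c x *v grad g c v x)"
    unfolding mc(1) gc[OF u] gc[OF v] ..
  also have "\<dots> = dir (v \<circ> chart_inv c) (snd c x) (grad g c u x)"
    by (rule dir_eq_inner_grad[OF c x v, symmetric])
  finally show ?thesis .
qed

lemma grad_inner_commute: "grad_inner A g u v x = grad_inner A g v u x"
proof -
  have "\<xi> \<bullet> (g c x *v \<eta>) = \<eta> \<bullet> (g c x *v \<xi>)" if "c \<in> A" "x \<in> fst c" for c \<xi> \<eta>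
    by (metis dot_lmul_matrix metric_sym[OF that] inner_commute transpose_matrix_vector)
  then show ?thesis by (simp add: grad_inner_def Let_def chart_at)
qed

lemma grad_Ck:
  assumes c: "c \<in> A" and W: "open W" and u: "Ck_on (Suc r) (snd c ` (fst c \<inter> W)) (u \<circ> chart_inv c)"
  shows "Ck_on r (snd c ` (fst c \<inter> W)) (\<lambda>z. grad g c u (chart_inv c z))"
proof (rule Ck_on_linear_solve[where M="g c \<circ> chart_inv c" and b="\<lambda>z. \<chi> i. dir (u \<circ> chart_inv c) z (axis i 1)"])
  let ?D = "snd c ` (fst c \<inter> W)"
  show D: "open ?D" by (rule chart_image_open[OF c W])
  have "Ck_on r (snd c ` fst c) (g c \<circ> chart_inv c)"
    using metric_smooth[OF c] by (simp add: metric_components_def smooth_on_def)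
  then have "Ck_on r ?D (g c \<circ> chart_inv c)" by (rule Ck_on_subset) auto
  then show "Ck_on r ?D (\<lambda>z. (g c \<circ> chart_inv c) z $ i $ j)" for i j
    by (intro Ck_on_nth D)
  show "Ck_on r ?D (\<lambda>z. (\<chi> i. dir (u \<circ> chart_inv c) z (axis i 1)) $ i)" for i
    using Ck_on_dir[OF u] by simp
  show "det ((g c \<circ> chart_inv c) z) \<noteq> 0" if "z \<in> ?D" for z
    using metric_invertible[OF c] that c by (auto simp: invertible_det_nz)
  show "(g c \<circ> chart_inv c) z *v grad g c u (chart_inv c z) = (\<chi> i. dir (u \<circ> chart_inv c) z (axis i 1))"
    if "z \<in> ?D" for z
    using metric_grad[OF c] that c by (auto simp: pd_def)
qed

text \<open>The gradient of \<open>v\<close> is that of \<open>u\<close> multiplied by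
  \<open>\<Phi>'\<close> at \<open>u\<close>. The Christoffel term of the divergence is linear in
  the field and only carries this factor along; differentiating the factor produces the term with
  \<open>\<Phi>''\<close>.\<close>

lemma divergence_grad_compose:
  assumes c: "c \<in> A" and x: "x \<in> fst c \<inter> W" and W: "open W"
    and u: "Ck_on (Suc (Suc 0)) (snd c ` (fst c \<inter> W)) (u \<circ> chart_inv c)"
    and v: "\<And>y. y \<in> W \<Longrightarrow> v y = \<Phi> (u y)"
    and \<Phi>: "\<And>y. y \<in> W \<Longrightarrow> (\<Phi> has_real_derivative \<Phi>' (u y)) (at (u y))"
      "\<And>y. y \<in> W \<Longrightarrow> (\<Phi>' has_real_derivative \<Phi>'' (u y)) (at (u y))"
  shows "divergence g c (grad g c v) x = \<Phi>' (u x) * divergence g c (grad g c u) x +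
      \<Phi>'' (u x) * dir (u \<circ> chart_inv c) (snd c x) (grad g c u x)"
    and "grad g c v x = \<Phi>' (u x) *\<^sub>R grad g c u x"
    and "(v \<circ> chart_inv c) differentiable (at (snd c x))"
proof -
  let ?D = "snd c ` (fst c \<inter> W)"
  have D: "open ?D" by (rule chart_image_open[OF c W])
  define z where "z = snd c x"
  have z: "z \<in> ?D" using x by (simp add: z_def)
  have inv: "chart_inv c z \<in> W" "snd c (chart_inv c z) = z" "chart_inv c z \<in> fst c" if "z \<in> ?D" for z
    using that c by auto
  have u_diff: "(u \<circ> chart_inv c) differentiable (at z)" if "z \<in> ?D" for z
    by (rule Ck_on_differentiable[OF u that])
  have v_der: "((v \<circ> chart_inv c) has_derivative (\<lambda>h. \<Phi>' (u (chart_inv c z)) * dir (u \<circ> chart_inv c) z h)) (at z)"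
    if "z \<in> ?D" for z
  proof -
    have "(\<Phi> has_derivative (*) (\<Phi>' (u (chart_inv c z)))) (at ((u \<circ> chart_inv c) z))"
      using \<Phi>(1)[OF inv(1)[OF that]] by (simp add: has_field_derivative_def)
    from has_derivative_compose[OF has_derivative_dir[OF u_diff[OF that]] this]
    show ?thesis
      by (rule iffD2[OF eq_on_open_derivative(1)[OF D that], rotated]) (simp add: v inv)
  qed
  show "(v \<circ> chart_inv c) differentiable (at (snd c x))"
    using differentiableI[OF v_der[OF z]] by (simp add: z_def)
  have grad_v: "grad g c v y = \<Phi>' (u y) *\<^sub>R grad g c u y" if "y \<in> fst c \<inter> W" for y
  proof -
    have "pd c i v y = \<Phi>' (u y) * pd c i u y" for i
      using dir_eq[OF v_der, of "snd c y" "axis i 1"] that c by (simp add: pd_def)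
    then have "(\<chi> i. pd c i v y) = \<Phi>' (u y) *\<^sub>R (\<chi> i. pd c i u y)"
      by (simp add: vec_eq_iff)
    then show ?thesis by (simp add: grad_def matrix_vector_mult_scaleR)
  qed
  then show "grad g c v x = \<Phi>' (u x) *\<^sub>R grad g c u x" using x by blast
  define X where "X = grad g c u x"
  have pd_grad: "pd c i (\<lambda>y. grad g c v y $ i) x =
      \<Phi>' (u x) * pd c i (\<lambda>y. grad g c u y $ i) x + \<Phi>'' (u x) * dir (u \<circ> chart_inv c) z (axis i 1) * X $ i" for i
  proof -
    have gd: "(\<lambda>z. grad g c u (chart_inv c z)) differentiable (at z)"
      by (rule Ck_on_differentiable[OF grad_Ck[OF c W u] z])
    have 1: "((\<lambda>z. grad g c u (chart_inv c z) $ i) has_derivative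
        dir (\<lambda>z. grad g c u (chart_inv c z) $ i) z) (at z)"
      by (rule has_derivative_dir, rule differentiableI,
          rule bounded_linear.has_derivative[OF bounded_linear_vec_nth has_derivative_dir[OF gd]])
    have "(\<Phi>' has_derivative (*) (\<Phi>'' (u x))) (at ((u \<circ> chart_inv c) z))"
      using \<Phi>(2)[of x] x c by (simp add: has_field_derivative_def z_def)
    from has_derivative_compose[OF has_derivative_dir[OF u_diff[OF z]] this]
    have 2: "((\<lambda>z. \<Phi>' (u (chart_inv c z))) has_derivative (\<lambda>h. \<Phi>'' (u x) * dir (u \<circ> chart_inv c) z h)) (at z)"
      by simp
    have "((\<lambda>z. grad g c v (chart_inv c z) $ i) has_derivative
        (\<lambda>h. \<Phi>' (u (chart_inv c z)) * dir (\<lambda>z. grad g c u (chart_inv c z) $ i) z h +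
          \<Phi>'' (u x) * dir (u \<circ> chart_inv c) z h * grad g c u (chart_inv c z) $ i)) (at z)"
      by (rule iffD2[OF eq_on_open_derivative(1)[OF D z] has_derivative_mult[OF 2 1]])
         (simp add: grad_v inv)
    from dir_eq[OF this, of "axis i 1"] show ?thesis
      using x c by (simp add: pd_def o_def z_def X_def)
  qed
  have "dir (u \<circ> chart_inv c) z X = (\<Sum>i\<in>UNIV. X $ i * dir (u \<circ> chart_inv c) z (axis i 1))"
    by (rule dir_axis_expansion[OF u_diff[OF z]])
  then show "divergence g c (grad g c v) x = \<Phi>' (u x) * divergence g c (grad g c u) x +
      \<Phi>'' (u x) * dir (u \<circ> chart_inv c) (snd c x) (grad g c u x)"
    unfolding z_def[symmetric] X_def[symmetric] divergence_def pd_grad grad_v[OF x]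
    by (simp add: sum_distrib_left sum.distrib algebra_simps X_def)
qed

text \<open>Contracting the inverse metric inside the Christoffel symbols with the differential of
  \<open>u\<close> yields its gradient, which brings the Hessian into the shape required by
  \<open>closed_conformal_field\<close>.\<close>

lemma hess_in_chart:
  assumes c: "c \<in> A" and x: "x \<in> fst c"
  shows "hess g u c x $ i $ j = dir (\<lambda>z. dir (u \<circ> chart_inv c) z (axis j 1)) (snd c x) (axis i 1) -
      1/2 * (\<Sum>r\<in>UNIV. grad g c u x $ r *
        (dir (\<lambda>z. (g c \<circ> chart_inv c) z $ j $ r) (snd c x) (axis i 1) +
         dir (\<lambda>z. (g c \<circ> chart_inv c) z $ i $ r) (snd c x) (axis j 1) -
         dir (\<lambda>z. (g c \<circ> chart_inv c) z $ i $ j) (snd c x) (axis r 1)))"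
proof -
  define K where "K = (\<lambda>r. pd c i (\<lambda>y. g c y $ j $ r) x + pd c j (\<lambda>y. g c y $ i $ r) x - pd c r (\<lambda>y. g c y $ i $ j) x)"
  define B where "B = matrix_inv (g c x)"
  have chr: "christoffel g c l i j x = 1/2 * (\<Sum>r\<in>UNIV. B $ l $ r * K r)" for l
    by (simp add: christoffel_def K_def B_def)
  have D: "open (snd c ` fst c)" "snd c x \<in> snd c ` fst c"
    using chart_image_open[OF c open_UNIV] x by auto
  have "dir (pd c j u \<circ> chart_inv c) (snd c x) = dir (\<lambda>z. dir (u \<circ> chart_inv c) z (axis j 1)) (snd c x)"
    by (rule eq_on_open_derivative(3)[OF D]) (use c in \<open>auto simp: pd_def\<close>)
  then have 1: "pd c i (pd c j u) x = dir (\<lambda>z. dir (u \<circ> chart_inv c) z (axis j 1)) (snd c x) (axis i 1)"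
    by (simp add: pd_def[of c i])
  have "(transpose B ** g c x) *v grad g c u x = grad g c u x"
    unfolding B_def metric_inverse(2)[OF c x] by simp
  then have "transpose B *v (\<chi> i. pd c i u x) = grad g c u x"
    unfolding metric_grad[OF c x, symmetric] by (simp add: matrix_vector_mul_assoc del: transpose_matrix_vector)
  then have G: "(\<Sum>l\<in>UNIV. B $ l $ r * pd c l u x) = grad g c u x $ r" for r
    by (auto simp: vec_eq_iff matrix_vector_mult_def transpose_def simp del: transpose_matrix_vector)
  have "(\<Sum>l\<in>UNIV. christoffel g c l i j x * pd c l u x) = 1/2 * (\<Sum>l\<in>UNIV. \<Sum>r\<in>UNIV. K r * (B $ l $ r * pd c l u x))"
    by (simp add: chr sum_distrib_left sum_distrib_right mult_ac)
  also have "\<dots> = 1/2 * (\<Sum>r\<in>UNIV. K r * (\<Sum>l\<in>UNIV. B $ l $ r * pd c l u x))"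
    by (subst sum.swap) (simp add: sum_distrib_left)
  also have "\<dots> = 1/2 * (\<Sum>r\<in>UNIV. grad g c u x $ r * K r)"
    unfolding G by (simp add: mult.commute)
  finally show ?thesis
    by (simp add: hess_def 1 K_def) (simp add: pd_def o_def)
qed

end

section \<open>Rigidity off the pole of the Green function\<close>

theorem proposition5p2:
  fixes A :: "('a::t2_space, 'n::finite) chart set"
    and g :: "('a, 'n) tensor2"
    and f G s v \<psi> :: "'a \<Rightarrow> real"
    and m k \<kappa> :: real
    and p :: 'a
    and U :: "'a set"
  assumes dim: "CARD('n) \<ge> 3" "CARD('n) = CARD('k::finite) + 1"
    and closed_connected: "compact (UNIV :: 'a set)" "connected (UNIV :: 'a set)"
    and manifold: "smooth_atlas A" "riemannian_metric A g"
    and f: "smooth_fun A UNIV f"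
    and params: "m > real CARD('n)" "k > 0" "\<kappa> > 0"
    and ric_bound: "\<And>c x \<xi>. \<lbrakk>c \<in> A; x \<in> fst c\<rbrakk> \<Longrightarrow>
          \<xi> \<bullet> (bakry_emery_ricci g f m c x *v \<xi>) \<ge> (m - 1) * k * (\<xi> \<bullet> (g c x *v \<xi>))"
    and green: "green_function A g f (m * (m - 2) * k / 4) \<kappa> p G"
    and s_def: "s = green_s m G"
    and v_def: "v = green_v A g k s"
    and U: "open U" "connected U" "U \<subseteq> - {p}"
    and grad_s: "\<And>c x. \<lbrakk>c \<in> A; x \<in> U \<inter> fst c\<rbrakk> \<Longrightarrow> grad g c s x \<noteq> 0"
    and psi_def: "\<psi> = (\<lambda>x. laplacian A g (\<lambda>y. (s y)\<^sup>2) x / real CARD('n))"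
    and hess_s2: "\<And>c x. \<lbrakk>c \<in> A; x \<in> U \<inter> fst c\<rbrakk> \<Longrightarrow>
          hess g (\<lambda>y. (s y)\<^sup>2) c x = \<psi> x *\<^sub>R g c x"
    and grad_f_s2: "\<And>x. x \<in> U \<Longrightarrow>
          grad_inner A g f (\<lambda>y. (s y)\<^sup>2) x = - (m - real CARD('n)) * \<psi> x"
    and ric_s2: "\<And>c x. \<lbrakk>c \<in> A; x \<in> U \<inter> fst c\<rbrakk> \<Longrightarrow>
          grad g c (\<lambda>y. (s y)\<^sup>2) x \<bullet>
            ((bakry_emery_ricci g f m c x - ((m - 1) * k) *\<^sub>R g c x) *v grad g c (\<lambda>y. (s y)\<^sup>2) x) = 0"
  shows "\<exists>c>0. \<forall>q\<in>U.
    \<exists>(V :: 'a set) (T :: 'a \<Rightarrow> real) (Y :: 'a \<Rightarrow> real^'k) (\<alpha> :: real) (\<beta> :: real) (\<Omega> :: (real^'k) set)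
       (S :: real \<Rightarrow> real) (t\<^sub>0 :: real) (g\<^sub>\<Sigma> :: real^'k \<Rightarrow> real^'k^'k) (f\<^sub>\<Sigma> :: real^'k \<Rightarrow> real).
      q \<in> V \<and> V \<subseteq> U \<and>
      coordinates_on A V ({\<alpha><..<\<beta>} \<times> \<Omega>) (\<lambda>x. (T x, Y x)) \<and>
      (\<forall>x\<in>V. grad_inner A g T s x > 0) \<and>
      bij_betw Y {x \<in> V. s x = s q} \<Omega> \<and>
      metric_components \<Omega> g\<^sub>\<Sigma> \<and>
      smooth_on \<Omega> f\<^sub>\<Sigma> \<and>
      (\<forall>x\<in>V. (s x)\<^sup>2 = S (T x)) \<and>
      (\<forall>t\<in>{\<alpha><..<\<beta>}. S differentiable (at t) \<and> deriv S t > 0 \<and>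
         (deriv S t)\<^sup>2 = c * S t - k * (S t)\<^sup>2 \<and>
         S t = c / k * (sin (sqrt k * (t - t\<^sub>0) / 2))\<^sup>2) \<and>
      (\<forall>d\<in>A. \<forall>x\<in>V \<inter> fst d.
         g d x = (\<chi> i j. pd d i T x * pd d j T x)
                 + (deriv S (T x))\<^sup>2 *\<^sub>R pullback d Y (g\<^sub>\<Sigma> (Y x)) x) \<and>
      (\<forall>x\<in>V. f x = - (m - real CARD('n)) * ln \<bar>deriv S (T x)\<bar> + f\<^sub>\<Sigma> (Y x)) \<and>
      (\<forall>x\<in>V. (v x)\<^sup>2 = c)"
proof -
  interpret riemannian_atlas A g
    using manifold by unfold_locales

  \<comment> \<open>Positivity and regularity of \<open>s\<close> and of \<open>w\<close>, its
    square\<close>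
  define N where "N = real CARD('n)"
  have N: "N \<ge> 3" using dim by (simp add: N_def)
  have m: "m > N" using params by (simp add: N_def)
  define w where "w = (\<lambda>y. (s y)\<^sup>2)"
  note hess_w = hess_s2[folded w_def] and grad_f_w = grad_f_s2[folded w_def N_def] and psi_w = psi_def[folded w_def N_def]
  have G_pos: "G x > 0" if "x \<noteq> p" for x
    using green that by (simp add: green_function_def)
  have G_eq: "weighted_laplacian A g f G x = m * (m - 2) * k / 4 * G x" if "x \<noteq> p" for x
    using green that by (simp add: green_function_def)
  have s_pos: "s x > 0" if "x \<noteq> p" for x
    using G_pos[OF that] by (simp add: s_def green_s_def)
  have w_pos: "w x > 0" if "x \<noteq> p" for x
    using s_pos[OF that] by (simp add: w_def)
  have Up: "x \<noteq> p" if "x \<in> U" for x using that U by blast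
  have open_p: "open (- {p})" by (intro open_Compl closed_singleton)
  have s_Ck: "Ck_on r (snd c ` (fst c \<inter> - {p})) (s \<circ> chart_inv c)" if c: "c \<in> A" for r c
  proof -
    let ?D = "snd c ` (fst c \<inter> - {p})"
    have D: "open ?D" by (rule chart_image_open[OF c open_p])
    have GC: "Ck_on r ?D (G \<circ> chart_inv c)"
      using green c by (auto simp: green_function_def smooth_fun_def smooth_on_def)
    have "Ck_on r ?D (\<lambda>z. 1 / 2 * ((G \<circ> chart_inv c) z powr (1 / (2 - m))))"
      using c by (intro Ck_on_mult[OF D] Ck_on_const Ck_on_compose[OF D Ck_on_powr GC]) (auto intro!: G_pos)
    then show ?thesis by (simp add: s_def green_s_def o_def)
  qed
  have w_Ck': "Ck_on r (snd c ` (fst c \<inter> - {p})) (w \<circ> chart_inv c)" if c: "c \<in> A" for r c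
  proof -
    have "Ck_on r (snd c ` (fst c \<inter> - {p})) (\<lambda>z. (s \<circ> chart_inv c) z * (s \<circ> chart_inv c) z)"
      by (intro Ck_on_mult chart_image_open[OF c open_p] s_Ck c)
    then show ?thesis by (simp add: w_def o_def power2_eq_square)
  qed
  let ?D = "\<lambda>c::('a, 'n) chart. snd c ` (fst c \<inter> U)"
  have D: "open (?D c)" if "c \<in> A" for c by (rule chart_image_open[OF that U(1)])
  have w_Ck: "Ck_on r (?D c) (w \<circ> chart_inv c)" if "c \<in> A" for r c
    by (rule Ck_on_subset[OF w_Ck'[OF that]]) (use U in auto)
  have f_Ck: "Ck_on r (?D c) (f \<circ> chart_inv c)" if "c \<in> A" for r c
  proof (rule Ck_on_subset)
    show "Ck_on r (snd c ` (fst c \<inter> UNIV)) (f \<circ> chart_inv c)"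
      using f that by (auto simp: smooth_fun_def smooth_on_def)
  qed auto
  have w_diff: "(w \<circ> chart_inv c) differentiable (at (snd c x))" and f_diff: "(f \<circ> chart_inv c) differentiable (at (snd c x))"
    if "c \<in> A" "x \<in> fst c \<inter> U" for c x
    using Ck_on_differentiable[OF w_Ck[OF that(1)]] Ck_on_differentiable[OF f_Ck[OF that(1)]] that(2) by auto
  have grad_w: "grad g c w x = (2 * s x) *\<^sub>R grad g c s x" if "c \<in> A" "x \<in> fst c \<inter> U" for c x
  proof -
    have "x \<in> fst c \<inter> - {p}" using that U by auto
    moreover have "w y = (s y)\<^sup>2" for y by (simp add: w_def)
    moreover have "((\<lambda>t. t\<^sup>2) has_real_derivative 2 * s y) (at (s y))" for y
      by (auto intro!: derivative_eq_intros)
    moreover have "((\<lambda>t. 2 * t) has_real_derivative 2) (at (s y))" for y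
      by (auto intro!: derivative_eq_intros)
    ultimately show ?thesis
      using divergence_grad_compose(2)[OF that(1) _ open_p s_Ck[OF that(1)],
          of x w "\<lambda>t. t\<^sup>2" "\<lambda>t. 2 * t" "\<lambda>_. 2"] by blast
  qed
  have grad_w_nz: "grad g c w x \<noteq> 0" if "c \<in> A" "x \<in> fst c \<inter> U" for c x
    using grad_w[OF that] grad_s[of c x] s_pos[OF Up, of x] that by auto

  \<comment> \<open>The squared gradient of \<open>w\<close> from the Green equation\<close>
  define n where "n = (\<lambda>x. grad_inner A g w w x)"
  have n_chart: "n x = dir (w \<circ> chart_inv c) (snd c x) (grad g c w x)" if "c \<in> A" "x \<in> fst c \<inter> U" for c x
    unfolding n_def using that by (intro grad_inner_chart w_diff) auto
  have n_eq: "n x = k * (w x)\<^sup>2 + 2 * \<psi> x * w x" if x: "x \<in> U" for x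
  proof -
    define c where "c = chart_at A x"
    have c: "c \<in> A" "x \<in> fst c" using chart_at by (auto simp: c_def)
    \<comment> \<open>The exponent in \<open>G = (4 * w) powr a\<close>, which follows from
      \<open>G = (2 * s) powr (2 - m)\<close> and \<open>(2 * s)\<^sup>2 = 4 * w\<close>.\<close>
    define a where "a = (2 - m) / 2"
    define Q where "Q = G x"
    have Q: "Q > 0" using G_pos[OF Up[OF x]] by (simp add: Q_def)
    have wx: "w x > 0" by (rule w_pos[OF Up[OF x]])
    have G_w: "G y = (4 * w y) powr a" if "y \<in> - {p}" for y
    proof -
      have "4 * w y = (G y powr (1 / (2 - m)))\<^sup>2"
        by (simp add: w_def s_def green_s_def power_mult_distrib power_divide)
      also have "\<dots> = G y powr (2 / (2 - m))"
        using G_pos[of y] that by (simp add: powr_power)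
      finally have "(4 * w y) powr a = G y powr (2 / (2 - m) * a)"
        by (simp only: powr_powr)
      moreover have "2 / (2 - m) * a = 1" using m N by (simp add: a_def)
      ultimately show ?thesis
        using G_pos[of y] that by simp
    qed
    define \<Phi>' where "\<Phi>' = (\<lambda>t. 4 * a * (4 * t) powr (a - 1))"
    define \<Phi>'' where "\<Phi>'' = (\<lambda>t. 16 * a * (a - 1) * (4 * t) powr (a - 2))"
    have d1: "((\<lambda>t. (4 * t) powr a) has_real_derivative \<Phi>' (w y)) (at (w y))" if "y \<in> - {p}" for y
      using w_pos[of y] that by (auto simp: \<Phi>'_def intro!: derivative_eq_intros)
    have d2: "(\<Phi>' has_real_derivative \<Phi>'' (w y)) (at (w y))" if "y \<in> - {p}" for y
      unfolding \<Phi>'_def \<Phi>''_def using w_pos[of y] that by (auto intro!: derivative_eq_intros)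
    have xp: "x \<in> fst c \<inter> - {p}" using c Up[OF x] by auto
    note comp = divergence_grad_compose[OF c(1) xp open_p w_Ck'[OF c(1)] G_w d1 d2]
    have "laplacian A g G x = \<Phi>' (w x) * laplacian A g w x + \<Phi>'' (w x) * n x"
      using comp(1) n_chart[of c x] c x by (simp add: laplacian_def Let_def c_def)
    moreover have "grad_inner A g f G x = \<Phi>' (w x) * grad_inner A g f w x"
      using comp(2) by (simp add: grad_inner_def Let_def c_def matrix_vector_mult_scaleR)
    moreover have "laplacian A g w x = N * \<psi> x"
      using N by (simp add: psi_w)
    ultimately have "\<Phi>' (w x) * (N * \<psi> x) + \<Phi>'' (w x) * n x - \<Phi>' (w x) * (- (m - N) * \<psi> x) = m * (m - 2) * k / 4 * Q"
      using G_eq[OF Up[OF x]] grad_f_w[OF x] by (simp add: weighted_laplacian_def Q_def)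
    moreover have "\<Phi>' (w x) = a * Q / w x" "\<Phi>'' (w x) = a * (a - 1) * Q / (w x)\<^sup>2"
      using G_w[of x] Up[OF x] wx
      by (simp_all add: \<Phi>'_def \<Phi>''_def Q_def powr_diff power2_eq_square field_simps)
    \<comment> \<open>The trace \<open>N * \<psi>\<close> of the Hessian and the drift term
      \<open>(m - N) * \<psi>\<close> add up to \<open>m * \<psi>\<close>, so the dimension
      disappears.\<close>
    ultimately have "a * Q / w x * (m * \<psi> x) + a * (a - 1) * Q / (w x)\<^sup>2 * n x = m * (m - 2) * k / 4 * Q"
      by (simp add: algebra_simps)
    then have "Q * (a * m * \<psi> x * w x + a * (a - 1) * n x) = Q * (m * (m - 2) * k / 4 * (w x)\<^sup>2)"
      using wx by (simp add: field_simps power2_eq_square)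
    then have "a * m * \<psi> x * w x + a * (a - 1) * n x = m * (m - 2) * k / 4 * (w x)\<^sup>2"
      using Q by simp
    then have "m * (m - 2) / 4 * n x = m * (m - 2) / 4 * (k * (w x)\<^sup>2 + 2 * \<psi> x * w x)"
      by (simp add: a_def field_simps)
    moreover have "m * (m - 2) / 4 \<noteq> 0" using m N by simp
    ultimately show ?thesis by (simp only: mult_cancel_left) blast
  qed

  \<comment> \<open>The conformal gradient field in charts and the constancy of the square of
    \<open>v\<close>\<close>
  define W where "W = (\<lambda>c z. grad g c w (chart_inv c z))"
  have W_Ck: "Ck_on r (?D c) (W c)" if "c \<in> A" for r c
    unfolding W_def by (rule grad_Ck[OF that U(1) w_Ck[OF that]])
  have inv_in: "chart_inv c z \<in> fst c \<inter> U" "snd c (chart_inv c z) = z" if "c \<in> A" "z \<in> ?D c" for c z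
    using that by auto
  have h_metric: "metric_components (?D c) (g c \<circ> chart_inv c)" if "c \<in> A" for c
    using metric_smooth[OF that] unfolding metric_components_def smooth_on_def by (blast intro: Ck_on_subset)
  have conf: "\<xi> \<bullet> (dir (g c \<circ> chart_inv c) z (W c z) *v \<eta>) + dir (W c) z \<xi> \<bullet> ((g c \<circ> chart_inv c) z *v \<eta>) +
        \<xi> \<bullet> ((g c \<circ> chart_inv c) z *v dir (W c) z \<eta>) = 2 * \<psi> (chart_inv c z) * (\<xi> \<bullet> ((g c \<circ> chart_inv c) z *v \<eta>))"
    and norm_der: "((\<lambda>z. dir (w \<circ> chart_inv c) z (W c z)) has_derivative
        (\<lambda>v. 2 * \<psi> (chart_inv c z) * dir (w \<circ> chart_inv c) z v)) (at z)"
    if c: "c \<in> A" and z: "z \<in> ?D c" for c z \<xi> \<eta>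
  proof -
    note cc = closed_conformal_field[OF D[OF c] z] closed_conformal_norm[OF D[OF c] z]
    have sym: "transpose ((g c \<circ> chart_inv c) z) = (g c \<circ> chart_inv c) z" if "z \<in> ?D c" for z
      using h_metric[OF c] that by (simp only: metric_components_def)
    have h_Ck: "Ck_on r (?D c) (g c \<circ> chart_inv c)" for r
      using h_metric[OF c] by (simp add: metric_components_def smooth_on_def)
    have gr: "((g c \<circ> chart_inv c) z *v W c z) $ j = dir (w \<circ> chart_inv c) z (axis j 1)" if "z \<in> ?D c" for z j
      using metric_grad[OF c, of "chart_inv c z" w] inv_in[OF c that] by (simp add: W_def pd_def)
    have he: "dir (\<lambda>z. dir (w \<circ> chart_inv c) z (axis j 1)) z (axis i 1) - 1/2 * (\<Sum>r\<in>UNIV. W c z $ r *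
        (dir (\<lambda>z. (g c \<circ> chart_inv c) z $ j $ r) z (axis i 1) + dir (\<lambda>z. (g c \<circ> chart_inv c) z $ i $ r) z (axis j 1)
          - dir (\<lambda>z. (g c \<circ> chart_inv c) z $ i $ j) z (axis r 1)))
        = \<psi> (chart_inv c z) * (g c \<circ> chart_inv c) z $ i $ j" for i j
      using hess_in_chart[OF c, of "chart_inv c z" w i j] hess_w[OF c, of "chart_inv c z"] inv_in[OF c z]
      by (simp add: W_def)
    note facts = sym Ck_on_differentiable[OF h_Ck z] Ck_on_differentiable[OF W_Ck[OF c] z]
      Ck_on_differentiable[OF Ck_on_dir[OF w_Ck[OF c]] z] Ck_on_differentiable[OF w_Ck[OF c]] gr he
    show "\<xi> \<bullet> (dir (g c \<circ> chart_inv c) z (W c z) *v \<eta>) + dir (W c) z \<xi> \<bullet> ((g c \<circ> chart_inv c) z *v \<eta>) +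
        \<xi> \<bullet> ((g c \<circ> chart_inv c) z *v dir (W c) z \<eta>) = 2 * \<psi> (chart_inv c z) * (\<xi> \<bullet> ((g c \<circ> chart_inv c) z *v \<eta>))"
      by (rule cc(1)[OF facts])
    show "((\<lambda>z. dir (w \<circ> chart_inv c) z (W c z)) has_derivative
        (\<lambda>v. 2 * \<psi> (chart_inv c z) * dir (w \<circ> chart_inv c) z v)) (at z)"
      by (rule cc(2)[OF facts])
  qed
  \<comment> \<open>Positivity of the squared gradient of \<open>s\<close> removes the square root
    in \<open>green_v\<close>; then \<open>grad w = 2 s grad s\<close> turns four times that
    quantity into \<open>n / w\<close>.\<close>
  have v_sq: "(v x)\<^sup>2 = n x / w x + k * w x" if x: "x \<in> U" for x
  proof -
    define c where "c = chart_at A x"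
    have c: "c \<in> A" "x \<in> fst c" using chart_at by (auto simp: c_def)
    have gs: "grad_inner A g s s x = grad g c s x \<bullet> (g c x *v grad g c s x)"
      by (simp add: grad_inner_def c_def Let_def)
    have "grad_inner A g s s x > 0"
      unfolding gs using grad_s[OF c(1)] c x by (intro metric_pos) auto
    then have "(v x)\<^sup>2 = 4 * grad_inner A g s s x + k * w x"
      using params by (simp add: v_def green_v_def w_def)
    moreover have "n x = 4 * w x * grad_inner A g s s x"
      unfolding n_def gs using grad_w[OF c(1), of x] c x
      by (simp add: grad_inner_def Let_def c_def[symmetric] matrix_vector_mult_scaleR w_def power2_eq_square)
    ultimately show ?thesis using w_pos[OF Up[OF x]] by simp
  qed
  \<comment> \<open>Connectedness of \<open>U\<close> reduces the claim to local constancy, which a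
    vanishing derivative on a ball in a chart provides.\<close>
  have v_const: "(v x)\<^sup>2 = (v y)\<^sup>2" if "x \<in> U" "y \<in> U" for x y
  proof (rule connected_local_const[OF U(2) that], intro ballI)
    fix x assume x: "x \<in> U"
    define c where "c = chart_at A x"
    have c: "c \<in> A" "x \<in> fst c" using chart_at by (auto simp: c_def)
    define q where "q = (\<lambda>z. dir (w \<circ> chart_inv c) z (W c z) / (w \<circ> chart_inv c) z + k * (w \<circ> chart_inv c) z)"
    have q_v: "q z = (v (chart_inv c z))\<^sup>2" if "z \<in> ?D c" for z
      using v_sq[of "chart_inv c z"] n_chart[OF c(1), of "chart_inv c z"] inv_in[OF c(1) that] by (simp add: q_def W_def)
    have q_der: "(q has_derivative (\<lambda>v. 0)) (at z)" if z: "z \<in> ?D c" for z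
    proof -
      let ?w = "w (chart_inv c z)" and ?n = "n (chart_inv c z)" and ?\<psi> = "\<psi> (chart_inv c z)"
      have y: "chart_inv c z \<in> U" "chart_inv c z \<in> fst c \<inter> U" using inv_in[OF c(1) z] by auto
      have wz: "?w > 0" by (rule w_pos[OF Up[OF y(1)]])
      have nz: "dir (w \<circ> chart_inv c) z (W c z) = ?n"
        using n_chart[OF c(1) y(2)] inv_in[OF c(1) z] by (simp add: W_def)
      have dw: "((w \<circ> chart_inv c) has_derivative dir (w \<circ> chart_inv c) z) (at z)"
        by (rule has_derivative_dir[OF Ck_on_differentiable[OF w_Ck[OF c(1)] z]])
      have "(q has_derivative (\<lambda>v. - ?n * (inverse ?w * dir (w \<circ> chart_inv c) z v * inverse ?w) +
          2 * ?\<psi> * dir (w \<circ> chart_inv c) z v / ?w + k * dir (w \<circ> chart_inv c) z v)) (at z)"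
        unfolding q_def
        using has_derivative_add[OF has_derivative_divide[OF norm_der[OF c(1) z] dw] has_derivative_mult_right[OF dw, of k]] wz nz
        by simp
      \<comment> \<open>By \<open>n_eq\<close> the quotient \<open>n / w\<close> equals
        \<open>k * w + 2 * \<psi>\<close>, so the three terms cancel.\<close>
      moreover have "- ?n * (inverse ?w * d * inverse ?w) + 2 * ?\<psi> * d / ?w + k * d = 0" for d
        using n_eq[OF y(1)] wz by (simp add: field_simps power2_eq_square)
      ultimately show ?thesis by simp
    qed
    have "snd c x \<in> ?D c" using c x by auto
    then obtain e where e: "e > 0" "ball (snd c x) e \<subseteq> ?D c"
      using D[OF c(1)] openE by blast
    define O' where "O' = (fst c \<inter> U) \<inter> snd c -` ball (snd c x) e"
    have "open O'"
      unfolding O'_def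
    proof (rule continuous_open_preimage)
      show "continuous_on (fst c \<inter> U) (snd c)"
        using chart_hom[OF c(1)] by (auto simp: homeomorphism_def intro: continuous_on_subset)
    qed (use chart_open[OF c(1)] U in auto)
    moreover have "x \<in> O'" using c x e by (simp add: O'_def)
    moreover have "(v x)\<^sup>2 = (v y)\<^sup>2" if "y \<in> O'" for y
    proof -
      have y: "y \<in> fst c" "y \<in> U" "snd c y \<in> ball (snd c x) e" using that by (auto simp: O'_def)
      have "q (snd c x) = q (snd c y)"
      proof (rule has_derivative_zero_unique[OF convex_ball _ _ y(3)])
        fix z assume "z \<in> ball (snd c x) e"
        then have "z \<in> ?D c" using e by blast
        then show "(q has_derivative (\<lambda>v. 0)) (at z within ball (snd c x) e)"
          by (rule has_derivative_at_withinI[OF q_der])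
      qed (use e in simp)
      then show ?thesis using q_v[of "snd c x"] q_v[of "snd c y"] c x y by auto
    qed
    ultimately show "\<forall>\<^sub>F y in at x within U. (v x)\<^sup>2 = (v y)\<^sup>2"
      unfolding eventually_at_topological by blast
  qed
  show ?thesis
  proof (cases "U = {}")
    case True
    \<comment> \<open>For empty \<open>U\<close> any positive constant serves.\<close>
    then show ?thesis by (intro exI[of _ 1]) simp
  next
    case False
    then obtain x0 where x0: "x0 \<in> U" by blast

    \<comment> \<open>The constant \<open>c\<close> and the profile\<close>
    define C where "C = (v x0)\<^sup>2"
    have C: "(v x)\<^sup>2 = C" if "x \<in> U" for x
      unfolding C_def by (rule v_const[OF that x0])
    have psi_C: "\<psi> x = C / 2 - k * w x" and n_C: "n x = C * w x - k * (w x)\<^sup>2" if "x \<in> U" for x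
    proof -
      have "C = n x / w x + k * w x" using v_sq[OF that] C[OF that] by simp
      then show "n x = C * w x - k * (w x)\<^sup>2"
        using w_pos[OF Up[OF that]] by (simp add: field_simps power2_eq_square)
      then have "2 * (\<psi> x * w x) = (C - 2 * (k * w x)) * w x"
        using n_eq[OF that] by (simp add: algebra_simps power2_eq_square)
      then have "(2 * \<psi> x) * w x = (C - 2 * (k * w x)) * w x" by (simp add: mult.assoc)
      then have "2 * \<psi> x = C - 2 * (k * w x)"
        using w_pos[OF Up[OF that]] by simp
      then show "\<psi> x = C / 2 - k * w x" by simp
    qed
    \<comment> \<open>The gradient of \<open>w\<close> does not vanish at \<open>x0\<close>, so
      \<open>n x0\<close> is positive and both summands in \<open>v_sq\<close> are.\<close>
    have C_pos: "C > 0"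
    proof -
      define c where "c = chart_at A x0"
      have c: "c \<in> A" "x0 \<in> fst c" using chart_at by (auto simp: c_def)
      have "n x0 > 0"
        unfolding n_def grad_inner_def Let_def c_def[symmetric]
        using grad_w_nz[OF c(1)] c x0 by (intro metric_pos) auto
      then show ?thesis
        using v_sq[OF x0] C[OF x0] w_pos[OF Up[OF x0]] params by (simp add: add_pos_pos)
    qed
    have slope_d: "((\<lambda>t. C / k * (sin (sqrt k * (t - 0) / 2))\<^sup>2) has_real_derivative warp_slope C k t) (at t)" for t
      using warp_profile_deriv[OF params(2), of C t] by (simp add: warp_profile_def[abs_def])
    \<comment> \<open>The time origin is zero, kept as \<open>t - 0\<close> so that the formula
      matches the existential statement literally.\<close>
    define S where "S = (\<lambda>t. C / k * (sin (sqrt k * (t - 0) / 2))\<^sup>2)"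
    have S: "S t = warp_profile C k t" for t by (simp add: S_def warp_profile_def)
    have S': "deriv S t = warp_slope C k t" "S differentiable (at t)" for t
      using slope_d[of t] by (auto simp: S_def DERIV_imp_deriv real_differentiable_def)
    show ?thesis
    \<comment> \<open>The constant is chosen before the point \<open>q\<close>, being common to all
      of \<open>U\<close>; the remaining data are local.\<close>
    proof (rule exI[of _ C], rule conjI[OF C_pos], rule ballI)

      \<comment> \<open>The normal form near a point, in one chart\<close>
      fix q assume q: "q \<in> U"
      define c where "c = chart_at A q"
      have c: "c \<in> A" "q \<in> fst c" using chart_at by (auto simp: c_def)
      have z0: "snd c q \<in> ?D c" using c q by auto
      note inv = inv_in[OF c(1)]
      have dir_w: "dir (w \<circ> chart_inv c) z v = v \<bullet> ((g c \<circ> chart_inv c) z *v W c z)" if "z \<in> ?D c" for z v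
        using dir_eq_inner_grad[OF c(1), of "chart_inv c z" w v] w_diff[OF c(1) inv(1)[OF that]] inv[OF that]
        by (simp add: W_def)
      have dir_f: "dir (f \<circ> chart_inv c) z (W c z) = - (m - N) * (C / 2 - k * (w \<circ> chart_inv c) z)" if "z \<in> ?D c" for z
      proof -
        have x: "chart_inv c z \<in> fst c" "chart_inv c z \<in> U" "chart_inv c z \<in> fst c \<inter> U" using inv[OF that] by auto
        note fd = f_diff[OF c(1) x(3)] and wd = w_diff[OF c(1) x(3)]
        have "dir (f \<circ> chart_inv c) z (W c z) = grad_inner A g w f (chart_inv c z)"
          using grad_inner_chart[OF c(1) x(1) wd fd] inv(2)[OF that] by (simp add: W_def)
        also have "\<dots> = grad_inner A g f w (chart_inv c z)"
          by (rule grad_inner_commute)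
        also have "\<dots> = - (m - N) * \<psi> (chart_inv c z)" by (rule grad_f_w[OF x(2)])
        finally show ?thesis by (simp add: psi_C[OF x(2)])
      qed
      have norm_W: "dir (w \<circ> chart_inv c) z (W c z) = C * (w \<circ> chart_inv c) z - k * ((w \<circ> chart_inv c) z)\<^sup>2"
        if "z \<in> ?D c" for z
        using n_chart[OF c(1) inv(1)[OF that]] inv[OF that] n_C[of "chart_inv c z"] by (simp add: W_def)
      have conf': "\<xi> \<bullet> (dir (g c \<circ> chart_inv c) z (W c z) *v \<eta>) + dir (W c) z \<xi> \<bullet> ((g c \<circ> chart_inv c) z *v \<eta>) +
        \<xi> \<bullet> ((g c \<circ> chart_inv c) z *v dir (W c) z \<eta>) =
        2 * (C / 2 - k * (w \<circ> chart_inv c) z) * (\<xi> \<bullet> ((g c \<circ> chart_inv c) z *v \<eta>))" if "z \<in> ?D c" for z \<xi> \<eta>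
        using conf[OF c(1) that, of \<xi> \<eta>] psi_C[of "chart_inv c z"] inv[OF that] by simp
      have w_pos': "(w \<circ> chart_inv c) z > 0" and W_nz: "W c z \<noteq> 0" if "z \<in> ?D c" for z
        using w_pos[OF Up, of "chart_inv c z"] grad_w_nz[OF c(1) inv(1)[OF that]] inv[OF that] by (auto simp: W_def)
      have smooth: "smooth_on (?D c) (w \<circ> chart_inv c)" "smooth_on (?D c) (f \<circ> chart_inv c)"
        using w_Ck[OF c(1)] f_Ck[OF c(1)] by (auto simp: smooth_on_def)
      obtain V T \<alpha> \<beta> and \<Omega> :: "(real^'k) set" and Y :: "real^'n \<Rightarrow> real^'k" and E g\<^sub>\<Sigma> f\<^sub>\<Sigma> where
        V: "open V" "snd c q \<in> V" "V \<subseteq> ?D c" "open \<Omega>" "{\<alpha><..<\<beta>} \<subseteq> {0<..<pi / sqrt k}"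
        and hom: "homeomorphism V ({\<alpha><..<\<beta>} \<times> \<Omega>) (\<lambda>z. (T z, Y z)) E"
        and TYE: "smooth_on V T" "smooth_on V Y" "smooth_on ({\<alpha><..<\<beta>} \<times> \<Omega>) E"
        and T_eq: "\<And>z. T z = warp_time C k ((w \<circ> chart_inv c) z)"
        and wT: "\<And>z. z \<in> V \<Longrightarrow> (w \<circ> chart_inv c) z = warp_profile C k (T z)"
        and T_dir: "\<And>z v. z \<in> V \<Longrightarrow> dir T z v = dir (w \<circ> chart_inv c) z v / warp_slope C k (T z)"
        and g\<Sigma>: "metric_components \<Omega> g\<^sub>\<Sigma>" and f\<Sigma>: "smooth_on \<Omega> f\<^sub>\<Sigma>"
        and g_form: "\<And>z \<xi> \<eta>. z \<in> V \<Longrightarrow> \<xi> \<bullet> ((g c \<circ> chart_inv c) z *v \<eta>) = dir T z \<xi> * dir T z \<eta> +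
          (warp_slope C k (T z))\<^sup>2 * (dir Y z \<xi> \<bullet> (g\<^sub>\<Sigma> (Y z) *v dir Y z \<eta>))"
        and f_form: "\<And>z. z \<in> V \<Longrightarrow> (f \<circ> chart_inv c) z = - (m - N) * ln (warp_slope C k (T z)) + f\<^sub>\<Sigma> (Y z)"
        by (rule warped_product_normal_form[OF dim(2) D[OF c(1)] z0 h_metric[OF c(1)] smooth C_pos params(2)
            dir_w conf' w_pos' W_nz norm_W dir_f]) blast+

      \<comment> \<open>Transport of the normal form from the chart to the manifold\<close>
      let ?B = "{\<alpha><..<\<beta>} \<times> \<Omega>"
      define V' where "V' = (fst c \<inter> U) \<inter> snd c -` V"
      \<comment> \<open>Defined from \<open>w\<close> rather than through \<open>snd c\<close>, so
        that \<open>T' \<circ> chart_inv c = T\<close> holds as an equation of functions, also off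
        the chart image.\<close>
      define T' where "T' = (\<lambda>x. warp_time C k (w x))"
      define Y' where "Y' = (\<lambda>x. Y (snd c x))"
      define F where "F = (\<lambda>x. (T' x, Y' x))"
      have V'_open: "open V'"
        unfolding V'_def
      proof (rule continuous_open_preimage)
        show "continuous_on (fst c \<inter> U) (snd c)"
          using chart_hom[OF c(1)] by (auto simp: homeomorphism_def intro: continuous_on_subset)
      qed (use chart_open[OF c(1)] U V in auto)
      have V': "x \<in> fst c" "x \<in> U" "snd c x \<in> V" "chart_inv c (snd c x) = x" if "x \<in> V'" for x
        using that c by (auto simp: V'_def)
      have T'_eq: "T' x = T (snd c x)" if "x \<in> V'" for x
        using V'[OF that] by (simp add: T'_def T_eq)
      have w_T': "w x = S (T' x)" if "x \<in> V'" for x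
        using wT[OF V'(3)[OF that]] V'[OF that] by (simp add: S T'_eq[OF that])
      have V_V': "chart_inv c z \<in> V'" if "z \<in> V" for z
      proof -
        have "z \<in> ?D c" using that V by blast
        then show ?thesis using inv[of z] that by (auto simp: V'_def)
      qed
      have hom_F: "homeomorphism V' ?B F (chart_inv c \<circ> E)"
      proof (rule homeomorphism_cong[OF homeomorphism_compose[OF _ hom, of V' "snd c" "chart_inv c"]])
        have "snd c ` V' = V"
        proof
          show "V \<subseteq> snd c ` V'"
          proof
            fix z assume "z \<in> V"
            then have "z \<in> ?D c" using V by blast
            then have "z = snd c (chart_inv c z)" using inv[of z] by simp
            then show "z \<in> snd c ` V'" using V_V'[OF \<open>z \<in> V\<close>] by (rule image_eqI)
          qed
        qed (use V' in auto)
        then show "homeomorphism V' V (snd c) (chart_inv c)"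
          using V' by (intro homeomorphism_of_subsets[OF chart_hom[OF c(1)], where T''="snd c ` fst c"]) auto
      qed (auto simp: F_def Y'_def T'_eq)
      \<comment> \<open>\<open>coordinates_on\<close> is phrased with \<open>inv_into\<close>, which
        on the box agrees with the inverse obtained by composition.\<close>
      have F_inv: "inv_into V' F p = (chart_inv c \<circ> E) p" if "p \<in> ?B" for p
      proof -
        have "inj_on F V'" using hom_F by (auto simp: homeomorphism_def intro: inj_on_inverseI)
        moreover have "(chart_inv c \<circ> E) p \<in> V'" "F ((chart_inv c \<circ> E) p) = p"
          using hom_F that unfolding homeomorphism_def by blast+
        ultimately show ?thesis by (metis inv_into_f_f)
      qed
      have hom_F': "homeomorphism V' ?B F (inv_into V' F)"
        by (rule homeomorphism_cong[OF hom_F]) (simp_all add: F_inv)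
      have V: "open V" "V \<subseteq> ?D c" "open \<Omega>" "{\<alpha><..<\<beta>} \<subseteq> {0<..<pi / sqrt k}" "snd c q \<in> V" by (fact V)+
      have T_Ck: "Ck_on r V T" and Y_Ck: "Ck_on r V Y" and E_Ck: "Ck_on r ?B E" for r
        using TYE by (auto simp: smooth_on_def)
      have trans: "Ck_on r (snd d ` (fst d \<inter> V')) (snd c \<circ> chart_inv d)" if d: "d \<in> A" for d r
        by (rule Ck_on_subset[OF transition_Ck[OF d c(1)]]) (use V' in auto)
      have T'_chart: "(T' \<circ> chart_inv d) z = T ((snd c \<circ> chart_inv d) z)"
        and Y'_chart: "(Y' \<circ> chart_inv d) z = Y ((snd c \<circ> chart_inv d) z)"
        and in_V: "(snd c \<circ> chart_inv d) z \<in> V" if d: "d \<in> A" and z: "z \<in> snd d ` (fst d \<inter> V')" for d z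
        using d z V'(3) T'_eq by (auto simp: Y'_def)
      \<comment> \<open>Seen from another chart \<open>d\<close>, both directions factor through the
        transition maps between \<open>c\<close> and \<open>d\<close>, which are smooth by the atlas
        condition.\<close>
      have coord: "coordinates_on A V' ?B F"
        unfolding coordinates_on_def smooth_fun_def smooth_on_def
      proof (intro conjI ballI allI)
        show "open V'" "open ?B" using V'_open V by (auto simp: open_Times)
        show "homeomorphism V' ?B F (inv_into V' F)" by (rule hom_F')
        fix d r assume d: "d \<in> A"
        have Od: "open (snd d ` (fst d \<inter> V'))" by (rule chart_image_open[OF d V'_open])
        have "Ck_on r (snd d ` (fst d \<inter> V')) (\<lambda>z. (T ((snd c \<circ> chart_inv d) z), Y ((snd c \<circ> chart_inv d) z)))"
          using in_V[OF d] by (intro Ck_on_Pair[OF Od] Ck_on_compose[OF Od T_Ck trans[OF d]] Ck_on_compose[OF Od Y_Ck trans[OF d]]) blast+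
        moreover have "(F \<circ> chart_inv d) z = (T ((snd c \<circ> chart_inv d) z), Y ((snd c \<circ> chart_inv d) z))"
          if "z \<in> snd d ` (fst d \<inter> V')" for z
          using T'_chart[OF d that] Y'_chart[OF d that] by (simp add: F_def)
        ultimately show "Ck_on r (snd d ` (fst d \<inter> V')) (F \<circ> chart_inv d)"
          by (rule Ck_on_eq[OF _ Od])
        let ?O = "F ` (V' \<inter> fst d)"
        have "openin (top_of_set ?B) ?O"
          by (rule homeomorphism_imp_open_map[OF hom_F']) (use V'_open chart_open[OF d] in \<open>auto simp: openin_open\<close>)
        then have O: "open ?O" using \<open>open ?B\<close> by (simp add: openin_open_eq)
        have O_in: "p \<in> ?B" "(chart_inv c \<circ> E) p \<in> V' \<inter> fst d" "E p \<in> snd c ` (fst c \<inter> fst d)" if p: "p \<in> ?O" for p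
        proof -
          obtain x where x: "x \<in> V'" "x \<in> fst d" "p = F x" using p by blast
          then have *: "p \<in> ?B" "(chart_inv c \<circ> E) p = x" using hom_F unfolding homeomorphism_def by blast+
          then show "p \<in> ?B" "(chart_inv c \<circ> E) p \<in> V' \<inter> fst d" using x by auto
          have "E p \<in> V" using hom *(1) unfolding homeomorphism_def by blast
          then have "E p \<in> ?D c" using V by blast
          then have "E p = snd c x" using inv(2)[of "E p"] *(2) by simp
          then show "E p \<in> snd c ` (fst c \<inter> fst d)" using x V'(1)[OF x(1)] by blast
        qed
        have "Ck_on r ?O (\<lambda>p. (snd d \<circ> chart_inv c) (E p))"
          by (rule Ck_on_compose[OF O transition_Ck[OF c(1) d] Ck_on_subset[OF E_Ck]]) (use O_in in blast)+
        moreover have "(snd d \<circ> inv_into V' F) p = (snd d \<circ> chart_inv c) (E p)" if "p \<in> ?O" for p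
          using F_inv[OF O_in(1)[OF that]] by simp
        ultimately show "Ck_on r ?O (snd d \<circ> inv_into V' F)"
          by (rule Ck_on_eq[OF _ O])
      qed
      have slope_pos: "warp_slope C k (T' x) > 0" if "x \<in> V'" for x
      proof -
        have "T' x \<in> {\<alpha><..<\<beta>}" using hom_F that unfolding homeomorphism_def F_def by blast
        then show ?thesis using V by (intro warp_slope_pos C_pos params(2)) auto
      qed
      have T'_inv: "T' \<circ> chart_inv c = T"
        by (simp add: fun_eq_iff T_eq T'_def)
      have T_diff: "T differentiable (at z)" and Y_diff: "Y differentiable (at z)" if "z \<in> V" for z
        using Ck_on_differentiable[OF T_Ck that] Ck_on_differentiable[OF Y_Ck that] by auto
      \<comment> \<open>The differential of \<open>T'\<close> is that of \<open>w\<close> divided by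
        the positive slope, and \<open>grad w = 2 s grad s\<close>; so \<open>t\<close> increases in
        the direction of the gradient of \<open>s\<close>.\<close>
      have Tgrad: "grad_inner A g T' s x > 0" if x: "x \<in> V'" for x
      proof -
        have xU: "x \<in> fst c \<inter> U" "x \<in> fst c" "x \<in> U" using V'[OF x] by auto
        have s_diff: "(s \<circ> chart_inv c) differentiable (at (snd c x))"
          by (rule Ck_on_differentiable[OF s_Ck[OF c(1)]]) (use xU Up in auto)
        have "grad_inner A g T' s x = grad_inner A g s T' x" by (rule grad_inner_commute)
        also have "\<dots> = dir (T' \<circ> chart_inv c) (snd c x) (grad g c s x)"
          by (rule grad_inner_chart[OF c(1) xU(2) s_diff]) (simp add: T'_inv T_diff V'(3)[OF x])
        also have "\<dots> = dir (w \<circ> chart_inv c) (snd c x) (grad g c s x) / warp_slope C k (T' x)"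
          unfolding T'_inv T_dir[OF V'(3)[OF x]] T'_eq[OF x] ..
        also have "dir (w \<circ> chart_inv c) (snd c x) (grad g c s x) = 2 * s x * (grad g c s x \<bullet> (g c x *v grad g c s x))"
          unfolding dir_eq_inner_grad[OF c(1) xU(2) w_diff[OF c(1) xU(1)]] grad_w[OF c(1) xU(1)]
          by (simp add: matrix_vector_mult_scaleR)
        finally show ?thesis
          using slope_pos[OF x] s_pos[OF Up[OF xU(3)]] metric_pos[OF c(1) xU(2) grad_s[OF c(1), of x]] xU
          by simp
      qed
      have q_in: "q \<in> V'" using q c V by (simp add: V'_def)
      have F_in: "T' x \<in> {\<alpha><..<\<beta>}" "Y' x \<in> \<Omega>" "(chart_inv c \<circ> E) (T' x, Y' x) = x" if "x \<in> V'" for x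
        using hom_F that unfolding homeomorphism_def F_def by blast+
      have F_surj: "(chart_inv c \<circ> E) p \<in> V'" "T' ((chart_inv c \<circ> E) p) = fst p" "Y' ((chart_inv c \<circ> E) p) = snd p"
        if "p \<in> ?B" for p
      proof -
        show "(chart_inv c \<circ> E) p \<in> V'" using hom_F that unfolding homeomorphism_def by blast
        have "F ((chart_inv c \<circ> E) p) = p" using hom_F that unfolding homeomorphism_def by blast
        then show "T' ((chart_inv c \<circ> E) p) = fst p" "Y' ((chart_inv c \<circ> E) p) = snd p"
          by (simp_all add: F_def prod_eq_iff)
      qed
      \<comment> \<open>Level sets of \<open>s\<close> in \<open>V'\<close> are the slices of
        constant \<open>T'\<close>: one direction uses the positivity of \<open>s\<close>, the other
        that \<open>T'\<close> is a function of \<open>s\<^sup>2\<close>.\<close>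
      have level: "s x = s q \<longleftrightarrow> T' x = T' q" if "x \<in> V'" for x
      proof
        assume "T' x = T' q"
        then have "(s x)\<^sup>2 = (s q)\<^sup>2" using w_T'[OF that] w_T'[OF q_in] by (simp add: w_def)
        then show "s x = s q"
          using s_pos[OF Up[OF V'(2)[OF that]]] s_pos[OF Up[OF q]] by (simp add: power2_eq_iff_nonneg)
      qed (simp add: T'_def w_def)
      have bij: "bij_betw Y' {x \<in> V'. s x = s q} \<Omega>"
      proof (rule bij_betwI[where g="\<lambda>y. (chart_inv c \<circ> E) (T' q, y)"])
        show "Y' \<in> {x \<in> V'. s x = s q} \<rightarrow> \<Omega>" using F_in by blast
        have p: "(T' q, y) \<in> ?B" if "y \<in> \<Omega>" for y using F_in(1)[OF q_in] that by blast
        show "(\<lambda>y. (chart_inv c \<circ> E) (T' q, y)) \<in> \<Omega> \<rightarrow> {x \<in> V'. s x = s q}"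
          using F_surj[OF p] level by (simp add: Pi_iff)
        show "(chart_inv c \<circ> E) (T' q, Y' x) = x" if "x \<in> {x \<in> V'. s x = s q}" for x
          using F_in(3)[of x] level[of x] that by simp
        show "Y' ((chart_inv c \<circ> E) (T' q, y)) = y" if "y \<in> \<Omega>" for y
          using F_surj(3)[OF p[OF that]] by simp
      qed
      \<comment> \<open>The components in a chart \<open>d\<close> come from evaluating the bilinear
        identity of chart \<open>c\<close> on the images of the coordinate vectors of
        \<open>d\<close> under the Jacobian \<open>J\<close>.\<close>
      have g_eq: "g d x = (\<chi> i j. pd d i T' x * pd d j T' x)
          + (warp_slope C k (T' x))\<^sup>2 *\<^sub>R pullback d Y' (g\<^sub>\<Sigma> (Y' x)) x" if d: "d \<in> A" and x: "x \<in> V' \<inter> fst d" for d x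
      proof -
        have xV: "x \<in> V'" "x \<in> fst d" "x \<in> fst d \<inter> fst c" using x V' by auto
        define z where "z = snd c x"
        have z: "z \<in> V" "chart_inv c z = x" using V'[OF xV(1)] by (auto simp: z_def)
        define J where "J = dir (snd c \<circ> chart_inv d) (snd d x)"
        have pdT: "pd d i T' x = dir T z (J (axis i 1))" for i
          using chart_change(2)[OF d c(1) xV(3), of T'] T_diff[OF z(1)]
          by (simp add: pd_def T'_inv J_def z_def)
        have Ya: "((\<lambda>z. Y z $ a) has_derivative (\<lambda>v. dir Y z v $ a)) (at z)" for a
          by (intro bounded_linear.has_derivative[OF bounded_linear_vec_nth] has_derivative_dir Y_diff z)
        have Y'a: "(((\<lambda>y. Y' y $ a) \<circ> chart_inv c) has_derivative (\<lambda>v. dir Y z v $ a)) (at z)" for a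
        proof (rule iffD2[OF eq_on_open_derivative(1)[OF V(1) z(1)] Ya])
          fix y assume "y \<in> V"
          then have "y \<in> ?D c" using V by blast
          then show "((\<lambda>y. Y' y $ a) \<circ> chart_inv c) y = Y y $ a" using inv(2) by (simp add: Y'_def)
        qed
        have pdY: "pd d i (\<lambda>y. Y' y $ a) x = dir Y z (J (axis i 1)) $ a" for i a
          using chart_change(2)[OF d c(1) xV(3), of "\<lambda>y. Y' y $ a" "axis i 1"] differentiableI[OF Y'a] dir_eq[OF Y'a]
          by (simp add: pd_def J_def z_def)
        have ge: "g d x $ i $ j = dir T z (J (axis i 1)) * dir T z (J (axis j 1)) +
          (warp_slope C k (T z))\<^sup>2 * (dir Y z (J (axis i 1)) \<bullet> (g\<^sub>\<Sigma> (Y z) *v dir Y z (J (axis j 1))))" for i j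
        proof -
          have "g d x $ i $ j = axis i 1 \<bullet> (g d x *v axis j 1)"
            by (simp add: inner_axis' matrix_vector_mult_basis column_def)
          also have "\<dots> = J (axis i 1) \<bullet> (g c x *v J (axis j 1))"
            unfolding J_def by (rule metric_chart_change(1)[OF d c(1) xV(3)])
          finally show ?thesis
            using g_form[OF z(1), of "J (axis i 1)" "J (axis j 1)"] z(2) by simp
        qed
        have Y'x: "Y' x = Y z" by (simp add: Y'_def z_def)
        have pb: "pullback d Y' (g\<^sub>\<Sigma> (Y' x)) x $ i $ j = dir Y z (J (axis i 1)) \<bullet> (g\<^sub>\<Sigma> (Y z) *v dir Y z (J (axis j 1)))" for i j
          by (simp add: pullback_def pdY Y'x inner_vec_def matrix_vector_mult_def
              sum_distrib_left mult_ac)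
        show ?thesis
          using T'_eq[OF xV(1)] by (simp add: vec_eq_iff ge pdT pb z_def[symmetric])
      qed
      show "\<exists>(V :: 'a set) (T :: 'a \<Rightarrow> real) (Y :: 'a \<Rightarrow> real^'k) (\<alpha> :: real) (\<beta> :: real) (\<Omega> :: (real^'k) set)
       (S :: real \<Rightarrow> real) (t\<^sub>0 :: real) (g\<^sub>\<Sigma> :: real^'k \<Rightarrow> real^'k^'k) (f\<^sub>\<Sigma> :: real^'k \<Rightarrow> real).
      q \<in> V \<and> V \<subseteq> U \<and>
      coordinates_on A V ({\<alpha><..<\<beta>} \<times> \<Omega>) (\<lambda>x. (T x, Y x)) \<and>
      (\<forall>x\<in>V. grad_inner A g T s x > 0) \<and>
      bij_betw Y {x \<in> V. s x = s q} \<Omega> \<and>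
      metric_components \<Omega> g\<^sub>\<Sigma> \<and>
      smooth_on \<Omega> f\<^sub>\<Sigma> \<and>
      (\<forall>x\<in>V. (s x)\<^sup>2 = S (T x)) \<and>
      (\<forall>t\<in>{\<alpha><..<\<beta>}. S differentiable (at t) \<and> deriv S t > 0 \<and>
         (deriv S t)\<^sup>2 = C * S t - k * (S t)\<^sup>2 \<and>
         S t = C / k * (sin (sqrt k * (t - t\<^sub>0) / 2))\<^sup>2) \<and>
      (\<forall>d\<in>A. \<forall>x\<in>V \<inter> fst d.
         g d x = (\<chi> i j. pd d i T x * pd d j T x)
                 + (deriv S (T x))\<^sup>2 *\<^sub>R pullback d Y (g\<^sub>\<Sigma> (Y x)) x) \<and>
      (\<forall>x\<in>V. f x = - (m - real CARD('n)) * ln \<bar>deriv S (T x)\<bar> + f\<^sub>\<Sigma> (Y x)) \<and>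
      (\<forall>x\<in>V. (v x)\<^sup>2 = C)"
      proof (intro exI conjI)
        show "q \<in> V'" by (rule q_in)
        show "V' \<subseteq> U" using V' by blast
        show "coordinates_on A V' ?B (\<lambda>x. (T' x, Y' x))" using coord by (simp add: F_def)
        show "\<forall>x\<in>V'. grad_inner A g T' s x > 0" using Tgrad by blast
        show "bij_betw Y' {x \<in> V'. s x = s q} \<Omega>" by (rule bij)
        show "metric_components \<Omega> g\<^sub>\<Sigma>" "smooth_on \<Omega> f\<^sub>\<Sigma>" by (fact g\<Sigma> f\<Sigma>)+
        show "\<forall>x\<in>V'. (s x)\<^sup>2 = S (T' x)" using w_T' by (simp add: w_def)
        show "\<forall>t\<in>{\<alpha><..<\<beta>}. S differentiable (at t) \<and> deriv S t > 0 \<and>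
           (deriv S t)\<^sup>2 = C * S t - k * (S t)\<^sup>2 \<and> S t = C / k * (sin (sqrt k * (t - 0) / 2))\<^sup>2"
        proof (intro ballI conjI)
          fix t assume "t \<in> {\<alpha><..<\<beta>}"
          then have "0 < t" "t < pi / sqrt k" using V by auto
          then show "deriv S t > 0" unfolding S'(1) by (intro warp_slope_pos C_pos params(2))
          show "(deriv S t)\<^sup>2 = C * S t - k * (S t)\<^sup>2"
            unfolding S'(1) S by (rule warp_slope_square[OF params(2)])
        qed (auto simp: S'(2), simp add: S_def)
        show "\<forall>d\<in>A. \<forall>x\<in>V' \<inter> fst d. g d x = (\<chi> i j. pd d i T' x * pd d j T' x)
                 + (deriv S (T' x))\<^sup>2 *\<^sub>R pullback d Y' (g\<^sub>\<Sigma> (Y' x)) x"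
          using g_eq by (simp add: S'(1))
        show "\<forall>x\<in>V'. f x = - (m - real CARD('n)) * ln \<bar>deriv S (T' x)\<bar> + f\<^sub>\<Sigma> (Y' x)"
        proof
          fix x assume x: "x \<in> V'"
          show "f x = - (m - real CARD('n)) * ln \<bar>deriv S (T' x)\<bar> + f\<^sub>\<Sigma> (Y' x)"
            using f_form[OF V'(3)[OF x]] V'(4)[OF x] slope_pos[OF x] T'_eq[OF x]
            by (simp add: S'(1) N_def Y'_def)
        qed
        show "\<forall>x\<in>V'. (v x)\<^sup>2 = C" using C V' by blast
      qed
    qed
  qed
qed

end
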